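(* Let $H<\mathrm{GL}(d,\mathbb{R})$ be an admissible dilation group with open dual orbit $\mathcal{O}$. Assume that $\mathcal{O}$ is $(0,2,w)$-temperately embedded with index $\ell\in\mathbb{N}$, for the constant weight $w\equiv1$. Then any nonzero function $\psi\in L^1(\mathbb{R}^d)$ with vanishing moments in $\mathcal{O}^c$ of order $t>\ell+d/2+1$ and $|\widehat\psi|_{t,t}<\infty$ is admissible. Moreover, there exist admissible vectors $\psi\in C_c^\infty(\mathbb{R}^d)$.
   Context: Let $d>1$ and let $H$ be a closed subgroup of $\mathrm{GL}(d,\mathbb{R})$. $G=\mathbb{R}^d\rtimes H$ has product $(x,h)(y,g)=(x+hy,hg)$ and left Haar measure $|\det h|^{-1}\,dx\,dh$, with $dh$ left Haar measure on $H$. The quasi-regular representation is $[\pi(x,h)f](y)=|\det h|^{-1/2}f(h^{-1}(y-x))$ on $L^2(\mathbb{R}^d)$. A nonzero $\psi\in L^2(\mathbb{R}^d)$ is called admissible if $(x,h)\mapsto\langle\psi,\pi(x,h)\psi\rangle$ is in $L^2(G)$. $H$ is called an admissible dilation group if $\pi$ is irreducible and square-integrable, i.e. has at least one admissible vector. It is known that this holds iff the dual action $(\xi,h)\mapsto h^T\xi$ has a single open orbit $\mathcal{O}=\{h^T\xi_0:h\in H\}$ of full measure, with compact stabilizers; $\mathcal{O}$ is called the open dual orbit and $\mathcal{O}^c=\mathbb{R}^d\setminus\mathcal{O}$. Fourier transform: $\widehat f(\xi)=\int f(x)e^{-2\pi i\langle x,\xi\rangle}dx$. For $r,m>0$: $|g|_{r,m}=\sup_{x\in\mathbb{R}^d,|\alpha|\le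 r}(1+|x|)^m|\partial^\alpha g(x)|$, where $|\alpha|=\sum_i\alpha_i$ for multiindices and $|x|$ is the euclidean norm for vectors. Auxiliary function: $A(\xi)=\min\left(\frac{\mathrm{dist}(\xi,\mathcal{O}^c)}{1+\sqrt{|\xi|^2-\mathrm{dist}(\xi,\mathcal{O}^c)^2}},\frac1{1+|\xi|}\right)$ for $\xi\in\mathcal{O}$, with $\mathrm{dist}$ the euclidean distance. For a weight (continuous positive submultiplicative function) $w$ on $H$, $s\ge0$, $1\le q<\infty$, the orbit $\mathcal{O}$ is $(s,q,w)$-temperately embedded with index $\ell\in\mathbb{N}$ if for a fixed $\xi_0\in\mathcal{O}$ (the choice is immaterial): (i) $h\mapsto|\det h|^{1/2-1/q}(1+\|h\|)^{s+d+1}w(h)A(h^T\xi_0)^\ell$ is in $L^q(H)$, and (ii) $h\mapsto|\det h|^{-1/2-1/q}(1+\|h\|)^{s+d+1}w(h)A(h^{-T}\xi_0)^\ell$ is in $L^1(H)$; here $\|\cdot\|$ is any matrix norm, $h^{-T}$ is the transpose inverse, and $L^q(H)$ is with respect to left Haar measure. For $r\in\mathbb{N}$, $f\in L^1(\mathbb{R}^d)$ has vanishing moments in $\mathcal{O}^c$ of order $r$ if all distributional derivatives $\partial^\alpha\widehat f$ with $|\alpha|\le r$ are continuous functions, and all those with $|\alpha|<r$ vanish identically on $\mathcal{O}^c$. *)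

theory Defs
  imports "HOL-Analysis.Analysis"
begin

section \<open>Closed matrix groups and Haar measure\<close>

definition closed_matrix_group :: "(real^'n^'n) set \<Rightarrow> bool" where
  "closed_matrix_group H \<longleftrightarrow>
     H \<subseteq> {A. invertible A} \<and> mat 1 \<in> H \<and>
     (\<forall>g\<in>H. \<forall>h\<in>H. g ** h \<in> H) \<and> (\<forall>h\<in>H. matrix_inv h \<in> H) \<and>
     closedin (top_of_set {A. invertible A}) H"

text \<open>A closed matrix group is locally compact and second countable, so a left-invariant Borel
  measure that is finite on compact sets and nonzero is automatically regular, i.e. it is a left
  Haar measure, unique up to a positive factor.\<close>

definition left_haar_measure :: "(real^'n^'n) set \<Rightarrow> (real^'n^'n) measure \<Rightarrow> bool" where
  "left_haar_measure H \<mu> \<longleftrightarrow>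
     sets \<mu> = sets (restrict_space borel H) \<and>
     (\<forall>g\<in>H. \<forall>B\<in>sets \<mu>. emeasure \<mu> ((\<lambda>h. g ** h) ` B) = emeasure \<mu> B) \<and>
     (\<forall>K. compact K \<and> K \<subseteq> H \<longrightarrow> emeasure \<mu> K < \<infinity>) \<and>
     emeasure \<mu> H \<noteq> 0"

text \<open>The left Haar measure \<open>|det h|\<^sup>-\<^sup>1 dx dh\<close> of the semidirect product of \<open>\<real>\<^sup>d\<close> and \<open>H\<close>.\<close>

definition affine_haar_measure :: "(real^'n^'n) measure \<Rightarrow> ((real^'n) \<times> (real^'n^'n)) measure" where
  "affine_haar_measure \<mu> =
     density (lborel \<Otimes>\<^sub>M \<mu>) (\<lambda>(x, h). ennreal (1 / \<bar>det h\<bar>))"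

section \<open>The quasi-regular representation\<close>

text \<open>Elements of \<open>L\<^sup>p\<close> are represented by functions; almost everywhere equality is made explicit
  wherever it matters.\<close>

definition in_Lp :: "real \<Rightarrow> 'a measure \<Rightarrow> ('a \<Rightarrow> 'b::{banach, second_countable_topology}) \<Rightarrow> bool" where
  "in_Lp p M f \<longleftrightarrow> f \<in> borel_measurable M \<and> integrable M (\<lambda>x. norm (f x) powr p)"

definition L2_inner :: "(real^'n \<Rightarrow> complex) \<Rightarrow> (real^'n \<Rightarrow> complex) \<Rightarrow> complex" where
  "L2_inner f g = (LINT x|lebesgue. f x * cnj (g x))"

definition quasi_regular ::
    "real^'n \<Rightarrow> real^'n^'n \<Rightarrow> (real^'n \<Rightarrow> complex) \<Rightarrow> (real^'n \<Rightarrow> complex)" where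
  "quasi_regular x h f =
     (\<lambda>y. complex_of_real (\<bar>det h\<bar> powr (-1/2)) * f (matrix_inv h *v (y - x)))"

text \<open>Taking \<open>u\<close> constant in the last clause shows that a closed subspace is saturated under
  almost everywhere equality.\<close>

definition closed_L2_subspace :: "(real^'n \<Rightarrow> complex) set \<Rightarrow> bool" where
  "closed_L2_subspace S \<longleftrightarrow>
     S \<subseteq> {f. in_Lp 2 lebesgue f} \<and> (\<lambda>x. 0) \<in> S \<and>
     (\<forall>f\<in>S. \<forall>g\<in>S. (\<lambda>x. f x + g x) \<in> S) \<and>
     (\<forall>c. \<forall>f\<in>S. (\<lambda>x. c * f x) \<in> S) \<and>
     (\<forall>u f. (\<forall>k::nat. u k \<in> S) \<and> in_Lp 2 lebesgue f \<and>
        (\<lambda>k. LINT x|lebesgue. (norm (u k x - f x))\<^sup>2) \<longlonglongrightarrow> 0 \<longrightarrow> f \<in> S)"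

definition quasi_regular_irreducible :: "(real^'n^'n) set \<Rightarrow> bool" where
  "quasi_regular_irreducible H \<longleftrightarrow>
     (\<forall>S. closed_L2_subspace S \<and> (\<forall>x. \<forall>h\<in>H. \<forall>f\<in>S. quasi_regular x h f \<in> S) \<longrightarrow>
        (\<forall>f\<in>S. AE x in lebesgue. f x = 0) \<or> S = {f. in_Lp 2 lebesgue f})"

definition admissible_vector :: "(real^'n^'n) measure \<Rightarrow> (real^'n \<Rightarrow> complex) \<Rightarrow> bool" where
  "admissible_vector \<mu> \<psi> \<longleftrightarrow>
     in_Lp 2 lebesgue \<psi> \<and> \<not> (AE x in lebesgue. \<psi> x = 0) \<and>
     in_Lp 2 (affine_haar_measure \<mu>) (\<lambda>(x, h). L2_inner \<psi> (quasi_regular x h \<psi>))"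

definition admissible_dilation_group ::
    "(real^'n^'n) set \<Rightarrow> (real^'n^'n) measure \<Rightarrow> bool" where
  "admissible_dilation_group H \<mu> \<longleftrightarrow>
     closed_matrix_group H \<and> quasi_regular_irreducible H \<and> (\<exists>\<psi>. admissible_vector \<mu> \<psi>)"

section \<open>The open dual orbit and temperate embedding\<close>

definition dual_orbit :: "(real^'n^'n) set \<Rightarrow> real^'n \<Rightarrow> (real^'n) set" where
  "dual_orbit H \<xi> = (\<lambda>h. transpose h *v \<xi>) ` H"

definition dual_stabilizer :: "(real^'n^'n) set \<Rightarrow> real^'n \<Rightarrow> (real^'n^'n) set" where
  "dual_stabilizer H \<xi> = {h \<in> H. transpose h *v \<xi> = \<xi>}"

text \<open>\<open>\<O>\<close> is the single open orbit of the dual action, of full measure, with compact stabilizers.\<close>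

definition open_dual_orbit :: "(real^'n^'n) set \<Rightarrow> (real^'n) set \<Rightarrow> bool" where
  "open_dual_orbit H \<O> \<longleftrightarrow>
     (\<exists>\<xi>\<^sub>0. \<O> = dual_orbit H \<xi>\<^sub>0) \<and> open \<O> \<and>
     (\<forall>\<xi>. open (dual_orbit H \<xi>) \<longrightarrow> dual_orbit H \<xi> = \<O>) \<and>
     - \<O> \<in> null_sets lebesgue \<and>
     (\<forall>\<xi>\<in>\<O>. compact (dual_stabilizer H \<xi>))"

text \<open>Junk values are harmless: \<open>0\<close> lies in the complement of an open dual orbit, which is therefore
  nonempty, and the radicand is nonnegative.\<close>

definition orbit_aux :: "(real^'n) set \<Rightarrow> real^'n \<Rightarrow> real" where
  "orbit_aux \<O> \<xi> =
     min (infdist \<xi> (- \<O>) / (1 + sqrt ((norm \<xi>)\<^sup>2 - (infdist \<xi> (- \<O>))\<^sup>2))) (1 / (1 + norm \<xi>))"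

definition weight_on :: "(real^'n^'n) set \<Rightarrow> (real^'n^'n \<Rightarrow> real) \<Rightarrow> bool" where
  "weight_on H w \<longleftrightarrow>
     continuous_on H w \<and> (\<forall>h\<in>H. w h > 0) \<and> (\<forall>g\<in>H. \<forall>h\<in>H. w (g ** h) \<le> w g * w h)"

text \<open>The matrix norm is the library one (Frobenius); all norms are equivalent, as are
  all choices of the base point \<open>\<xi>\<^sub>0\<close>.\<close>

definition temperately_embedded ::
    "(real^'n^'n) set \<Rightarrow> (real^'n^'n) measure \<Rightarrow> (real^'n) set \<Rightarrow>
     real \<Rightarrow> real \<Rightarrow> (real^'n^'n \<Rightarrow> real) \<Rightarrow> nat \<Rightarrow> bool" where
  "temperately_embedded H \<mu> \<O> s q w l \<longleftrightarrow>
     0 \<le> s \<and> 1 \<le> q \<and> weight_on H w \<and>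
     (\<exists>\<xi>\<^sub>0\<in>\<O>.
        in_Lp q \<mu> (\<lambda>h. \<bar>det h\<bar> powr (1/2 - 1/q) * (1 + norm h) powr (s + real CARD('n) + 1)
                         * w h * orbit_aux \<O> (transpose h *v \<xi>\<^sub>0) ^ l) \<and>
        in_Lp 1 \<mu> (\<lambda>h. \<bar>det h\<bar> powr (-1/2 - 1/q) * (1 + norm h) powr (s + real CARD('n) + 1)
                         * w h * orbit_aux \<O> (transpose (matrix_inv h) *v \<xi>\<^sub>0) ^ l))"

section \<open>Multiindex derivatives, Schwartz norms and vanishing moments\<close>

definition partial_deriv :: "'n \<Rightarrow> (real^'n \<Rightarrow> complex) \<Rightarrow> (real^'n \<Rightarrow> complex)" where
  "partial_deriv i f = (\<lambda>x. vector_derivative (\<lambda>s::real. f (x + s *\<^sub>R axis i 1)) (at 0))"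

definition iter_partial_deriv :: "'n list \<Rightarrow> (real^'n \<Rightarrow> complex) \<Rightarrow> (real^'n \<Rightarrow> complex)" where
  "iter_partial_deriv js f = foldr partial_deriv js f"

definition multi_order :: "('n::finite \<Rightarrow> nat) \<Rightarrow> nat" where
  "multi_order \<alpha> = (\<Sum>i\<in>UNIV. \<alpha> i)"

text \<open>The coordinates \<open>'n\<close> carry no order, so some order of differentiation is chosen. It is
  immaterial for functions whose partial derivatives up to order \<open>multi_order \<alpha>\<close> are continuous.\<close>

definition multi_deriv :: "('n::finite \<Rightarrow> nat) \<Rightarrow> (real^'n \<Rightarrow> complex) \<Rightarrow> (real^'n \<Rightarrow> complex)" where
  "multi_deriv \<alpha> f = iter_partial_deriv (SOME js. \<forall>i. count_list js i = \<alpha> i) f"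

definition smooth :: "(real^'n \<Rightarrow> complex) \<Rightarrow> bool" where
  "smooth f \<longleftrightarrow> (\<forall>js x. iter_partial_deriv js f differentiable (at x))"

text \<open>The space \<open>C\<^sub>c\<^sup>\<infinity>(\<real>\<^sup>d)\<close>.\<close>

definition test_function :: "(real^'n \<Rightarrow> complex) \<Rightarrow> bool" where
  "test_function f \<longleftrightarrow> smooth f \<and> compact (closure {x. f x \<noteq> 0})"

text \<open>\<open>g\<close> is the distributional derivative \<open>\<partial>\<^sup>\<alpha>f\<close>; meaningful for locally integrable \<open>f\<close>, \<open>g\<close>.\<close>

definition distr_deriv ::
    "('n::finite \<Rightarrow> nat) \<Rightarrow> (real^'n \<Rightarrow> complex) \<Rightarrow> (real^'n \<Rightarrow> complex) \<Rightarrow> bool" where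
  "distr_deriv \<alpha> f g \<longleftrightarrow>
     (\<forall>\<phi>. test_function \<phi> \<longrightarrow>
        (LINT x|lebesgue. g x * \<phi> x) =
          (-1) ^ multi_order \<alpha> * (LINT x|lebesgue. f x * multi_deriv \<alpha> \<phi> x))"

definition fourier :: "(real^'n \<Rightarrow> complex) \<Rightarrow> (real^'n \<Rightarrow> complex)" where
  "fourier f = (\<lambda>\<xi>. LINT x|lebesgue. f x * cis (- 2 * pi * (x \<bullet> \<xi>)))"

definition schwartz_norm :: "real \<Rightarrow> real \<Rightarrow> (real^'n \<Rightarrow> complex) \<Rightarrow> ennreal" where
  "schwartz_norm r m g =
     (SUP x. SUP \<alpha>\<in>{\<alpha>. real (multi_order \<alpha>) \<le> r}.
        ennreal ((1 + norm x) powr m * norm (multi_deriv \<alpha> g x)))"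

text \<open>A continuous representative of a distributional derivative is unique.\<close>

definition vanishing_moments :: "(real^'n) set \<Rightarrow> nat \<Rightarrow> (real^'n \<Rightarrow> complex) \<Rightarrow> bool" where
  "vanishing_moments Z r f \<longleftrightarrow>
     integrable lebesgue f \<and>
     (\<forall>\<alpha>. multi_order \<alpha> \<le> r \<longrightarrow>
        (\<exists>g. distr_deriv \<alpha> (fourier f) g \<and> continuous_on UNIV g \<and>
             (multi_order \<alpha> < r \<longrightarrow> (\<forall>\<xi>\<in>Z. g \<xi> = 0))))"

end

theory Submission
  imports Defs "HOL-Probability.Probability"
begin

text \<open>Admissibility is a decay property of the Fourier transform. For fixed \<open>h\<close> the coefficient
  \<open>x \<mapsto> \<langle>\<psi>, \<pi>(x, h)\<psi>\<rangle>\<close> is a convolution, so Plancherel and the left invariance of Haar measure bound its squared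
  \<open>L\<^sup>2\<close>-norm over the semidirect product by \<open>\<parallel>\<psi>^\<parallel>\<^sup>2 \<integral>\<^bsub>H\<^esub> |\<psi>^(h\<^sup>T\<xi>\<^sub>0)|\<^sup>2 dh\<close>, where \<open>\<psi>^\<close> is the transform of \<open>\<psi>\<close> and
  \<open>\<xi>\<^sub>0\<close> any point of the orbit (lemma \<open>admissible_vectorI\<close>). Condition (i) of temperate embedding says, for
  exponent 2, that the integral is finite as soon as \<open>|\<psi>^| \<le> C A\<^sup>l\<close> on the orbit
  (\<open>temperate_integral_finite\<close>). Both parts of the theorem provide such a bound.

  In the first part the transform vanishes to order \<open>t\<close> on the complement of the orbit and its derivatives up
  to order \<open>t\<close> decay like \<open>(1 + |\<xi>|)\<^sup>-\<^sup>t\<close>. The derivatives are given as continuous distributional ones;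
  mollification shows that they are classical (\<open>weak_derivative_line\<close>). The complement is a
  closed cone, hence the segment from \<open>\<xi>\<close> to its nearest point \<open>\<eta>\<close> in the complement is orthogonal to \<open>\<eta>\<close> and stays
  outside the ball of radius \<open>|\<eta>|\<close>. Integrating \<open>t\<close> times along it gives \<open>|\<psi>^(\<xi>)| \<le> C (|\<xi> - \<eta>| / (1 + |\<eta>|))\<^sup>t\<close>
  (\<open>vanishing_moments_estimate\<close>), and by Pythagoras \<open>|\<xi> - \<eta>| / (1 + |\<eta>|)\<close> is the first term in the minimum
  defining \<open>A\<close> (\<open>orbit_aux_bounds\<close>). The second term is the plain decay of \<open>\<psi>^\<close>, which together with
  \<open>t > d/2 + 1\<close> also makes \<open>\<psi>^\<close> square integrable.

  For the second part one needs a compactly supported function whose transform vanishes to order \<open>l\<close>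
  on the complement. There is a nonzero polynomial \<open>P\<close> that vanishes there (\<open>orbit_complement_polynomial\<close>), and
  a differential operator applied to a bump function \<open>f\<close> has transform \<open>P\<^sup>l f^\<close>, which satisfies
  the bound because \<open>f^\<close> decays faster than any polynomial (\<open>test_function_candidate\<close>). The polynomial is
  the determinant of the vectors \<open>X\<^sub>i\<^sup>T\<xi>\<close> for suitable \<open>X\<^sub>i\<close> in the Lie algebra of \<open>H\<close>. Where these vectors are independent the
  orbit is open, and there is only one open orbit; and as the Lie algebra moves \<open>\<xi>\<^sub>0\<close> in all directions, \<open>X\<^sub>i\<close> can be chosen such that the
  determinant is 1 at \<open>\<xi>\<^sub>0\<close>. The last fact (\<open>lie_algebra_acts_transitively\<close>) is where
  compactness of the stabilizers enters; its proof combines a Baire category argument with limits of tangent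
  directions.\<close>

section \<open>Matrix calculus and the matrix exponential\<close>

lemma norm_matrix_squared:
  fixes A :: "real^'n^'m"
  shows "(norm A)\<^sup>2 = (\<Sum>i\<in>UNIV. \<Sum>j\<in>UNIV. (A $ i $ j)\<^sup>2)"
  unfolding power2_norm_eq_inner by (simp add: inner_vec_def power2_eq_square)

text \<open>Row times column is an inner product, so this is the Cauchy--Schwarz inequality in every entry.\<close>

lemma norm_matrix_mult_le:
  fixes A B :: "real^'n^'n"
  shows "norm (A ** B) \<le> norm A * norm B"
proof -
  have "(norm (A ** B))\<^sup>2 = (\<Sum>i\<in>UNIV. \<Sum>j\<in>UNIV. ((A $ i) \<bullet> (column j B))\<^sup>2)"
    unfolding norm_matrix_squared
    by (simp add: matrix_matrix_mult_def inner_vec_def column_def)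
  also have "\<dots> \<le> (\<Sum>i\<in>UNIV. \<Sum>j\<in>UNIV. (norm (A $ i))\<^sup>2 * (norm (column j B))\<^sup>2)"
    by (intro sum_mono) (simp add: Cauchy_Schwarz_ineq power2_norm_eq_inner)
  also have "\<dots> = (\<Sum>i\<in>UNIV. (norm (A $ i))\<^sup>2) * (\<Sum>j\<in>UNIV. (norm (column j B))\<^sup>2)"
    by (simp add: sum_product)
  also have "(\<Sum>i\<in>UNIV. (norm (A $ i))\<^sup>2) = (norm A)\<^sup>2"
    unfolding power2_norm_eq_inner by (simp add: inner_vec_def)
  also have "(\<Sum>j\<in>UNIV. (norm (column j B))\<^sup>2) = (norm B)\<^sup>2"
    unfolding norm_matrix_squared power2_norm_eq_inner
    by (subst sum.swap) (simp add: inner_vec_def column_def power2_eq_square)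
  finally have "(norm (A ** B))\<^sup>2 \<le> (norm A * norm B)\<^sup>2"
    by (simp add: power_mult_distrib)
  then show ?thesis
    by (rule power2_le_imp_le) simp
qed

lemma bounded_bilinear_matrix_mult:
  "bounded_bilinear ((**) :: real^'n^'n \<Rightarrow> real^'n^'n \<Rightarrow> real^'n^'n)"
proof
  show "\<exists>K. \<forall>a b. norm ((a :: real^'n^'n) ** (b :: real^'n^'n)) \<le> norm a * norm b * K"
    by (rule exI[of _ 1]) (use norm_matrix_mult_le in auto)
qed (simp_all add: vec_eq_iff matrix_matrix_mult_def sum.distrib sum_distrib_left algebra_simps)

interpretation matrix_mult: bounded_bilinear
  "(**) :: real^'n^'n \<Rightarrow> real^'n^'n \<Rightarrow> real^'n^'n"
  by (rule bounded_bilinear_matrix_mult)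

lemma bounded_linear_transpose_apply:
  fixes v :: "real^'n"
  shows "bounded_linear (\<lambda>A :: real^'n^'n. transpose A *v v)"
  by (rule linear_conv_bounded_linear[THEN iffD1])
     (auto intro!: linearI simp: vec_eq_iff matrix_vector_mult_def transpose_def sum.distrib
        sum_distrib_left algebra_simps)

lemma continuous_on_det: "continuous_on S (det :: real^'n^'n \<Rightarrow> real)"
  unfolding det_def by (intro continuous_intros)

lemma matrix_inv_inverse:
  fixes A :: "real^'n^'n"
  assumes "invertible A"
  shows "A ** matrix_inv A = mat 1" "matrix_inv A ** A = mat 1"
  using someI_ex[OF assms[unfolded invertible_def]] by (simp_all add: matrix_inv_def)

lemma continuous_on_matrix_inv: "continuous_on {A :: real^'n^'n. invertible A} matrix_inv"
proof -
  define C :: "real^'n^'n \<Rightarrow> real^'n^'n" where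
    "C A = (\<chi> k l. det (\<chi> i j. if j = k then axis l 1 $ i else A $ i $ j) / det A)" for A
  have eq: "matrix_inv A = C A" if "invertible A" for A :: "real^'n^'n"
  proof -
    have d: "det A \<noteq> 0" using that by (simp add: invertible_det_nz)
    have "column l (matrix_inv A) = column l (C A)" for l
    proof -
      have "A *v (matrix_inv A *v axis l 1) = axis l 1"
        using that by (simp add: matrix_vector_mul_assoc matrix_inv_inverse)
      then have "matrix_inv A *v axis l 1
          = (\<chi> k. det (\<chi> i j. if j = k then axis l 1 $ i else A $ i $ j) / det A)"
        using cramer[OF d] by blast
      then show ?thesis
        by (simp add: C_def matrix_vector_mult_basis column_def)
    qed
    then show ?thesis by (simp add: column_def vec_eq_iff)
  qed
  have c: "continuous_on S (\<lambda>x :: real^'n^'n. if j = k then a else x $ i $ j)"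
    for S i and j k :: 'n and a :: real
    by (cases "j = k") (auto intro!: continuous_intros)
  have "continuous_on {A :: real^'n^'n. invertible A} C"
    unfolding C_def det_def
    apply (intro continuous_on_vec_lambda continuous_intros)
    subgoal by (rule c)
    subgoal by (auto simp: invertible_det_nz det_def)
    done
  then show ?thesis
    using eq by (subst continuous_on_cong[OF refl]) auto
qed

lemma tendsto_matrix_inv:
  fixes f :: "'a \<Rightarrow> real^'n^'n"
  assumes "(f \<longlongrightarrow> L) F" "invertible L"
  shows "((\<lambda>x. matrix_inv (f x)) \<longlongrightarrow> matrix_inv L) F"
proof -
  have "open {A :: real^'n^'n. invertible A}"
    using open_Collect_neq[OF continuous_on_det[of UNIV] continuous_on_const[of UNIV 0]]
    by (simp add: invertible_det_nz)
  then have "isCont matrix_inv L"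
    using continuous_on_matrix_inv[where 'n='n] assms(2)
    by (metis continuous_on_eq_continuous_at mem_Collect_eq)
  then show ?thesis using assms(1) by (rule isCont_tendsto_compose)
qed

primrec mpow :: "real^'n^'n \<Rightarrow> nat \<Rightarrow> real^'n^'n" where
  "mpow X 0 = mat 1"
| "mpow X (Suc k) = X ** mpow X k"

definition mexp :: "real^'n^'n \<Rightarrow> real^'n^'n" where
  "mexp X = (\<Sum>k. (1 / fact k) *\<^sub>R mpow X k)"

lemma norm_mpow_le: "norm (mpow X k) \<le> norm (mat 1 :: real^'n^'n) * norm X ^ k"
  for X :: "real^'n^'n"
proof (induction k)
  case (Suc k)
  have "norm (mpow X (Suc k)) \<le> norm X * norm (mpow X k)"
    by (simp add: norm_matrix_mult_le)
  also have "\<dots> \<le> norm X * (norm (mat 1 :: real^'n^'n) * norm X ^ k)"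
    by (intro mult_left_mono Suc) auto
  finally show ?case by (simp add: ac_simps)
qed simp

lemma mpow_commute: "mpow X k ** X = X ** mpow X k"
  by (induction k) (simp_all flip: matrix_mul_assoc)

lemma mpow_scaleR: "mpow (c *\<^sub>R X) k = c ^ k *\<^sub>R mpow X k" for X :: "real^'n^'n"
  by (induction k) (simp_all add: matrix_mult.scaleR_left matrix_mult.scaleR_right)

text \<open>A series is an integral over counting measure, which makes this an instance of dominated convergence.\<close>

lemma suminf_tendsto_dominated:
  fixes a :: "nat \<Rightarrow> nat \<Rightarrow> 'b::{banach, second_countable_topology}"
  assumes "\<And>k. (\<lambda>n. a n k) \<longlonglongrightarrow> b k"
    and bd: "\<And>n k. norm (a n k) \<le> M k" and M: "summable M"
  shows "(\<lambda>n. \<Sum>k. a n k) \<longlonglongrightarrow> (\<Sum>k. b k)"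
proof -
  have M0: "M k \<ge> 0" for k using bd[of 0 k] norm_ge_zero order_trans by blast
  have iM: "integrable (count_space UNIV) M"
    using M M0 by (simp add: integrable_count_space_nat_iff)
  have ib: "integrable (count_space UNIV) b"
    and lim: "(\<lambda>n. LINT k|count_space UNIV. a n k) \<longlonglongrightarrow> (LINT k|count_space UNIV. b k)"
    and ia: "\<And>n. integrable (count_space UNIV) (a n)"
    using integrable_dominated_convergence[of b "count_space UNIV" a M]
      integral_dominated_convergence[of b "count_space UNIV" a M]
      integrable_dominated_convergence2[of b "count_space UNIV" a M]
      assms iM by auto
  show ?thesis using lim by (simp add: integral_count_space_nat ia ib)
qed

lemma binomial_ratio_tendsto:
  assumes m: "filterlim m at_top sequentially"
  shows "(\<lambda>n. real (m n choose k) / real (m n) ^ k) \<longlonglongrightarrow> 1 / fact k"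
proof -
  have lim0: "(\<lambda>n. real i / real (m n)) \<longlonglongrightarrow> 0" for i
    by (intro tendsto_divide_0[OF tendsto_const] filterlim_at_top_imp_at_infinity
        filterlim_compose[OF filterlim_real_sequentially m])
  have "(\<lambda>n. (\<Prod>i<k. 1 - real i / real (m n)) / fact k) \<longlonglongrightarrow> (\<Prod>i<k. 1 - 0) / fact k"
    by (intro tendsto_intros lim0) auto
  moreover have "eventually (\<lambda>n. (\<Prod>i<k. 1 - real i / real (m n)) / fact k
      = real (m n choose k) / real (m n) ^ k) sequentially"
  proof -
    have "eventually (\<lambda>n. m n > 0) sequentially"
      using eventually_compose_filterlim[OF eventually_gt_at_top m] .
    then show ?thesis
    proof eventually_elim
      case (elim n)
      have "real (m n choose k) = (\<Prod>i<k. real (m n) - real i) / fact k"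
        by (simp add: binomial_gbinomial gbinomial_prod_rev atLeast0LessThan)
      moreover have "(\<Prod>i<k. 1 - real i / real (m n)) * real (m n) ^ k
          = (\<Prod>i<k. real (m n) - real i)"
        using elim by (induction k) (simp_all add: field_simps)
      ultimately show ?case using elim by (simp add: field_simps)
    qed
  qed
  ultimately show ?thesis by (simp add: tendsto_cong)
qed

lemma mpow_one_plus:
  fixes Y :: "real^'n^'n"
  shows "mpow (mat 1 + Y) m = (\<Sum>k\<le>m. real (m choose k) *\<^sub>R mpow Y k)"
proof (induction m)
  case (Suc m)
  have "mpow (mat 1 + Y) (Suc m)
      = (\<Sum>k\<le>m. real (m choose k) *\<^sub>R mpow Y k) + (\<Sum>k\<le>m. real (m choose k) *\<^sub>R mpow Y (Suc k))"
    by (simp add: Suc matrix_mult.add_left matrix_mult.sum_right matrix_mult.scaleR_right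
        scaleR_add_right sum.distrib)
  also have "(\<Sum>k\<le>m. real (m choose k) *\<^sub>R mpow Y k)
      = mpow Y 0 + (\<Sum>k\<le>m. real (m choose Suc k) *\<^sub>R mpow Y (Suc k))"
  proof -
    have "(\<Sum>k\<le>m. real (m choose k) *\<^sub>R mpow Y k) = (\<Sum>k\<le>Suc m. real (m choose k) *\<^sub>R mpow Y k)"
      by (simp add: binomial_eq_0)
    also have "\<dots> = mpow Y 0 + (\<Sum>k\<le>m. real (m choose Suc k) *\<^sub>R mpow Y (Suc k))"
      by (subst sum.atMost_Suc_shift) simp
    finally show ?thesis .
  qed
  also have "mpow Y 0 + (\<Sum>k\<le>m. real (m choose Suc k) *\<^sub>R mpow Y (Suc k))
        + (\<Sum>k\<le>m. real (m choose k) *\<^sub>R mpow Y (Suc k))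
      = (\<Sum>k\<le>Suc m. real (Suc m choose k) *\<^sub>R mpow Y k)"
    unfolding sum.atMost_Suc_shift[of "\<lambda>k. real (Suc m choose k) *\<^sub>R mpow Y k"]
    by (simp add: sum.distrib scaleR_add_left)
  finally show ?case .
qed simp

lemma summable_exp_bound: "summable (\<lambda>k. C * R ^ k / fact k)" for C R :: real
  unfolding times_divide_eq_right[symmetric]
  using summable_exp[of R] by (intro summable_mult) (simp add: divide_inverse mult.commute)

lemma norm_mexp_term_le:
  fixes X :: "real^'n^'n"
  assumes "norm X \<le> R" "0 \<le> c" "c \<le> 1 / fact k"
  shows "norm (c *\<^sub>R mpow X k) \<le> norm (mat 1 :: real^'n^'n) * R ^ k / fact k"
proof -
  have "norm (c *\<^sub>R mpow X k) \<le> (1 / fact k) * (norm (mat 1 :: real^'n^'n) * R ^ k)"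
  proof -
    have "norm (mpow X k) \<le> norm (mat 1 :: real^'n^'n) * R ^ k"
      using assms norm_mpow_le[of X k]
      by (meson mult_left_mono norm_ge_zero order_trans power_mono)
    then have "c * norm (mpow X k) \<le> (1 / fact k) * (norm (mat 1 :: real^'n^'n) * R ^ k)"
      using assms by (intro mult_mono) auto
    then show ?thesis using assms by simp
  qed
  then show ?thesis by simp
qed

lemma mpow_tendsto: "Y \<longlonglongrightarrow> X \<Longrightarrow> (\<lambda>n. mpow (Y n) k) \<longlonglongrightarrow> mpow X k" for X :: "real^'n^'n"
  by (induction k) (auto intro: matrix_mult.tendsto)

text \<open>On a bounded set of matrices the exponential series is dominated termwise by one scalar exponential
  series.\<close>

lemma tendsto_mexp:
  fixes X :: "real^'n^'n"
  assumes "Y \<longlonglongrightarrow> X"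
  shows "(\<lambda>n. mexp (Y n)) \<longlonglongrightarrow> mexp X"
proof -
  obtain R where R: "norm (Y n) \<le> R" for n
    using convergent_imp_bounded[OF assms] by (auto simp: bounded_iff)
  show ?thesis unfolding mexp_def
  proof (rule suminf_tendsto_dominated)
    show "summable (\<lambda>k. norm (mat 1 :: real^'n^'n) * R ^ k / fact k)"
      by (rule summable_exp_bound)
    show "norm ((1 / fact k) *\<^sub>R mpow (Y n) k) \<le> norm (mat 1 :: real^'n^'n) * R ^ k / fact k" for n k
      by (rule norm_mexp_term_le[OF R]) auto
    show "(\<lambda>n. (1 / fact k) *\<^sub>R mpow (Y n) k) \<longlonglongrightarrow> (1 / fact k) *\<^sub>R mpow X k" for k
      by (intro tendsto_intros mpow_tendsto assms)
  qed
qed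

text \<open>The matrix form of \<open>(1 + x/m)\<^sup>m \<longlonglongrightarrow> exp x\<close>: in the binomial expansion of \<open>(1 + Y/m)\<^sup>m\<close> the
  coefficient of \<open>Y\<^sup>k\<close> is at most \<open>1 / k!\<close> and converges to it, so dominated convergence applies. It is
  what turns a tangent direction of a group into a one-parameter subgroup.\<close>

lemma mpow_tendsto_mexp:
  fixes X :: "real^'n^'n"
  assumes m: "filterlim m at_top sequentially" and h: "(\<lambda>n. real (m n) *\<^sub>R (h n - mat 1)) \<longlonglongrightarrow> X"
  shows "(\<lambda>n. mpow (h n) (m n)) \<longlonglongrightarrow> mexp X"
proof -
  define Y where "Y n = real (m n) *\<^sub>R (h n - mat 1)" for n
  have YX: "Y \<longlonglongrightarrow> X" using h by (simp add: Y_def[abs_def])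
  obtain R where R: "norm (Y n) \<le> R" for n
    using convergent_imp_bounded[OF YX] by (auto simp: bounded_iff)
  define a where "a n k = (real (m n choose k) / real (m n) ^ k) *\<^sub>R mpow (Y n) k" for n k
  have "(\<lambda>n. \<Sum>k. a n k) \<longlonglongrightarrow> (\<Sum>k. (1 / fact k) *\<^sub>R mpow X k)"
  proof (rule suminf_tendsto_dominated[where M="\<lambda>k. norm (mat 1 :: real^'n^'n) * R ^ k / fact k"])
    fix n k
    have "real ((m n choose k) * fact k) \<le> real (m n ^ k)"
      using binomial_fact_pow[of "m n" k] of_nat_mono by blast
    then have "real (m n choose k) / real (m n) ^ k \<le> 1 / fact k"
      by (cases "m n = 0 \<and> k > 0") (auto simp: field_simps divide_le_eq)
    then show "norm (a n k) \<le> norm (mat 1 :: real^'n^'n) * R ^ k / fact k"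
      unfolding a_def by (intro norm_mexp_term_le R) auto
  next
    show "(\<lambda>n. a n k) \<longlonglongrightarrow> (1 / fact k) *\<^sub>R mpow X k" for k
      unfolding a_def by (intro tendsto_intros mpow_tendsto YX binomial_ratio_tendsto m)
  qed (rule summable_exp_bound)
  moreover have "eventually (\<lambda>n. (\<Sum>k. a n k) = mpow (h n) (m n)) sequentially"
  proof -
    have "eventually (\<lambda>n. m n > 0) sequentially"
      using eventually_compose_filterlim[OF eventually_gt_at_top m] .
    then show ?thesis
    proof eventually_elim
      case (elim n)
      have "h n = mat 1 + (1 / real (m n)) *\<^sub>R Y n"
        using elim by (simp add: Y_def)
      then have "mpow (h n) (m n) = (\<Sum>k\<le>m n. a n k)"
        unfolding a_def by (simp add: mpow_one_plus mpow_scaleR power_divide)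
      moreover have "(\<Sum>k. a n k) = (\<Sum>k\<le>m n. a n k)"
        by (rule suminf_finite) (auto simp: a_def binomial_eq_0)
      ultimately show ?case by simp
    qed
  qed
  ultimately show ?thesis by (simp add: tendsto_cong mexp_def)
qed

lemma mexp_sums: "(\<lambda>k. (1 / fact k) *\<^sub>R mpow X k) sums mexp X" for X :: "real^'n^'n"
  unfolding mexp_def
  by (rule summable_sums, rule summable_comparison_test'[OF summable_exp_bound])
     (rule norm_mexp_term_le[OF order.refl], auto)

lemma mexp_0 [simp]: "mexp (0 :: real^'n^'n) = mat 1"
proof -
  have "(1 / fact k) *\<^sub>R mpow 0 k = (if k = 0 then mat 1 else (0 :: real^'n^'n))" for k
    by (cases k) (auto simp: matrix_mult.zero_left)
  then show ?thesis
    using mexp_sums[of "0 :: real^'n^'n"] sums_If_finite_set[of "{0}" "\<lambda>_. mat 1 :: real^'n^'n"]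
    by (auto intro: sums_unique2)
qed

text \<open>The remainder starts at \<open>X\<^sup>2\<close>; for \<open>norm X \<le> 1\<close> all higher powers are absorbed by \<open>exp 1\<close>.\<close>

lemma mexp_first_order:
  fixes X :: "real^'n^'n"
  assumes "norm X \<le> 1"
  shows "norm (mexp X - mat 1 - X) \<le> norm (mat 1 :: real^'n^'n) * exp 1 * (norm X)\<^sup>2"
proof -
  let ?C = "norm (mat 1 :: real^'n^'n)"
  have s: "(\<lambda>k. (1 / fact (k + 2)) *\<^sub>R mpow X (k + 2)) sums (mexp X - mat 1 - X)"
  proof -
    have "(\<Sum>k<2. (1 / fact k) *\<^sub>R mpow X k) = mat 1 + X"
      by (simp add: numeral_2_eq_2 lessThan_Suc add.commute)
    then show ?thesis
      using sums_iff_shift'[of "\<lambda>k. (1 / fact k) *\<^sub>R mpow X k" 2 "mexp X"] mexp_sums[of X]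
      by (simp add: diff_diff_eq del: fact_Suc mpow.simps)
  qed
  have e: "(\<lambda>k. ?C * (norm X)\<^sup>2 * (1 / fact k)) sums (?C * (norm X)\<^sup>2 * exp 1)"
    using exp_converges[of "1::real"] by (intro sums_mult) (simp add: divide_inverse)
  have le: "norm ((1 / fact (k + 2)) *\<^sub>R mpow X (k + 2)) \<le> ?C * (norm X)\<^sup>2 * (1 / fact k)" for k
  proof -
    have "norm ((1 / fact (k + 2)) *\<^sub>R mpow X (k + 2)) \<le> (1 / fact k) * (?C * norm X ^ (k + 2))"
      using norm_mpow_le[of X "k+2"] fact_mono[of k "k+2", where 'a=real]
      by (auto intro!: frac_le simp del: fact_Suc mpow.simps)
    also have "(1 / fact k) * (?C * norm X ^ (k + 2)) \<le> (1 / fact k) * (?C * (norm X)\<^sup>2)"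
      using assms by (intro mult_left_mono power_decreasing) auto
    finally show ?thesis by (simp del: fact_Suc mpow.simps)
  qed
  have "norm (mexp X - mat 1 - X) = norm (\<Sum>k. (1 / fact (k + 2)) *\<^sub>R mpow X (k + 2))"
    by (subst sums_unique[OF s]) (rule refl)
  also have "\<dots> \<le> (\<Sum>k. ?C * (norm X)\<^sup>2 * (1 / fact k))"
    by (rule norm_suminf_le[OF le sums_summable[OF e]])
  also have "\<dots> = ?C * (norm X)\<^sup>2 * exp 1"
    by (rule sums_unique[OF e, symmetric])
  finally show ?thesis by (simp add: ac_simps)
qed

section \<open>The Lie algebra of a closed matrix group\<close>

text \<open>The dual action is written with the transpose; this rule would rewrite it to a row vector times a matrix.\<close>

declare transpose_matrix_vector [simp del]

lemma closed_matrix_groupD: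
  assumes "closed_matrix_group (H :: (real^'n^'n) set)"
  shows "mat 1 \<in> H" "\<And>g h. g \<in> H \<Longrightarrow> h \<in> H \<Longrightarrow> g ** h \<in> H"
    "\<And>h. h \<in> H \<Longrightarrow> matrix_inv h \<in> H" "\<And>h. h \<in> H \<Longrightarrow> invertible h"
    "\<And>h. h \<in> H \<Longrightarrow> h ** matrix_inv h = mat 1" "\<And>h. h \<in> H \<Longrightarrow> matrix_inv h ** h = mat 1"
    "\<And>h. h \<in> H \<Longrightarrow> det h \<noteq> 0"
  using assms matrix_inv_inverse unfolding closed_matrix_group_def
  by (auto simp: subset_eq simp flip: invertible_det_nz)

text \<open>A closed matrix group is closed relative to the invertible matrices only, so a limit has to be
  known to be invertible before it can be claimed for the group.\<close>

lemma closed_matrix_group_limit: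
  fixes H :: "(real^'n^'n) set"
  assumes H: "closed_matrix_group H" and "\<And>n. f n \<in> H" "f \<longlonglongrightarrow> L" "invertible L"
  shows "L \<in> H"
proof -
  obtain T where T: "closed T" "H = {A. invertible A} \<inter> T"
    using H unfolding closed_matrix_group_def closedin_closed by auto
  have "L \<in> T"
    using T assms by (metis IntD2 closed_sequentially)
  then show ?thesis using T assms by auto
qed

lemma mpow_in_group: "closed_matrix_group H \<Longrightarrow> h \<in> H \<Longrightarrow> mpow h k \<in> H"
  by (induction k) (auto simp: closed_matrix_groupD)

lemma mpow_matrix_inv:
  assumes "invertible (h :: real^'n^'n)"
  shows "mpow h k ** mpow (matrix_inv h) k = mat 1"
proof (induction k)
  case (Suc k)
  have "mpow h (Suc k) ** mpow (matrix_inv h) (Suc k)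
      = mpow h k ** (h ** matrix_inv h) ** mpow (matrix_inv h) k"
    by (simp add: matrix_mul_assoc flip: mpow_commute[of h k])
  then show ?case using Suc assms by (simp add: matrix_inv_inverse)
qed simp

text \<open>The description by one-parameter subgroups: it makes no reference to smoothness of the group, and
  closedness of the group alone turns it into a vector space.\<close>

definition lie_algebra :: "(real^'n^'n) set \<Rightarrow> (real^'n^'n) set" where
  "lie_algebra H = {X. \<forall>s. mexp (s *\<^sub>R X) \<in> H}"

lemma lie_algebra_scaleR: "X \<in> lie_algebra H \<Longrightarrow> c *\<^sub>R X \<in> lie_algebra H"
  by (simp add: lie_algebra_def)

text \<open>With \<open>m\<close> the integer part of \<open>s / e\<close>, the powers \<open>h\<^sup>m\<close> stay in the group and converge to \<open>mexp (s X)\<close>.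
  That limit is invertible because the powers of the inverses converge too, to its inverse.\<close>

lemma tangent_mexp_pos:
  fixes H :: "(real^'n^'n) set"
  assumes H: "closed_matrix_group H" and h: "\<And>n. h n \<in> H"
    and e: "\<And>n. e n > 0" "e \<longlonglongrightarrow> (0::real)" and X: "(\<lambda>n. (1 / e n) *\<^sub>R (h n - mat 1)) \<longlonglongrightarrow> X"
    and s: "s > 0"
  shows "mexp (s *\<^sub>R X) \<in> H"
proof -
  define m where "m n = nat \<lfloor>s / e n\<rfloor>" for n
  have hm: "h \<longlonglongrightarrow> mat 1"
  proof -
    have "(\<lambda>n. mat 1 + e n *\<^sub>R ((1 / e n) *\<^sub>R (h n - mat 1))) \<longlonglongrightarrow> mat 1 + 0 *\<^sub>R X"
      by (intro tendsto_intros e X)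
    moreover have "mat 1 + e n *\<^sub>R ((1 / e n) *\<^sub>R (h n - mat 1)) = h n" for n
      using e(1)[of n] by simp
    ultimately show ?thesis by simp
  qed
  have se: "filterlim (\<lambda>n. s / e n) at_top sequentially"
  proof -
    have "filterlim (\<lambda>n. inverse (e n)) at_top sequentially"
      using e by (intro filterlim_inverse_at_top) auto
    then show ?thesis
      using filterlim_tendsto_pos_mult_at_top[OF tendsto_const s] by (simp add: divide_inverse)
  qed
  have m: "filterlim m at_top sequentially"
    unfolding m_def
    by (rule filterlim_compose[OF filterlim_nat_sequentially])
       (rule filterlim_compose[OF filterlim_floor_sequentially se])
  have me: "(\<lambda>n. real (m n) * e n) \<longlonglongrightarrow> s"
  proof (rule tendsto_sandwich)
    have b: "s / e n - 1 \<le> real (m n)" "real (m n) \<le> s / e n" for n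
    proof -
      have "0 \<le> s / e n" using s e(1)[of n] by simp
      then have "real (m n) = real_of_int \<lfloor>s / e n\<rfloor>" by (simp add: m_def)
      then show "s / e n - 1 \<le> real (m n)" "real (m n) \<le> s / e n" by linarith+
    qed
    show "eventually (\<lambda>n. s - e n \<le> real (m n) * e n) sequentially"
      using b(1) e(1) by (intro always_eventually allI) (simp add: field_simps)
    show "eventually (\<lambda>n. real (m n) * e n \<le> s) sequentially"
      using b(2) e(1) by (intro always_eventually allI) (simp add: field_simps)
    show "(\<lambda>n. s - e n) \<longlonglongrightarrow> s" using tendsto_diff[OF tendsto_const e(2), of s] by simp
  qed auto
  have lim: "(\<lambda>n. real (m n) *\<^sub>R (h n - mat 1)) \<longlonglongrightarrow> s *\<^sub>R X"
  proof -
    have "(\<lambda>n. (real (m n) * e n) *\<^sub>R ((1 / e n) *\<^sub>R (h n - mat 1))) \<longlonglongrightarrow> s *\<^sub>R X"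
      by (intro tendsto_scaleR me X)
    moreover have "(real (m n) * e n) *\<^sub>R ((1 / e n) *\<^sub>R (h n - mat 1)) = real (m n) *\<^sub>R (h n - mat 1)" for n
      using e(1)[of n] by simp
    ultimately show ?thesis by (simp only:)
  qed
  have inv1: "invertible (mat 1 :: real^'n^'n)" by (auto simp: invertible_def)
  have i1: "matrix_inv (mat 1) = (mat 1 :: real^'n^'n)"
    using matrix_inv_inverse[OF inv1] by simp
  have hi: "(\<lambda>n. matrix_inv (h n)) \<longlonglongrightarrow> mat 1"
    using tendsto_matrix_inv[OF hm inv1] by (simp add: i1)
  have lim': "(\<lambda>n. real (m n) *\<^sub>R (matrix_inv (h n) - mat 1)) \<longlonglongrightarrow> - (s *\<^sub>R X)"
  proof -
    have "(\<lambda>n. - (matrix_inv (h n) ** (real (m n) *\<^sub>R (h n - mat 1)))) \<longlonglongrightarrow> - (mat 1 ** (s *\<^sub>R X))"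
      by (intro tendsto_minus matrix_mult.tendsto hi lim)
    moreover have "- (matrix_inv (h n) ** (real (m n) *\<^sub>R (h n - mat 1)))
        = real (m n) *\<^sub>R (matrix_inv (h n) - mat 1)" for n
      using closed_matrix_groupD(6)[OF H h[of n]]
      by (simp add: matrix_mult.scaleR_right matrix_mult.diff_right algebra_simps)
    ultimately show ?thesis by simp
  qed
  have "(\<lambda>n. mpow (h n) (m n) ** mpow (matrix_inv (h n)) (m n)) \<longlonglongrightarrow> mexp (s *\<^sub>R X) ** mexp (- (s *\<^sub>R X))"
    by (intro matrix_mult.tendsto mpow_tendsto_mexp m lim lim')
  moreover have "mpow (h n) (m n) ** mpow (matrix_inv (h n)) (m n) = mat 1" for n
    by (rule mpow_matrix_inv[OF closed_matrix_groupD(4)[OF H h]])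
  ultimately have "mexp (s *\<^sub>R X) ** mexp (- (s *\<^sub>R X)) = mat 1"
    by (simp only: LIMSEQ_const_iff)
  then have "invertible (mexp (s *\<^sub>R X))"
    unfolding invertible_right_inverse by blast
  then show ?thesis
    using closed_matrix_group_limit[OF H _ mpow_tendsto_mexp[OF m lim]] mpow_in_group[OF H h] by blast
qed

text \<open>Negative times follow from positive ones, since the inverses \<open>h\<^sup>-\<^sup>1\<close> are tangent to \<open>-X\<close>.\<close>

lemma tangent_in_lie_algebra:
  fixes H :: "(real^'n^'n) set"
  assumes H: "closed_matrix_group H" and h: "\<And>n. h n \<in> H"
    and e: "\<And>n. e n > 0" "e \<longlonglongrightarrow> (0::real)" and X: "(\<lambda>n. (1 / e n) *\<^sub>R (h n - mat 1)) \<longlonglongrightarrow> X"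
  shows "X \<in> lie_algebra H"
  unfolding lie_algebra_def
proof safe
  fix s :: real
  have pos: "mexp (s *\<^sub>R X) \<in> H" if "s > 0" for s using tangent_mexp_pos[OF assms that] .
  consider "s > 0" | "s = 0" | "s < 0" by linarith
  then show "mexp (s *\<^sub>R X) \<in> H"
  proof cases
    case 3
    have hm: "h \<longlonglongrightarrow> mat 1"
    proof -
      have "(\<lambda>n. mat 1 + e n *\<^sub>R ((1 / e n) *\<^sub>R (h n - mat 1))) \<longlonglongrightarrow> mat 1 + 0 *\<^sub>R X"
        by (intro tendsto_intros e X)
      moreover have "mat 1 + e n *\<^sub>R ((1 / e n) *\<^sub>R (h n - mat 1)) = h n" for n
        using e(1)[of n] by simp
      ultimately show ?thesis by simp
    qed
    have inv1: "invertible (mat 1 :: real^'n^'n)" by (auto simp: invertible_def)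
    have i1: "matrix_inv (mat 1) = (mat 1 :: real^'n^'n)"
      using matrix_inv_inverse[OF inv1] by simp
    have hi: "(\<lambda>n. matrix_inv (h n)) \<longlonglongrightarrow> mat 1"
      using tendsto_matrix_inv[OF hm inv1] by (simp add: i1)
    have "(\<lambda>n. - (matrix_inv (h n) ** ((1 / e n) *\<^sub>R (h n - mat 1)))) \<longlonglongrightarrow> - (mat 1 ** X)"
      by (intro tendsto_minus matrix_mult.tendsto hi X)
    moreover have "- (matrix_inv (h n) ** ((1 / e n) *\<^sub>R (h n - mat 1)))
        = (1 / e n) *\<^sub>R (matrix_inv (h n) - mat 1)" for n
      using closed_matrix_groupD(6)[OF H h[of n]]
      by (simp add: matrix_mult.scaleR_right matrix_mult.diff_right algebra_simps)
    ultimately have "(\<lambda>n. (1 / e n) *\<^sub>R (matrix_inv (h n) - mat 1)) \<longlonglongrightarrow> - X" by simp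
    from tangent_mexp_pos[OF H _ e this, of "- s"] 3 closed_matrix_groupD(3)[OF H h]
    show ?thesis by simp
  qed (use pos closed_matrix_groupD(1)[OF H] in auto)
qed

lemma mexp_has_derivative_0: "((mexp :: real^'n^'n \<Rightarrow> real^'n^'n) has_derivative (\<lambda>X. X)) (at 0)"
  unfolding has_derivative_at_alt
proof (intro conjI allI impI)
  let ?C = "norm (mat 1 :: real^'n^'n) * exp 1 + 1"
  have C: "?C > 0" by (smt (verit) exp_gt_zero mult_nonneg_nonneg norm_ge_zero)
  fix e :: real assume e: "e > 0"
  show "\<exists>d>0. \<forall>y. norm (y - 0) < d \<longrightarrow>
      norm (mexp y - mexp 0 - (y - 0)) \<le> e * norm (y - 0 :: real^'n^'n)"
  proof (intro exI[of _ "min 1 (e / ?C)"] conjI allI impI)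
    show "min 1 (e / ?C) > 0" using e C by simp
    fix y :: "real^'n^'n" assume y: "norm (y - 0) < min 1 (e / ?C)"
    have "norm (mexp y - mat 1 - y) \<le> norm (mat 1 :: real^'n^'n) * exp 1 * (norm y)\<^sup>2"
      using y by (intro mexp_first_order) simp
    also have "\<dots> \<le> ?C * (norm y)\<^sup>2" by (intro mult_right_mono) auto
    also have "\<dots> = (?C * norm y) * norm y" by (simp add: power2_eq_square)
    also have "\<dots> \<le> e * norm y"
      using y C by (intro mult_right_mono) (auto simp: field_simps)
    finally show "norm (mexp y - mexp 0 - (y - 0)) \<le> e * norm (y - 0)" by simp
  qed
qed (rule bounded_linear_ident)

lemma mexp_tangent:
  fixes X :: "real^'n^'n"
  assumes e: "\<And>n. e n > 0" "e \<longlonglongrightarrow> (0::real)"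
  shows "(\<lambda>n. (1 / e n) *\<^sub>R (mexp (e n *\<^sub>R X) - mat 1)) \<longlonglongrightarrow> X"
proof -
  let ?C = "norm (mat 1 :: real^'n^'n) * exp 1"
  have "(\<lambda>n. (1 / e n) *\<^sub>R (mexp (e n *\<^sub>R X) - mat 1) - X) \<longlonglongrightarrow> 0"
  proof (rule Lim_null_comparison)
    have "(\<lambda>n. norm (e n *\<^sub>R X)) \<longlonglongrightarrow> norm (0 *\<^sub>R X)"
      by (intro tendsto_intros e)
    then have "eventually (\<lambda>n. norm (e n *\<^sub>R X) < 1) sequentially"
      by (rule order_tendstoD) simp
    then show "eventually (\<lambda>n. norm ((1 / e n) *\<^sub>R (mexp (e n *\<^sub>R X) - mat 1) - X)
        \<le> ?C * (e n * (norm X)\<^sup>2)) sequentially"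
    proof eventually_elim
      case (elim n)
      have "(1 / e n) *\<^sub>R (mexp (e n *\<^sub>R X) - mat 1) - X
          = (1 / e n) *\<^sub>R (mexp (e n *\<^sub>R X) - mat 1 - e n *\<^sub>R X)"
        using e(1)[of n] by (simp add: algebra_simps)
      also have "norm \<dots> = (1 / e n) * norm (mexp (e n *\<^sub>R X) - mat 1 - e n *\<^sub>R X)"
        using e(1)[of n] by simp
      also have "\<dots> \<le> (1 / e n) * (?C * (norm (e n *\<^sub>R X))\<^sup>2)"
        using elim e(1)[of n] by (intro mult_left_mono mexp_first_order) auto
      also have "\<dots> = ?C * (e n * (norm X)\<^sup>2)"
        using e(1)[of n] by (simp add: power2_eq_square)
      finally show ?case .
    qed
    have "(\<lambda>n. ?C * (e n * (norm X)\<^sup>2)) \<longlonglongrightarrow> ?C * (0 * (norm X)\<^sup>2)"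
      by (intro tendsto_intros e)
    then show "(\<lambda>n. ?C * (e n * (norm X)\<^sup>2)) \<longlonglongrightarrow> 0" by simp
  qed
  then show ?thesis by (rule Lim_null[THEN iffD2])
qed

text \<open>The products \<open>mexp (e X) mexp (e Y)\<close> are tangent to \<open>X + Y\<close>.\<close>

lemma lie_algebra_add:
  fixes H :: "(real^'n^'n) set"
  assumes H: "closed_matrix_group H" and X: "X \<in> lie_algebra H" and Y: "Y \<in> lie_algebra H"
  shows "X + Y \<in> lie_algebra H"
proof (rule tangent_in_lie_algebra[OF H])
  define e where "e n = 1 / real (Suc n)" for n
  show e: "e n > 0" "e \<longlonglongrightarrow> 0" for n
    using LIMSEQ_inverse_real_of_nat by (simp_all add: e_def[abs_def] inverse_eq_divide)
  define x where "x n = mexp (e n *\<^sub>R X)" for n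
  define y where "y n = mexp (e n *\<^sub>R Y)" for n
  show "x n ** y n \<in> H" for n
    using X Y closed_matrix_groupD(2)[OF H] by (auto simp: lie_algebra_def x_def y_def)
  have dx: "(\<lambda>n. (1 / e n) *\<^sub>R (x n - mat 1)) \<longlonglongrightarrow> X"
    unfolding x_def by (rule mexp_tangent[OF e])
  have dy: "(\<lambda>n. (1 / e n) *\<^sub>R (y n - mat 1)) \<longlonglongrightarrow> Y"
    unfolding y_def by (rule mexp_tangent[OF e])
  have y1: "y \<longlonglongrightarrow> mat 1"
    unfolding y_def using tendsto_mexp[OF tendsto_scaleR[OF e(2) tendsto_const[of Y]]] by simp
  have "(\<lambda>n. ((1 / e n) *\<^sub>R (x n - mat 1)) ** y n + (1 / e n) *\<^sub>R (y n - mat 1)) \<longlonglongrightarrow> X ** mat 1 + Y"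
    by (intro tendsto_add matrix_mult.tendsto dx dy y1)
  then show "(\<lambda>n. (1 / e n) *\<^sub>R (x n ** y n - mat 1)) \<longlonglongrightarrow> X + Y"
    by (simp add: matrix_mult.scaleR_left matrix_mult.diff_left algebra_simps)
qed

lemma lie_algebra_zero: "closed_matrix_group H \<Longrightarrow> 0 \<in> lie_algebra H"
  by (simp add: lie_algebra_def closed_matrix_groupD)

lemma lie_algebra_sum:
  assumes "closed_matrix_group H" "\<And>i. i \<in> I \<Longrightarrow> X i \<in> lie_algebra H"
  shows "(\<Sum>i\<in>I. X i) \<in> lie_algebra H"
  using assms(2) by (induction I rule: infinite_finite_induct)
    (auto intro: lie_algebra_add lie_algebra_zero assms(1))

section \<open>Open orbits and the polynomial vanishing off them\<close>

lemma transpose_apply_mult: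
  "transpose ((g :: real^'n^'n) ** h) *v \<xi> = transpose h *v (transpose g *v \<xi>)"
  by (simp add: matrix_transpose_mul matrix_vector_mul_assoc)

lemma bij_transpose_apply:
  fixes h :: "real^'n^'n"
  assumes "invertible h"
  shows "bij (\<lambda>\<xi>. transpose h *v \<xi>)"
proof (rule o_bij)
  show "(\<lambda>\<xi>. transpose (matrix_inv h) *v \<xi>) \<circ> (\<lambda>\<xi>. transpose h *v \<xi>) = id"
    "(\<lambda>\<xi>. transpose h *v \<xi>) \<circ> (\<lambda>\<xi>. transpose (matrix_inv h) *v \<xi>) = id"
    using matrix_inv_inverse[OF assms]
    by (auto simp: fun_eq_iff simp flip: transpose_apply_mult)
qed

lemma interior_transpose_image:
  fixes h :: "real^'n^'n"
  assumes "invertible h"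
  shows "interior ((\<lambda>\<xi>. transpose h *v \<xi>) ` S) = (\<lambda>\<xi>. transpose h *v \<xi>) ` interior S"
  by (rule interior_bijective_linear_image[OF matrix_vector_mul_linear bij_transpose_apply[OF assms]])

lemma dual_orbit_eq:
  fixes H :: "(real^'n^'n) set"
  assumes H: "closed_matrix_group H" and \<eta>: "\<eta> \<in> dual_orbit H \<xi>"
  shows "dual_orbit H \<eta> = dual_orbit H \<xi>"
proof -
  have sub: "dual_orbit H (transpose g *v \<zeta>) \<subseteq> dual_orbit H \<zeta>" if "g \<in> H" for g \<zeta>
    using closed_matrix_groupD(2)[OF H that]
    unfolding dual_orbit_def by (force simp flip: transpose_apply_mult)
  obtain g where g: "g \<in> H" "\<eta> = transpose g *v \<xi>" using \<eta> by (auto simp: dual_orbit_def)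
  have "\<xi> = transpose (matrix_inv g) *v \<eta>"
    using closed_matrix_groupD(5)[OF H g(1)] by (simp add: g(2) flip: transpose_apply_mult)
  then show ?thesis
    using sub[OF g(1), of \<xi>] sub[OF closed_matrix_groupD(3)[OF H g(1)], of \<eta>] g(2) by simp
qed

text \<open>An open mapping theorem. A compact neighbourhood \<open>U\<close> of the identity is moved over the whole group by
  countably many translations (Lindelof), so the open orbit is a countable union of compact sets, each a
  linear image of \<open>S = U\<^sup>T\<xi>\<close>. By Baire one of them, hence \<open>S\<close>, has interior points; translating an
  interior point \<open>u\<^sub>0\<^sup>T\<xi>\<close> back by \<open>u\<^sub>0\<^sup>-\<^sup>1\<close> makes \<open>\<xi>\<close> interior, at the price of enlarging \<open>U\<close> to
  \<open>U u\<^sub>0\<^sup>-\<^sup>1\<close>.\<close>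

lemma orbit_map_open_at_1:
  fixes H :: "(real^'n^'n) set"
  assumes H: "closed_matrix_group H" and op: "open (dual_orbit H \<xi>)" and e: "e > 0"
  shows "\<xi> \<in> interior ((\<lambda>h. transpose h *v \<xi>) ` {h \<in> H. norm (h - mat 1) < e})"
proof -
  have inv1: "invertible (mat 1 :: real^'n^'n)" by (auto simp: invertible_def)
  have i1: "matrix_inv (mat 1) = (mat 1 :: real^'n^'n)"
    using matrix_inv_inverse[OF inv1] by simp
  have opG: "open {A :: real^'n^'n. invertible A}"
    using open_Collect_neq[OF continuous_on_det[of UNIV] continuous_on_const[of UNIV 0]]
    by (simp add: invertible_det_nz)
  define B where "B = norm (mat 1 :: real^'n^'n) + 1"
  have B: "B > 0" by (simp add: B_def add_nonneg_pos)
  have "((\<lambda>u. matrix_inv u) \<longlongrightarrow> mat 1) (nhds (mat 1 :: real^'n^'n))"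
    using tendsto_matrix_inv[OF filterlim_ident inv1] by (simp add: i1)
  then have "eventually (\<lambda>u. dist (matrix_inv u) (mat 1 :: real^'n^'n) < 1) (nhds (mat 1))"
    by (rule tendstoD) simp
  moreover have "eventually (\<lambda>u :: real^'n^'n. invertible u) (nhds (mat 1))"
    using eventually_nhds_in_open[OF opG, of "mat 1"] inv1 by simp
  ultimately have "eventually (\<lambda>u :: real^'n^'n. invertible u \<and> norm (matrix_inv u) \<le> B) (nhds (mat 1))"
  proof eventually_elim
    case (elim u)
    then show ?case
      using norm_triangle_ineq2[of "matrix_inv u" "mat 1"] by (auto simp: B_def dist_norm)
  qed
  then obtain \<delta> where \<delta>: "\<delta> > 0"
    "\<And>u :: real^'n^'n. dist u (mat 1) < \<delta> \<Longrightarrow> invertible u \<and> norm (matrix_inv u) \<le> B"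
    unfolding eventually_nhds_metric by auto
  \<comment> \<open>two elements of \<open>U\<close> differ by at most \<open>2 r\<close>, and \<open>B\<close> bounds the inverses near the identity\<close>
  define r where "r = min (\<delta> / 2) (e / (4 * B))"
  have r: "r > 0" "r < \<delta>" "2 * r * B < e"
    using \<delta> e B by (auto simp: r_def min_def field_simps)
  define U where "U = H \<inter> cball (mat 1) r"
  define S where "S = (\<lambda>u. transpose u *v \<xi>) ` U"
  obtain T where T: "closed T" "H = {A. invertible A} \<inter> T"
    using H unfolding closed_matrix_group_def closedin_closed by auto
  have "U = T \<inter> cball (mat 1) r"
    using T r \<delta> by (auto simp: U_def dist_commute)
  then have "compact U" using T by (simp add: closed_Int_compact)
  then have cS: "compact S"
    unfolding S_def
    by (rule compact_continuous_image[OF linear_continuous_on[OF bounded_linear_transpose_apply]])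
  \<comment> \<open>some translate of \<open>S\<close> has interior points, by the Baire category theorem\<close>
  have "\<exists>h\<in>H. interior ((\<lambda>x. transpose h *v x) ` S) \<noteq> {}"
  proof (rule ccontr)
    assume contra: "\<not> ?thesis"
    \<comment> \<open>\<open>N h\<close> is a neighbourhood of \<open>h\<close> whose points in \<open>H\<close> lie in \<open>U h\<close>\<close>
    define N where "N h = {A. norm (A ** matrix_inv h - mat 1) < r}" for h :: "real^'n^'n"
    have "open (N h)" for h
      unfolding N_def
      by (intro open_Collect_less continuous_on_norm continuous_on_diff continuous_on_const
          linear_continuous_on matrix_mult.bounded_linear_left)
    then have opN: "\<And>V. V \<in> N ` H \<Longrightarrow> open V" by auto
    obtain F where F: "F \<subseteq> N ` H" "countable F" "\<Union>F = \<Union>(N ` H)"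
      by (rule Lindelof[OF opN])
    obtain D where "countable D" "D \<subseteq> H" "F = N ` D"
      using F countable_subset_image[of F N H] by (metis (no_types))
    then have D: "countable D" "D \<subseteq> H" "\<Union>(N ` D) = \<Union>(N ` H)"
      using F by simp_all
    define C where "C h = (\<lambda>x. transpose h *v x) ` S" for h :: "real^'n^'n"
    have cC: "closed (C h)" for h
      unfolding C_def
      by (rule compact_imp_closed[OF compact_continuous_image[OF linear_continuous_on cS]])
         (rule matrix_vector_mul_bounded_linear)
    have "UNIV \<subseteq> closure (\<Inter>((\<lambda>h. - C h) ` D))"
    proof (rule Baire)
      fix V assume "V \<in> (\<lambda>h. - C h) ` D"
      then obtain h where h: "h \<in> D" "V = - C h" by auto
      have "interior (C h) = {}" using contra h D by (auto simp: C_def)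
      then show "openin (top_of_set UNIV) V \<and> UNIV \<subseteq> closure V"
        using cC h by (auto simp: closure_complement)
    qed (use D in auto)
    moreover have "\<xi> \<in> dual_orbit H \<xi>"
      using closed_matrix_groupD(1)[OF H] by (force simp: dual_orbit_def)
    ultimately have "dual_orbit H \<xi> \<inter> \<Inter>((\<lambda>h. - C h) ` D) \<noteq> {}"
      using open_Int_closure_eq_empty[OF op] by blast
    then obtain x where x: "x \<in> dual_orbit H \<xi>" "\<And>h. h \<in> D \<Longrightarrow> x \<notin> C h"
      by blast
    then obtain g where g: "g \<in> H" "x = transpose g *v \<xi>" by (auto simp: dual_orbit_def)
    have "g \<in> N g"
      using closed_matrix_groupD(5)[OF H g(1)] r by (simp add: N_def)
    then obtain h where h: "h \<in> D" "g \<in> N h" using D g(1) by blast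
    then have hH: "h \<in> H" using D by auto
    have "g ** matrix_inv h \<in> U"
      using h closed_matrix_groupD(2)[OF H g(1) closed_matrix_groupD(3)[OF H hH]]
      by (auto simp: U_def N_def dist_norm norm_minus_commute)
    moreover have "x = transpose h *v (transpose (g ** matrix_inv h) *v \<xi>)"
      using closed_matrix_groupD(6)[OF H hH]
      by (simp add: g(2) flip: transpose_apply_mult matrix_mul_assoc)
    ultimately have "x \<in> C h" by (auto simp: C_def S_def)
    then show False using x h by blast
  qed
  then obtain h where h: "h \<in> H" "interior ((\<lambda>x. transpose h *v x) ` S) \<noteq> {}" by blast
  then have "interior S \<noteq> {}"
    using interior_transpose_image[OF closed_matrix_groupD(4)[OF H h(1)]] by auto
  then obtain u0 where u0: "u0 \<in> U" "transpose u0 *v \<xi> \<in> interior S"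
    using interior_subset[of S] by (force simp: S_def)
  have u0H: "u0 \<in> H" using u0 by (simp add: U_def)
  have "transpose (matrix_inv u0) *v (transpose u0 *v \<xi>)
      \<in> interior ((\<lambda>x. transpose (matrix_inv u0) *v x) ` S)"
    using u0 closed_matrix_groupD(3,4)[OF H] u0H by (simp add: interior_transpose_image)
  moreover have "transpose (matrix_inv u0) *v (transpose u0 *v \<xi>) = \<xi>"
    using closed_matrix_groupD(5)[OF H u0H] by (simp flip: transpose_apply_mult)
  moreover have "(\<lambda>x. transpose (matrix_inv u0) *v x) ` S
      \<subseteq> (\<lambda>h. transpose h *v \<xi>) ` {h \<in> H. norm (h - mat 1) < e}"
  proof safe
    fix x assume "x \<in> S"
    then obtain u where u: "u \<in> U" "x = transpose u *v \<xi>" by (auto simp: S_def)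
    have "u ** matrix_inv u0 - mat 1 = (u - u0) ** matrix_inv u0"
      using closed_matrix_groupD(5)[OF H u0H] by (simp add: matrix_mult.diff_left)
    then have "norm (u ** matrix_inv u0 - mat 1) \<le> norm (u - u0) * norm (matrix_inv u0)"
      by (simp add: norm_matrix_mult_le)
    also have "\<dots> \<le> (2 * r) * B"
    proof (intro mult_mono)
      show "norm (u - u0) \<le> 2 * r"
        using u u0 norm_triangle_ineq4[of "u - mat 1" "u0 - mat 1"]
        by (simp add: U_def dist_norm norm_minus_commute)
      show "norm (matrix_inv u0) \<le> B"
        using u0 r \<delta>(2)[of u0] by (simp add: U_def dist_commute)
    qed (use r in auto)
    finally have "norm (u ** matrix_inv u0 - mat 1) < e" using r by simp
    moreover have "u ** matrix_inv u0 \<in> H"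
      using u u0H closed_matrix_groupD(2,3)[OF H] by (auto simp: U_def)
    ultimately show "transpose (matrix_inv u0) *v x
        \<in> (\<lambda>h. transpose h *v \<xi>) ` {h \<in> H. norm (h - mat 1) < e}"
      by (auto simp: u(2) simp flip: transpose_apply_mult)
  qed
  ultimately show ?thesis using subsetD[OF interior_mono] by simp
qed

text \<open>The infinitesimal version of openness of the orbit, obtained without any manifold structure on
  the group. By the open mapping theorem \<open>\<xi> + e v\<close> is reached by group elements \<open>g\<close> tending to the
  identity as \<open>e\<close> tends to 0. A tangent vector of these elements should solve the equation, but they
  may tend to the identity much more slowly than \<open>e\<close>, moving mainly along the stabilizer. To exclude this,
  \<open>g\<close> is multiplied by the stabilizer element that brings it closest to the identity; compactness of the
  stabilizer provides one. If the distance \<open>d\<close> of the result \<open>h\<close> to the identity is \<open>O(e)\<close> along a subsequence, a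
  limit of \<open>(h - 1) / e\<close> is the required \<open>X\<close>. Otherwise a limit \<open>X\<close> of \<open>(h - 1) / d\<close> has norm 1 and
  annihilates \<open>\<xi>\<close>, so that \<open>mexp (- d X)\<close> lies in the stabilizer and moves \<open>h\<close> to distance \<open>o(d)\<close> of the
  identity, against the choice of \<open>h\<close>.\<close>

lemma lie_algebra_acts_transitively:
  fixes H :: "(real^'n^'n) set"
  assumes H: "closed_matrix_group H" and op: "open (dual_orbit H \<xi>)"
    and K: "compact (dual_stabilizer H \<xi>)"
  shows "\<exists>X\<in>lie_algebra H. transpose X *v \<xi> = v"
proof -
  let ?K = "dual_stabilizer H \<xi>"
  have "\<exists>e g. 0 < e \<and> e \<le> 1 / real (Suc n) \<and> g \<in> H \<and> norm (g - mat 1) < 1 / real (Suc n)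
      \<and> transpose g *v \<xi> = \<xi> + e *\<^sub>R v" for n
  proof -
    have "1 / real (Suc n) > 0" by simp
    from orbit_map_open_at_1[OF H op this]
    obtain \<rho> where \<rho>: "\<rho> > 0"
      "ball \<xi> \<rho> \<subseteq> (\<lambda>h. transpose h *v \<xi>) ` {h \<in> H. norm (h - mat 1) < 1 / real (Suc n)}"
      unfolding mem_interior by blast
    \<comment> \<open>small enough for \<open>\<xi> + e v\<close> to stay inside the ball covered by the orbit map\<close>
    define e where "e = min (1 / real (Suc n)) (\<rho> / (2 * (norm v + 1)))"
    have v1: "norm v + 1 > 0" by (simp add: add_nonneg_pos)
    have e: "0 < e" "e \<le> 1 / real (Suc n)" using \<rho>(1) v1 by (auto simp: e_def)
    have "e * norm v \<le> \<rho> / (2 * (norm v + 1)) * (norm v + 1)"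
      using e(1) \<rho>(1) v1 by (intro mult_mono) (auto simp: e_def)
    also have "\<dots> = \<rho> / 2" using v1 by (simp add: divide_simps)
    also have "\<dots> < \<rho>" using \<rho>(1) by simp
    finally have "\<xi> + e *\<^sub>R v \<in> ball \<xi> \<rho>" using e by (simp add: dist_norm)
    then have "\<xi> + e *\<^sub>R v
        \<in> (\<lambda>h. transpose h *v \<xi>) ` {h \<in> H. norm (h - mat 1) < 1 / real (Suc n)}"
      using \<rho>(2) by (rule subsetD[rotated])
    then obtain g where "g \<in> H" "norm (g - mat 1) < 1 / real (Suc n)"
      "\<xi> + e *\<^sub>R v = transpose g *v \<xi>"
      unfolding image_iff by blast
    then show ?thesis using e by (intro exI[of _ e] exI[of _ g]) simp
  qed
  then obtain e g where eg: "\<And>n. 0 < e n" "\<And>n. e n \<le> 1 / real (Suc n)" "\<And>n. g n \<in> H"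
    "\<And>n. norm (g n - mat 1) < 1 / real (Suc n)" "\<And>n. transpose (g n) *v \<xi> = \<xi> + e n *\<^sub>R v"
    by metis
  have e0: "e \<longlonglongrightarrow> 0"
    by (rule tendsto_sandwich[OF _ _ tendsto_const LIMSEQ_inverse_real_of_nat])
       (use eg(1,2) in \<open>auto intro!: always_eventually simp: inverse_eq_divide less_imp_le\<close>)
  have K1: "mat 1 \<in> ?K" using closed_matrix_groupD(1)[OF H] by (simp add: dual_stabilizer_def)
  have Kmult: "k ** k' \<in> ?K" if "k \<in> ?K" "k' \<in> ?K" for k k'
    using that closed_matrix_groupD(2)[OF H] by (auto simp: dual_stabilizer_def transpose_apply_mult)
  have "\<exists>k\<in>?K. \<forall>k'\<in>?K. norm (k ** g n - mat 1) \<le> norm (k' ** g n - mat 1)" for n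
    by (rule continuous_attains_inf[OF K _ continuous_on_norm[OF continuous_on_diff[OF
          linear_continuous_on[OF matrix_mult.bounded_linear_left] continuous_on_const]]])
       (use K1 in blast)
  then obtain k where k: "\<And>n. k n \<in> ?K"
    "\<And>n k'. k' \<in> ?K \<Longrightarrow> norm (k n ** g n - mat 1) \<le> norm (k' ** g n - mat 1)" by metis
  define h where "h n = k n ** g n" for n
  define d where "d n = norm (h n - mat 1)" for n
  have hH: "h n \<in> H" for n
    using k(1)[of n] eg(3)[of n] closed_matrix_groupD(2)[OF H] by (simp add: h_def dual_stabilizer_def)
  have h\<xi>: "transpose (h n) *v \<xi> = \<xi> + e n *\<^sub>R v" for n
    using k(1)[of n] eg(5)[of n] by (simp add: h_def transpose_apply_mult dual_stabilizer_def)
  have hmin: "d n \<le> norm (k' ** h n - mat 1)" if "k' \<in> ?K" for k' n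
    using k(2)[OF Kmult[OF that k(1)[of n]], of n]
    unfolding d_def h_def matrix_mul_assoc .
  have d0: "d \<longlonglongrightarrow> 0"
  proof (rule tendsto_sandwich[OF _ _ tendsto_const LIMSEQ_inverse_real_of_nat])
    show "eventually (\<lambda>n. d n \<le> inverse (real (Suc n))) sequentially"
    proof (intro always_eventually allI)
      show "d n \<le> inverse (real (Suc n))" for n
        using k(2)[OF K1, of n] eg(4)[of n] by (simp add: d_def h_def inverse_eq_divide)
    qed
  qed (simp add: d_def)
  have quot: "transpose ((1 / c) *\<^sub>R (h n - mat 1)) *v \<xi> = (e n / c) *\<^sub>R v" for n c
  proof -
    interpret L: bounded_linear "\<lambda>A :: real^'n^'n. transpose A *v \<xi>"
      by (rule bounded_linear_transpose_apply)
    show ?thesis by (simp add: L.scaleR L.diff h\<xi>)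
  qed
  have quot_lim: "(\<lambda>n. (e (q n) / c n) *\<^sub>R v) \<longlonglongrightarrow> transpose X *v \<xi>"
    if "(\<lambda>n. (1 / c n) *\<^sub>R (h (q n) - mat 1)) \<longlonglongrightarrow> X" for c q X
    using bounded_linear.tendsto[OF bounded_linear_transpose_apply that, of \<xi>] by (simp add: quot)
  \<comment> \<open>the tangential case is the one in which \<open>h\<close> approaches the identity at the rate \<open>e\<close>\<close>
  show ?thesis
  proof (cases "\<exists>B. frequently (\<lambda>n. d n \<le> B * e n) sequentially")
    case True
    then obtain B where inf: "infinite {n. d n \<le> B * e n}"
      unfolding cofinite_eq_sequentially[symmetric] frequently_cofinite not_le by blast
    define r where "r = enumerate {n. d n \<le> B * e n}"
    have r: "strict_mono r" "\<And>n. d (r n) \<le> B * e (r n)"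
      using strict_mono_enumerate[OF inf] enumerate_in_set[OF inf] unfolding r_def by simp_all
    have "norm ((1 / e (r n)) *\<^sub>R (h (r n) - mat 1)) \<le> B" for n
      using r(2)[of n] eg(1)[of "r n"] unfolding norm_scaleR by (simp add: d_def divide_le_eq)
    then have "bounded (range (\<lambda>n. (1 / e (r n)) *\<^sub>R (h (r n) - mat 1)))"
      unfolding bounded_iff by blast
    from bounded_imp_convergent_subsequence[OF this]
    obtain X q where q: "strict_mono q"
      "((\<lambda>n. (1 / e (r n)) *\<^sub>R (h (r n) - mat 1)) \<circ> q) \<longlonglongrightarrow> X"
      by blast
    have rq: "strict_mono (r \<circ> q)" using r(1) q(1) by (rule strict_mono_o)
    have lim: "(\<lambda>n. (1 / e ((r \<circ> q) n)) *\<^sub>R (h ((r \<circ> q) n) - mat 1)) \<longlonglongrightarrow> X"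
      using q(2) by (simp only: comp_def)
    have "X \<in> lie_algebra H"
      using LIMSEQ_subseq_LIMSEQ[OF e0 rq]
      by (intro tangent_in_lie_algebra[OF H hH _ _ lim]) (auto simp: eg comp_def)
    moreover have "transpose X *v \<xi> = v"
      using quot_lim[OF lim] eg(1) by (simp add: LIMSEQ_const_iff less_imp_neq[THEN not_sym])
    ultimately show ?thesis by blast
  next
    case False
    then have ev: "eventually (\<lambda>n. d n > B * e n) sequentially" for B
      by (simp add: not_frequently not_le)
    obtain N where N: "\<And>n. n \<ge> N \<Longrightarrow> d n > 0"
      using ev[of 0] by (auto simp: eventually_sequentially)
    have ed: "(\<lambda>n. e n / d n) \<longlonglongrightarrow> 0"
    proof (rule tendstoI)
      fix b :: real assume b: "b > 0"
      show "eventually (\<lambda>n. dist (e n / d n) 0 < b) sequentially"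
        using ev[of "1 / b"] ev[of 0]
        by eventually_elim (use b eg(1) in \<open>auto simp: field_simps less_imp_le\<close>)
    qed
    have n1: "norm ((1 / d (n + N)) *\<^sub>R (h (n + N) - mat 1)) = 1" for n
      using N[of "n + N"] unfolding norm_scaleR by (simp add: d_def)
    then have "norm ((1 / d (n + N)) *\<^sub>R (h (n + N) - mat 1)) \<le> 1" for n
      by (simp only: order.refl)
    then have "bounded (range (\<lambda>n. (1 / d (n + N)) *\<^sub>R (h (n + N) - mat 1)))"
      unfolding bounded_iff by blast
    from bounded_imp_convergent_subsequence[OF this]
    obtain X q where q: "strict_mono q"
      "((\<lambda>n. (1 / d (n + N)) *\<^sub>R (h (n + N) - mat 1)) \<circ> q) \<longlonglongrightarrow> X"
      by blast
    have X1: "norm X = 1"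
      using tendsto_norm[OF q(2)] unfolding comp_def n1 by (simp add: LIMSEQ_const_iff)
    define p where "p n = q n + N" for n
    have p: "strict_mono p" using q(1) by (auto simp: p_def strict_mono_def)
    have dp: "d (p n) > 0" for n using N by (simp add: p_def)
    have lim: "(\<lambda>n. (1 / d (p n)) *\<^sub>R (h (p n) - mat 1)) \<longlonglongrightarrow> X"
      using q(2) by (simp only: comp_def p_def)
    have d0p: "(\<lambda>n. d (p n)) \<longlonglongrightarrow> 0"
      using LIMSEQ_subseq_LIMSEQ[OF d0 p] by (simp add: comp_def)
    have X: "X \<in> lie_algebra H"
      by (rule tangent_in_lie_algebra[OF H hH dp d0p lim])
    have "(\<lambda>n. (e (p n) / d (p n)) *\<^sub>R v) \<longlonglongrightarrow> 0 *\<^sub>R v"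
      using tendsto_scaleR[OF LIMSEQ_subseq_LIMSEQ[OF ed p] tendsto_const] unfolding comp_def .
    then have X\<xi>: "transpose X *v \<xi> = 0"
      using quot_lim[OF lim] LIMSEQ_unique by fastforce
    have stab: "mexp (s *\<^sub>R X) \<in> ?K" for s
    proof -
      have z: "transpose (mpow (s *\<^sub>R X) (Suc j)) *v \<xi> = 0" for j
        using X\<xi> by (simp add: transpose_apply_mult transpose_scalar scaleR_matrix_vector_assoc[symmetric])
      have "(\<lambda>j. transpose ((1 / fact j) *\<^sub>R mpow (s *\<^sub>R X) j) *v \<xi>) sums (transpose (mexp (s *\<^sub>R X)) *v \<xi>)"
        by (rule bounded_linear.sums[OF bounded_linear_transpose_apply mexp_sums])
      moreover have "(\<lambda>j. transpose ((1 / fact j) *\<^sub>R mpow (s *\<^sub>R X) j) *v \<xi>) = (\<lambda>j. if j = 0 then \<xi> else 0)"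
      proof
        fix j show "transpose ((1 / fact j) *\<^sub>R mpow (s *\<^sub>R X) j) *v \<xi> = (if j = 0 then \<xi> else 0)"
          using z[of "j - 1"] by (cases j) (auto simp: transpose_scalar scaleR_matrix_vector_assoc[symmetric]
              simp del: mpow.simps(2) fact_Suc)
      qed
      ultimately have "transpose (mexp (s *\<^sub>R X)) *v \<xi> = \<xi>"
        using sums_If_finite_set[of "{0}" "\<lambda>_. \<xi>"] by (auto intro: sums_unique2)
      then show ?thesis using X by (simp add: dual_stabilizer_def lie_algebra_def)
    qed
    \<comment> \<open>the stabilizer elements \<open>a n\<close> cancel \<open>h\<close> to first order in \<open>d\<close>\<close>
    define a where "a n = mexp (d (p n) *\<^sub>R (- X))" for n
    have a: "(\<lambda>n. (1 / d (p n)) *\<^sub>R (a n - mat 1)) \<longlonglongrightarrow> - X"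
      unfolding a_def by (rule mexp_tangent[OF dp d0p])
    have h1: "(\<lambda>n. h (p n)) \<longlonglongrightarrow> mat 1"
      using d0p unfolding d_def by (subst LIM_zero_iff[symmetric]) (rule tendsto_norm_zero_cancel)
    have "(\<lambda>n. ((1 / d (p n)) *\<^sub>R (a n - mat 1)) ** h (p n) + (1 / d (p n)) *\<^sub>R (h (p n) - mat 1))
        \<longlonglongrightarrow> - X ** mat 1 + X"
      by (intro tendsto_add matrix_mult.tendsto a h1 lim)
    moreover have "((1 / d (p n)) *\<^sub>R (a n - mat 1)) ** h (p n) + (1 / d (p n)) *\<^sub>R (h (p n) - mat 1)
        = (1 / d (p n)) *\<^sub>R (a n ** h (p n) - mat 1)" for n
      by (simp add: matrix_mult.scaleR_left matrix_mult.diff_left algebra_simps)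
    ultimately have "(\<lambda>n. (1 / d (p n)) *\<^sub>R (a n ** h (p n) - mat 1)) \<longlonglongrightarrow> 0"
      by simp
    from tendsto_norm_zero[OF this]
    have lim0: "(\<lambda>n. norm ((1 / d (p n)) *\<^sub>R (a n ** h (p n) - mat 1))) \<longlonglongrightarrow> 0" .
    have "norm ((1 / d (p n)) *\<^sub>R (a n ** h (p n) - mat 1)) \<ge> 1" for n
      using hmin[of "a n" "p n"] stab[of "- d (p n)"] dp[of n] unfolding norm_scaleR
      by (simp add: a_def le_divide_eq)
    then have "(1::real) \<le> 0" by (intro LIMSEQ_le_const[OF lim0] exI allI impI)
    then show ?thesis by simp
  qed
qed

lemma continuous_on_mexp: "continuous_on UNIV (mexp :: real^'n^'n \<Rightarrow> real^'n^'n)"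
  unfolding continuous_on_sequentially by (auto simp: comp_def intro: tendsto_mexp)

text \<open>If the vectors \<open>X\<^sub>i\<^sup>T\<xi>\<close> form a basis, then \<open>t \<mapsto> mexp (\<Sum>t\<^sub>i X\<^sub>i)\<^sup>T\<xi>\<close> is continuous with invertible derivative
  at \<open>0\<close>, and an open mapping theorem that only needs differentiability at the point makes \<open>\<xi>\<close> an
  interior point of its orbit. Homogeneity does the rest.\<close>

lemma open_dual_orbitI:
  fixes H :: "(real^'n^'n) set"
  assumes H: "closed_matrix_group H" and X: "\<And>i. X i \<in> lie_algebra H"
    and nz: "det (\<chi> i. transpose (X i) *v \<xi>) \<noteq> 0"
  shows "open (dual_orbit H \<xi>)"
proof -
  define M where "M = transpose (\<chi> i. transpose (X i) *v \<xi>)"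
  define L where "L t = (\<Sum>i\<in>UNIV. t $ i *\<^sub>R X i)" for t :: "real^'n"
  define F where "F t = transpose (mexp (L t)) *v \<xi>" for t
  have L: "bounded_linear L"
    unfolding L_def by (intro bounded_linear_sum bounded_linear_scaleR_const bounded_linear_vec_nth)
  have L0: "L 0 = 0" by (simp add: L_def)
  have LM: "transpose (L t) *v \<xi> = M *v t" for t
  proof -
    interpret B: bounded_linear "\<lambda>A :: real^'n^'n. transpose A *v \<xi>"
      by (rule bounded_linear_transpose_apply)
    have "transpose (L t) *v \<xi> = (\<Sum>i\<in>UNIV. t $ i *\<^sub>R (transpose (X i) *v \<xi>))"
      by (simp only: L_def B.sum B.scaleR)
    also have "\<dots> = M *v t"
      unfolding matrix_mult_sum[of M t]
      by (simp add: M_def row_def scalar_mult_eq_scaleR)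
    finally show ?thesis .
  qed
  have "det M \<noteq> 0" using nz by (simp add: M_def det_transpose)
  then have invM: "invertible M" by (simp add: invertible_det_nz)
  have LinH: "mexp (L t) \<in> H" for t
  proof -
    have "L t \<in> lie_algebra H"
      unfolding L_def by (intro lie_algebra_sum H lie_algebra_scaleR X)
    then have "mexp (1 *\<^sub>R L t) \<in> H" unfolding lie_algebra_def by blast
    then show ?thesis by simp
  qed
  have F0: "F 0 = \<xi>" by (simp add: F_def L0 transpose_mat)
  have "F 0 \<in> interior (F ` UNIV)"
  proof (rule sussmann_open_mapping)
    show "continuous_on UNIV F"
      unfolding F_def
      by (intro linear_continuous_on_compose[OF _ bounded_linear.linear[OF bounded_linear_transpose_apply]]
          continuous_on_compose2[OF continuous_on_mexp] linear_continuous_on L) auto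
    have "(L has_derivative L) (at 0)" by (rule bounded_linear_imp_has_derivative[OF L])
    then have "((\<lambda>t. mexp (L t)) has_derivative (\<lambda>t. L t)) (at 0)"
      using has_derivative_compose[of L L 0 UNIV mexp "\<lambda>X. X"] mexp_has_derivative_0 L0 by simp
    from bounded_linear.has_derivative[OF bounded_linear_transpose_apply this, of \<xi>]
    show "(F has_derivative (\<lambda>t. M *v t)) (at 0)"
      unfolding F_def LM .
    show "(*v) M \<circ> (*v) (matrix_inv M) = id"
      using matrix_inv_inverse[OF invM] by (simp add: fun_eq_iff matrix_vector_mul_assoc)
  qed (simp_all add: matrix_vector_mul_bounded_linear)
  moreover have "F ` UNIV \<subseteq> dual_orbit H \<xi>"
    using LinH by (auto simp: F_def dual_orbit_def)
  ultimately have \<xi>int: "\<xi> \<in> interior (dual_orbit H \<xi>)"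
    using subsetD[OF interior_mono] F0 by simp
  have "dual_orbit H \<xi> \<subseteq> interior (dual_orbit H \<xi>)"
  proof
    fix \<eta> assume "\<eta> \<in> dual_orbit H \<xi>"
    then obtain h where h: "h \<in> H" "\<eta> = transpose h *v \<xi>" by (auto simp: dual_orbit_def)
    have "\<eta> \<in> interior ((\<lambda>\<zeta>. transpose h *v \<zeta>) ` dual_orbit H \<xi>)"
      using \<xi>int closed_matrix_groupD(4)[OF H h(1)] h(2) by (simp add: interior_transpose_image)
    moreover have "(\<lambda>\<zeta>. transpose h *v \<zeta>) ` dual_orbit H \<xi> \<subseteq> dual_orbit H \<xi>"
      using closed_matrix_groupD(2)[OF H _ h(1)]
      unfolding dual_orbit_def by (auto simp flip: transpose_apply_mult)
    ultimately show "\<eta> \<in> interior (dual_orbit H \<xi>)" by (rule subsetD[OF interior_mono, rotated])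
  qed
  then show ?thesis using interior_subset open_interior by (metis subset_antisym)
qed

lemma open_dual_orbit_eq:
  assumes H: "closed_matrix_group H" and Orb: "open_dual_orbit H \<O>" and \<xi>: "\<xi> \<in> \<O>"
  shows "dual_orbit H \<xi> = \<O>"
  using Orb \<xi> dual_orbit_eq[OF H] unfolding open_dual_orbit_def by auto

text \<open>Choosing \<open>X\<^sub>i\<close> in the Lie algebra with \<open>X\<^sub>i\<^sup>T\<xi>\<^sub>0\<close> the \<open>i\<close>-th unit vector, \<open>P(\<xi>) = det (X\<^sub>i\<^sup>T\<xi>)\<^sub>i\<close> is a
  polynomial. Where it does not vanish the orbit is open, and there is only one open orbit. The values
  along the ray through \<open>\<xi>\<^sub>0\<close> show that \<open>P\<close> is nonzero arbitrarily close to the origin.\<close>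

lemma orbit_complement_polynomial:
  fixes H :: "(real^'n^'n) set"
  assumes H: "closed_matrix_group H" and Orb: "open_dual_orbit H \<O>" and \<xi>0: "\<xi>0 \<in> \<O>"
  obtains P :: "real^'n \<Rightarrow> real" where "real_polynomial_function P" "\<And>\<xi>. \<xi> \<notin> \<O> \<Longrightarrow> P \<xi> = 0"
    "\<And>s. P (s *\<^sub>R \<xi>0) = s ^ CARD('n)"
proof -
  have orb: "dual_orbit H \<xi>0 = \<O>" by (rule open_dual_orbit_eq[OF assms])
  have "\<exists>X\<in>lie_algebra H. transpose X *v \<xi>0 = v" for v
    using Orb \<xi>0 orb unfolding open_dual_orbit_def
    by (intro lie_algebra_acts_transitively[OF H]) auto
  then obtain X where X: "\<And>v. X v \<in> lie_algebra H" "\<And>v. transpose (X v) *v \<xi>0 = v"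
    by metis
  define Y where "Y i = X (axis i 1)" for i :: 'n
  define P where "P \<xi> = det (\<chi> i. transpose (Y i) *v \<xi>)" for \<xi>
  show thesis
  proof
    have "real_polynomial_function (\<lambda>\<xi>. (transpose (Y i) *v \<xi>) $ j)" for i j
      by (intro real_polynomial_function.intros(1)
          bounded_linear_compose[OF bounded_linear_vec_nth matrix_vector_mul_bounded_linear])
    then show "real_polynomial_function P"
      unfolding P_def det_def
      by (intro real_polynomial_function_sum real_polynomial_function.intros(4)
          real_polynomial_function.intros(2) real_polynomial_function_prod) auto
    show "P \<xi> = 0" if "\<xi> \<notin> \<O>" for \<xi>
    proof (rule ccontr)
      assume "P \<xi> \<noteq> 0"
      then have "open (dual_orbit H \<xi>)"
        using open_dual_orbitI[OF H, of Y \<xi>] X by (simp add: P_def Y_def)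
      then have "dual_orbit H \<xi> = \<O>" using Orb unfolding open_dual_orbit_def by blast
      moreover have "\<xi> \<in> dual_orbit H \<xi>"
        unfolding dual_orbit_def
        by (rule image_eqI[OF _ closed_matrix_groupD(1)[OF H]]) (simp add: transpose_mat)
      ultimately show False using that by simp
    qed
    fix s :: real
    have "(\<chi> i. transpose (Y i) *v (s *\<^sub>R \<xi>0)) = (\<chi> i j. if i = j then s else 0 :: real^'n^'n)"
      by (simp add: vec_eq_iff matrix_vector_mult_scaleR X(2) Y_def axis_def)
    then show "P (s *\<^sub>R \<xi>0) = s ^ CARD('n)"
      unfolding P_def by (simp add: det_diagonal)
  qed
qed

text \<open>Scalars commute with the group, so a scalar multiple of a point with open orbit has open orbit.\<close>

lemma orbit_complement_cone:
  fixes H :: "(real^'n^'n) set"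
  assumes H: "closed_matrix_group H" and Orb: "open_dual_orbit H \<O>" and \<xi>: "\<xi> \<notin> \<O>"
  shows "c *\<^sub>R \<xi> \<notin> \<O>"
proof
  assume c: "c *\<^sub>R \<xi> \<in> \<O>"
  have op: "open \<O>" using Orb by (simp add: open_dual_orbit_def)
  have orb: "dual_orbit H (c *\<^sub>R \<xi>) = \<O>" by (rule open_dual_orbit_eq[OF H Orb c])
  have eq: "dual_orbit H (c *\<^sub>R \<xi>) = (\<lambda>x. c *\<^sub>R x) ` dual_orbit H \<xi>" for c \<xi>
    by (auto simp: dual_orbit_def matrix_vector_mult_scaleR image_image)
  have c0: "c \<noteq> 0"
  proof
    assume "c = 0"
    then have "\<O> = {0}"
      using orb closed_matrix_groupD(1)[OF H] by (auto simp: dual_orbit_def)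
    then show False using op not_open_singleton by metis
  qed
  have "dual_orbit H \<xi> = (\<lambda>x. (1 / c) *\<^sub>R x) ` \<O>"
    using c0 by (simp add: image_image eq flip: orb)
  then have "open (dual_orbit H \<xi>)" using c0 op by (simp add: open_scaling)
  then have "dual_orbit H \<xi> = \<O>" using Orb unfolding open_dual_orbit_def by blast
  moreover have "\<xi> \<in> dual_orbit H \<xi>"
    unfolding dual_orbit_def
    by (rule image_eqI[OF _ closed_matrix_groupD(1)[OF H]]) (simp add: transpose_mat)
  ultimately show False using \<xi> by simp
qed

lemma zero_not_in_orbit:
  fixes H :: "(real^'n^'n) set"
  assumes H: "closed_matrix_group H" and Orb: "open_dual_orbit H \<O>"
  shows "0 \<notin> \<O>"
proof
  assume "0 \<in> \<O>"
  then have "\<O> = dual_orbit H 0" using open_dual_orbit_eq[OF H Orb] by simp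
  also have "\<dots> = {0}" using closed_matrix_groupD(1)[OF H] by (auto simp: dual_orbit_def)
  finally show False using Orb not_open_singleton by (metis open_dual_orbit_def)
qed

section \<open>Smooth functions and test functions\<close>

lemma iter_partial_deriv_simps [simp]:
  "iter_partial_deriv [] f = f"
  "iter_partial_deriv (j # js) f = partial_deriv j (iter_partial_deriv js f)"
  "iter_partial_deriv (is @ js) f = iter_partial_deriv is (iter_partial_deriv js f)"
  by (simp_all add: iter_partial_deriv_def)

lemma partial_deriv_eqI:
  assumes "(f has_derivative D) (at x)"
  shows "partial_deriv i f x = D (axis i 1)"
proof -
  have "((\<lambda>s::real. x + s *\<^sub>R axis i 1) has_derivative (\<lambda>s. s *\<^sub>R axis i 1)) (at 0)"
    by (auto intro!: derivative_eq_intros)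
  moreover have "(f has_derivative D) (at (x + 0 *\<^sub>R axis i 1))" using assms by simp
  ultimately have "((\<lambda>s. f (x + s *\<^sub>R axis i 1)) has_derivative (\<lambda>s. D (s *\<^sub>R axis i 1))) (at 0)"
    by (rule has_derivative_compose)
  then have "((\<lambda>s. f (x + s *\<^sub>R axis i 1)) has_vector_derivative D (axis i 1)) (at 0)"
    using has_derivative_bounded_linear[OF assms]
    by (simp add: has_vector_derivative_def linear_simps)
  then show ?thesis
    unfolding partial_deriv_def by (rule vector_derivative_at)
qed

lemma derivative_eq_sum_partial:
  fixes f :: "real^'n \<Rightarrow> complex"
  assumes "f differentiable (at x)"
  shows "(f has_derivative (\<lambda>v. \<Sum>i\<in>UNIV. v $ i *\<^sub>R partial_deriv i f x)) (at x)"
proof -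
  obtain D where D: "(f has_derivative D) (at x)" using assms by (auto simp: differentiable_def)
  interpret D: bounded_linear D by (rule has_derivative_bounded_linear[OF D])
  have "D v = (\<Sum>i\<in>UNIV. v $ i *\<^sub>R partial_deriv i f x)" for v
  proof -
    have "v = (\<Sum>i\<in>UNIV. v $ i *\<^sub>R axis i 1)"
      using basis_expansion[of v] by (simp add: scalar_mult_eq_scaleR)
    then have "D v = (\<Sum>i\<in>UNIV. v $ i *\<^sub>R D (axis i 1))"
      by (metis (no_types, lifting) D.sum D.scaleR sum.cong)
    then show ?thesis by (simp add: partial_deriv_eqI[OF D])
  qed
  then have "D = (\<lambda>v. \<Sum>i\<in>UNIV. v $ i *\<^sub>R partial_deriv i f x)" by blast
  then show ?thesis using D by simp
qed

lemma smoothD: "smooth f \<Longrightarrow> iter_partial_deriv js f differentiable (at x)"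
  by (simp add: smooth_def)

lemma smooth_partial_deriv: "smooth f \<Longrightarrow> smooth (partial_deriv i f)"
  using smoothD[of f "_ @ [i]"] by (simp add: smooth_def)

lemma smooth_differentiable: "smooth f \<Longrightarrow> f differentiable (at x)"
  using smoothD[of f "[]"] by simp

lemma smooth_continuous: "smooth f \<Longrightarrow> continuous_on UNIV f"
  by (simp add: continuous_at_imp_continuous_on differentiable_imp_continuous_within smooth_differentiable)

lemma partial_deriv_add:
  assumes "f differentiable (at x)" "g differentiable (at x)"
  shows "partial_deriv i (\<lambda>x. f x + g x) x = partial_deriv i f x + partial_deriv i g x"
proof -
  obtain D E where D: "(f has_derivative D) (at x)" and E: "(g has_derivative E) (at x)"
    using assms by (auto simp: differentiable_def)
  show ?thesis
    using partial_deriv_eqI[OF has_derivative_add[OF D E]] partial_deriv_eqI[OF D] partial_deriv_eqI[OF E]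
    by simp
qed

lemma partial_deriv_cmult:
  assumes "f differentiable (at x)"
  shows "partial_deriv i (\<lambda>x. c * f x) x = c * partial_deriv i f x"
proof -
  obtain D where D: "(f has_derivative D) (at x)" using assms by (auto simp: differentiable_def)
  then show ?thesis
    using partial_deriv_eqI[OF has_derivative_mult_right[OF D]] partial_deriv_eqI[OF D] by simp
qed

lemma partial_deriv_affine:
  fixes f :: "real^'n \<Rightarrow> complex"
  assumes "f differentiable (at (a *\<^sub>R x + b))"
  shows "partial_deriv i (\<lambda>x. f (a *\<^sub>R x + b)) x = of_real a * partial_deriv i f (a *\<^sub>R x + b)"
proof -
  obtain D where D: "(f has_derivative D) (at (a *\<^sub>R x + b))" using assms by (auto simp: differentiable_def)
  have "((\<lambda>x. a *\<^sub>R x + b) has_derivative (\<lambda>x. a *\<^sub>R x)) (at x)"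
    by (auto intro!: derivative_eq_intros)
  from has_derivative_compose[OF this D]
  have "partial_deriv i (\<lambda>x. f (a *\<^sub>R x + b)) x = D (a *\<^sub>R axis i 1)"
    by (rule partial_deriv_eqI)
  then show ?thesis
    using partial_deriv_eqI[OF D, of i] linear_simps(5)[OF has_derivative_bounded_linear[OF D]]
    by (simp add: scaleR_conv_of_real)
qed

lemma iter_partial_deriv_add:
  assumes "smooth f" "smooth g"
  shows "iter_partial_deriv js (\<lambda>x. f x + g x) = (\<lambda>x. iter_partial_deriv js f x + iter_partial_deriv js g x)"
proof (induction js)
  case (Cons j js)
  show ?case by (rule ext) (simp add: Cons.IH partial_deriv_add smoothD assms)
qed simp

lemma iter_partial_deriv_cmult:
  assumes "smooth f"
  shows "iter_partial_deriv js (\<lambda>x. c * f x) = (\<lambda>x. c * iter_partial_deriv js f x)"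
proof (induction js)
  case (Cons j js)
  show ?case by (rule ext) (simp add: Cons.IH partial_deriv_cmult smoothD assms)
qed simp

lemma iter_partial_deriv_affine:
  fixes f :: "real^'n \<Rightarrow> complex"
  assumes "smooth f"
  shows "iter_partial_deriv js (\<lambda>x. f (a *\<^sub>R x + b))
    = (\<lambda>x. of_real a ^ length js * iter_partial_deriv js f (a *\<^sub>R x + b))"
proof (induction js)
  case (Cons j js)
  have d: "(\<lambda>x. iter_partial_deriv js f (a *\<^sub>R x + b)) differentiable (at x)" for x
    using differentiable_chain_at[of "\<lambda>x. a *\<^sub>R x + b" x "iter_partial_deriv js f"] smoothD[OF assms]
    by (simp add: comp_def)
  show ?case
    by (simp add: Cons fun_eq_iff partial_deriv_cmult[OF d] partial_deriv_affine smoothD[OF assms])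
qed simp

lemma smooth_add: "smooth f \<Longrightarrow> smooth g \<Longrightarrow> smooth (\<lambda>x. f x + g x)"
  by (subst smooth_def) (simp add: iter_partial_deriv_add smoothD)

lemma smooth_cmult: "smooth f \<Longrightarrow> smooth (\<lambda>x. c * f x)"
  by (subst smooth_def) (simp add: iter_partial_deriv_cmult smoothD)

lemma smooth_affine:
  assumes "smooth f" shows "smooth (\<lambda>x. f (a *\<^sub>R x + b))"
proof (subst smooth_def, intro allI)
  fix js x
  have "(\<lambda>x. iter_partial_deriv js f (a *\<^sub>R x + b)) differentiable (at x)"
    using differentiable_chain_at[of "\<lambda>x. a *\<^sub>R x + b" x "iter_partial_deriv js f"] smoothD[OF assms]
    by (simp add: comp_def)
  then show "iter_partial_deriv js (\<lambda>x. f (a *\<^sub>R x + b)) differentiable at x"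
    by (simp add: iter_partial_deriv_affine[OF assms])
qed

lemma test_function_iff:
  fixes f :: "real^'n \<Rightarrow> complex"
  shows "test_function f \<longleftrightarrow> smooth f \<and> (\<exists>R. \<forall>x. norm x > R \<longrightarrow> f x = 0)"
proof -
  have "compact (closure {x. f x \<noteq> 0}) \<longleftrightarrow> bounded {x. f x \<noteq> 0}" by simp
  also have "\<dots> \<longleftrightarrow> (\<exists>R. \<forall>x. norm x > R \<longrightarrow> f x = 0)"
    unfolding bounded_iff by (auto simp: not_le[symmetric])
  finally show ?thesis by (simp add: test_function_def)
qed

lemma partial_deriv_support:
  fixes f :: "real^'n \<Rightarrow> complex"
  assumes "\<And>x. norm x > R \<Longrightarrow> f x = 0" "norm x > R"
  shows "partial_deriv i f x = 0"
proof -
  have op: "open {x :: real^'n. norm x > R}" by (intro open_Collect_less continuous_intros)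
  have "((\<lambda>_. 0) has_derivative (\<lambda>_. 0)) (at x)" by simp
  then have "(f has_derivative (\<lambda>_. 0)) (at x)"
    by (rule has_derivative_transform_within_open[OF _ op]) (use assms in auto)
  from partial_deriv_eqI[OF this] show ?thesis .
qed

lemma test_function_partial_deriv:
  fixes f :: "real^'n \<Rightarrow> complex"
  assumes "test_function f" shows "test_function (partial_deriv i f)"
proof -
  obtain R where R: "\<And>x. norm x > R \<Longrightarrow> f x = 0" using assms unfolding test_function_iff by blast
  then have "\<forall>x. norm x > R \<longrightarrow> partial_deriv i f x = 0" using partial_deriv_support[of R f] by simp
  then show ?thesis using assms smooth_partial_deriv unfolding test_function_iff by blast
qed

lemma test_function_iter:
  fixes f :: "real^'n \<Rightarrow> complex"
  shows "test_function f \<Longrightarrow> test_function (iter_partial_deriv js f)"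
  by (induction js) (auto intro: test_function_partial_deriv)

lemma test_function_add:
  fixes f g :: "real^'n \<Rightarrow> complex"
  assumes "test_function f" "test_function g" shows "test_function (\<lambda>x. f x + g x)"
proof -
  obtain R S where "\<And>x. norm x > R \<Longrightarrow> f x = 0" "\<And>x. norm x > S \<Longrightarrow> g x = 0"
    using assms unfolding test_function_iff by blast
  then have "\<forall>x. norm x > max R S \<longrightarrow> f x + g x = 0" by simp
  then show ?thesis using assms smooth_add unfolding test_function_iff by blast
qed

lemma test_function_cmult:
  fixes f :: "real^'n \<Rightarrow> complex"
  assumes "test_function f" shows "test_function (\<lambda>x. c * f x)"
proof -
  obtain R where R: "\<And>x. norm x > R \<Longrightarrow> f x = 0" using assms unfolding test_function_iff by blast
  then have "\<forall>x. norm x > R \<longrightarrow> c * f x = 0" by simp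
  then show ?thesis using assms smooth_cmult unfolding test_function_iff by blast
qed

lemma test_function_affine:
  fixes f :: "real^'n \<Rightarrow> complex"
  assumes "test_function f" "a \<noteq> 0" shows "test_function (\<lambda>x. f (a *\<^sub>R x + b))"
proof -
  obtain R where R: "\<And>x. norm x > R \<Longrightarrow> f x = 0" using assms unfolding test_function_iff by blast
  have "f (a *\<^sub>R x + b) = 0" if "norm x > (R + norm b) / \<bar>a\<bar>" for x
  proof (rule R)
    have "R + norm b < \<bar>a\<bar> * norm x" using that assms by (simp add: field_simps)
    then show "R < norm (a *\<^sub>R x + b)"
      using norm_triangle_ineq4[of "a *\<^sub>R x + b" b] by simp
  qed
  then show ?thesis using assms smooth_affine unfolding test_function_iff by blast
qed

lemma test_function_continuous: "test_function f \<Longrightarrow> continuous_on UNIV f"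
  by (simp add: test_function_def smooth_continuous)

lemma compact_support_integrable:
  fixes f :: "'a::euclidean_space \<Rightarrow> 'b::euclidean_space"
  assumes "continuous_on UNIV f" "\<And>x. norm x > R \<Longrightarrow> f x = 0"
  shows "integrable lborel f"
proof -
  have "set_integrable lborel (cball 0 R) f"
    unfolding set_integrable_def
    using assms(1) by (intro borel_integrable_compact) (auto intro: continuous_on_subset)
  then show ?thesis
    unfolding set_integrable_def
    by (rule Bochner_Integration.integrable_cong[THEN iffD1, rotated 2])
       (use assms(2) in \<open>force simp: indicator_def\<close>)+
qed

lemma compact_support_bounded:
  fixes f :: "'a::euclidean_space \<Rightarrow> 'b::real_normed_vector"
  assumes "continuous_on UNIV f" "\<And>x. norm x > R \<Longrightarrow> f x = 0"
  obtains M where "\<And>x. norm (f x) \<le> M" "M \<ge> 0"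
proof -
  have "bounded (f ` cball 0 R)"
    using assms(1) by (intro compact_imp_bounded compact_continuous_image) (auto intro: continuous_on_subset)
  then obtain M where M: "\<And>x. x \<in> cball 0 R \<Longrightarrow> norm (f x) \<le> M"
    unfolding bounded_iff by blast
  show thesis
  proof
    show "norm (f x) \<le> max M 0" for x
      using M[of x] assms(2)[of x] by (cases "norm x > R") (auto simp: le_max_iff_disj)
  qed simp
qed

lemma test_function_integrable:
  fixes f :: "real^'n \<Rightarrow> complex"
  assumes "test_function f" shows "integrable lborel f"
proof -
  obtain R where R: "\<And>x. norm x > R \<Longrightarrow> f x = 0" using assms unfolding test_function_iff by blast
  show ?thesis by (rule compact_support_integrable[OF test_function_continuous[OF assms] R])
qed

lemma test_function_bounded:
  fixes f :: "real^'n \<Rightarrow> complex"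
  assumes "test_function f" obtains M where "\<And>x. norm (f x) \<le> M" "M \<ge> 0"
proof -
  obtain R where R: "\<And>x. norm x > R \<Longrightarrow> f x = 0" using assms unfolding test_function_iff by blast
  show ?thesis
    by (rule compact_support_bounded[OF test_function_continuous[OF assms] R]) (auto intro: that)
qed

text \<open>The family \<open>t\<^sup>-\<^sup>k e\<^bsup>-1/t\<^esup>\<close>, extended by zero, is closed under differentiation up to linear combinations, which spares a
  computation of all derivatives of \<open>e\<^bsup>-1/t\<^esup>\<close>.\<close>

definition flat_exp :: "nat \<Rightarrow> real \<Rightarrow> real" where
  "flat_exp k t = (if t > 0 then (1 / t) ^ k * exp (- (1 / t)) else 0)"

lemma flat_exp_tendsto_0: "(flat_exp k \<longlongrightarrow> 0) (at 0)"
proof -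
  have "((\<lambda>t::real. inverse t ^ k / exp (inverse t)) \<longlongrightarrow> 0) (at_right 0)"
    by (rule filterlim_compose[OF tendsto_power_div_exp_0 filterlim_inverse_at_top_right])
  moreover have "eventually (\<lambda>t::real. inverse t ^ k / exp (inverse t) = flat_exp k t) (at_right 0)"
    using eventually_at_right_less[of 0]
    by eventually_elim (simp add: flat_exp_def exp_minus field_simps)
  ultimately have "(flat_exp k \<longlongrightarrow> 0) (at_right 0)"
    by (rule Lim_transform_eventually)
  moreover have "(flat_exp k \<longlongrightarrow> 0) (at_left 0)"
    by (rule tendsto_eventually) (auto simp: flat_exp_def eventually_at_left[of "-1"] intro!: exI[of _ "-1"])
  ultimately show ?thesis by (simp add: filterlim_split_at)
qed

lemma flat_exp_has_derivative:
  "(flat_exp k has_real_derivative (flat_exp (k + 2) t - of_nat k * flat_exp (k + 1) t)) (at t)"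
proof -
  consider "t > 0" | "t < 0" | "t = 0" by linarith
  then show ?thesis
  proof cases
    case 1
    have u: "((\<lambda>t. 1 / t) has_real_derivative - ((1 / t)\<^sup>2)) (at t)"
      using 1 by (auto intro!: derivative_eq_intros simp: power2_eq_square)
    have "((\<lambda>t. (1 / t) ^ k * exp (- (1 / t))) has_real_derivative
        of_nat k * (1 / t) ^ (k - 1) * - ((1 / t)\<^sup>2) * exp (- (1 / t))
        + (1 / t) ^ k * (exp (- (1 / t)) * (1 / t)\<^sup>2)) (at t)"
      by (rule derivative_eq_intros u refl)+ simp
    also have "of_nat k * (1 / t) ^ (k - 1) * - ((1 / t)\<^sup>2) * exp (- (1 / t))
        + (1 / t) ^ k * (exp (- (1 / t)) * (1 / t)\<^sup>2)
        = flat_exp (k + 2) t - of_nat k * flat_exp (k + 1) t"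
      using 1 by (cases k) (simp_all add: flat_exp_def power2_eq_square algebra_simps add_divide_distrib del: power_one_over)
    finally have "((\<lambda>t. (1 / t) ^ k * exp (- (1 / t))) has_real_derivative
        (flat_exp (k + 2) t - of_nat k * flat_exp (k + 1) t)) (at t)" .
    then show ?thesis
      by (rule has_field_derivative_transform_within_open[of _ _ _ "{0<..}"])
         (use 1 in \<open>auto simp: flat_exp_def\<close>)
  next
    case 2
    have "((\<lambda>_. 0) has_real_derivative 0) (at t)" by simp
    then have "(flat_exp k has_real_derivative 0) (at t)"
      by (rule has_field_derivative_transform_within_open[of _ _ _ "{..<0}"])
         (use 2 in \<open>auto simp: flat_exp_def\<close>)
    then show ?thesis using 2 by (simp add: flat_exp_def)
  next
    case 3
    have "eventually (\<lambda>h. flat_exp (Suc k) h = (flat_exp k (0 + h) - flat_exp k 0) / h) (at 0)"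
      by (auto simp: flat_exp_def eventually_at_filter field_simps)
    then have "((\<lambda>h. (flat_exp k (0 + h) - flat_exp k 0) / h) \<longlongrightarrow> 0) (at 0)"
      using flat_exp_tendsto_0[of "Suc k"] by (rule Lim_transform_eventually[rotated])
    then show ?thesis using 3 by (simp add: DERIV_def flat_exp_def)
  qed
qed

text \<open>A class of functions that is closed under partial derivatives and contains the bump function
  \<open>e\<^bsup>-1/(1-|x|\<^sup>2)\<^esup>\<close>. Smoothness of all members is immediate from this closure.\<close>

inductive bump_span :: "(real^'n \<Rightarrow> complex) \<Rightarrow> bool" where
  base: "bump_span (\<lambda>x. of_real (flat_exp k (1 - x \<bullet> x)))"
| coord: "bump_span f \<Longrightarrow> bump_span (\<lambda>x. of_real (x $ i) * f x)"
| cmult: "bump_span f \<Longrightarrow> bump_span (\<lambda>x. c * f x)"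
| add: "bump_span f \<Longrightarrow> bump_span g \<Longrightarrow> bump_span (\<lambda>x. f x + g x)"

lemma bump_span_deriv:
  fixes f :: "real^'n \<Rightarrow> complex"
  assumes "bump_span f"
  shows "(\<forall>x. f differentiable (at x)) \<and> (\<forall>i. bump_span (partial_deriv i f))"
  using assms
proof induction
  case (base k)
  let ?f = "\<lambda>x :: real^'n. complex_of_real (flat_exp k (1 - x \<bullet> x))"
  let ?d = "\<lambda>x :: real^'n. flat_exp (k + 2) (1 - x \<bullet> x) - of_nat k * flat_exp (k + 1) (1 - x \<bullet> x)"
  have 1: "(?f has_derivative (\<lambda>v. of_real (?d x * (- (2 * (x \<bullet> v)))))) (at x)" for x
  proof -
    have "((\<lambda>x :: real^'n. 1 - x \<bullet> x) has_derivative (\<lambda>v. - (2 * (x \<bullet> v)))) (at x)"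
      by (auto intro!: derivative_eq_intros simp: inner_commute)
    then have "((\<lambda>x. flat_exp k (1 - x \<bullet> x)) has_derivative (\<lambda>v. ?d x * (- (2 * (x \<bullet> v))))) (at x)"
      using flat_exp_has_derivative[of k "1 - x \<bullet> x"]
      unfolding has_field_derivative_def by (rule has_derivative_compose)
    then show ?thesis by (rule has_derivative_of_real)
  qed
  have "partial_deriv i ?f = (\<lambda>x. (-2) * (of_real (x $ i) * of_real (flat_exp (k + 2) (1 - x \<bullet> x)))
      + (2 * of_nat k) * (of_real (x $ i) * of_real (flat_exp (k + 1) (1 - x \<bullet> x))))" for i
    by (rule ext) (simp add: partial_deriv_eqI[OF 1] inner_axis algebra_simps)
  note pd = this
  show ?case
  proof (intro conjI allI)
    show "?f differentiable (at x)" for x using 1 by (auto simp only: differentiable_def)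
    show "bump_span (partial_deriv i ?f)" for i unfolding pd by (intro bump_span.intros)
  qed
next
  case (coord f j)
  have 1: "((\<lambda>x :: real^'n. complex_of_real (x $ j)) has_derivative (\<lambda>v. of_real (v $ j))) (at x)" for x
    by (intro has_derivative_of_real bounded_linear_imp_has_derivative bounded_linear_vec_nth)
  have 2: "((\<lambda>x. of_real (x $ j) * f x) has_derivative
      (\<lambda>v. of_real (x $ j) * (\<Sum>i\<in>UNIV. v $ i *\<^sub>R partial_deriv i f x) + of_real (v $ j) * f x)) (at x)" for x
    by (intro has_derivative_mult 1 derivative_eq_sum_partial) (use coord in blast)
  have "partial_deriv i (\<lambda>x. of_real (x $ j) * f x)
      = (\<lambda>x. of_real (x $ j) * partial_deriv i f x + (if i = j then 1 else 0) * f x)" for i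
    by (rule ext) (simp add: partial_deriv_eqI[OF 2] axis_def if_distrib[of "\<lambda>c. c *\<^sub>R _"] cong: if_cong)
  then show ?case using 2 coord by (auto intro!: bump_span.intros simp: differentiable_def)
next
  case (cmult f c)
  then have "partial_deriv i (\<lambda>x. c * f x) = (\<lambda>x. c * partial_deriv i f x)" for i
    by (simp add: fun_eq_iff partial_deriv_cmult)
  then show ?case using cmult by (auto intro!: bump_span.intros)
next
  case (add f g)
  then have "partial_deriv i (\<lambda>x. f x + g x) = (\<lambda>x. partial_deriv i f x + partial_deriv i g x)" for i
    by (simp add: fun_eq_iff partial_deriv_add)
  then show ?case using add by (auto intro!: bump_span.intros)
qed

lemma bump_span_smooth: "bump_span f \<Longrightarrow> smooth f"
proof -
  assume f: "bump_span f"
  have "bump_span (iter_partial_deriv js f)" for js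
    by (induction js) (use f bump_span_deriv in auto)
  then show "smooth f" unfolding smooth_def using bump_span_deriv by blast
qed

lemma mollifier_exists:
  obtains \<rho> :: "real^'n \<Rightarrow> real" where "test_function (\<lambda>x. complex_of_real (\<rho> x))" "\<And>x. \<rho> x \<ge> 0"
    "\<And>x. norm x > 1 \<Longrightarrow> \<rho> x = 0" "integrable lborel \<rho>" "(LINT x|lborel. \<rho> x) = 1"
proof -
  define b where "b x = flat_exp 0 (1 - x \<bullet> x)" for x :: "real^'n"
  have b0: "b x \<ge> 0" for x by (simp add: b_def flat_exp_def)
  have bs: "b x = 0" if "norm x > 1" for x
  proof -
    have "x \<bullet> x > 1" using that by (simp add: dot_square_norm one_less_power)
    then show ?thesis by (simp add: b_def flat_exp_def)
  qed
  have sm: "smooth (\<lambda>x. complex_of_real (b x))"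
    unfolding b_def by (rule bump_span_smooth[OF bump_span.base])
  have tb: "test_function (\<lambda>x. complex_of_real (b x))"
    unfolding test_function_iff using sm bs by (intro conjI exI[of _ 1]) auto
  have ib: "integrable lborel b"
    using integrable_Re[OF test_function_integrable[OF tb]] by simp
  have cb: "continuous_on UNIV b"
    using continuous_on_Re[OF test_function_continuous[OF tb]] by simp
  have "(LINT x|lborel. b x) \<noteq> 0"
  proof
    assume "(LINT x|lborel. b x) = 0"
    then have "AE x in lborel. b x = 0" using integral_nonneg_eq_0_iff_AE[OF ib] b0 by simp
    then have "AE x in lebesgue. x \<notin> {x. b x \<noteq> 0}" by (simp add: AE_completion)
    moreover have op: "open {x. b x \<noteq> 0}" by (intro open_Collect_neq cb continuous_on_const)
    ultimately have "{x. b x \<noteq> 0} \<in> null_sets lebesgue"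
      by (subst (asm) AE_iff_null_sets[symmetric]) auto
    then have "negligible {x. b x \<noteq> 0}" by (simp add: negligible_iff_null_sets)
    moreover have "0 \<in> {x. b x \<noteq> 0}" by (simp add: b_def flat_exp_def)
    ultimately show False using open_not_negligible[OF op] by blast
  qed
  then have pos: "(LINT x|lborel. b x) > 0"
    using Bochner_Integration.integral_nonneg[of lborel b] b0 by (simp add: less_le)
  define c where "c = (LINT x|lborel. b x)"
  show thesis
  proof
    show "test_function (\<lambda>x. complex_of_real (b x / c))"
      using test_function_cmult[OF tb, of "1 / of_real c"] by simp
    show "b x / c \<ge> 0" for x using b0 pos by (simp add: c_def)
    show "norm x > 1 \<Longrightarrow> b x / c = 0" for x using bs by simp
    show "integrable lborel (\<lambda>x. b x / c)" using ib by simp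
    show "(LINT x|lborel. b x / c) = 1" using pos by (simp add: c_def)
  qed
qed

section \<open>The Fourier transform of integrable functions\<close>

lemma borel_measurable_cis [measurable (raw)]:
  "f \<in> borel_measurable M \<Longrightarrow> (\<lambda>x. cis (f x)) \<in> borel_measurable M"
  by (rule measurable_compose[OF _ borel_measurable_continuous_onI[OF continuous_on_cis[OF continuous_on_id]]])

lemma borel_measurable_cnj [measurable (raw)]:
  "f \<in> borel_measurable M \<Longrightarrow> (\<lambda>x. cnj (f x)) \<in> borel_measurable M"
  by (rule measurable_compose[OF _ borel_measurable_continuous_onI[OF continuous_on_cnj[OF continuous_on_id]]])

lemma borel_measurable_cis_inner:
  "(\<lambda>(x :: 'a::euclidean_space, y). cis (c * (x \<bullet> y))) \<in> borel_measurable (lborel \<Otimes>\<^sub>M lborel)"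
  unfolding lborel_prod split_beta measurable_lborel2
  by (intro borel_measurable_continuous_onI continuous_intros)

lemma norm_squared_Basis: "(norm x)\<^sup>2 = (\<Sum>b\<in>Basis. (x \<bullet> b)\<^sup>2)" for x :: "'a::euclidean_space"
  unfolding power2_norm_eq_inner by (subst euclidean_inner) (simp add: power2_eq_square)

lemma integral_lborel_affine:
  fixes f :: "'a::euclidean_space \<Rightarrow> 'b::{banach, second_countable_topology}"
  assumes "c \<noteq> 0" and [measurable]: "f \<in> borel_measurable borel"
  shows "(LINT x|lborel. f x) = \<bar>c\<bar> ^ DIM('a) *\<^sub>R (LINT x|lborel. f (t + c *\<^sub>R x))"
  by (subst lborel_affine[OF assms(1), of t], subst integral_density) (simp_all add: integral_distr)

lemma nn_integral_lborel_affine: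
  fixes f :: "'a::euclidean_space \<Rightarrow> ennreal"
  assumes "c \<noteq> 0" and [measurable]: "f \<in> borel_measurable borel"
  shows "(\<integral>\<^sup>+x. f x \<partial>lborel) = ennreal (\<bar>c\<bar> ^ DIM('a)) * (\<integral>\<^sup>+x. f (t + c *\<^sub>R x) \<partial>lborel)"
  by (subst lborel_affine[OF assms(1), of t], subst nn_integral_density)
     (simp_all add: nn_integral_distr nn_integral_cmult)

lemma integrable_lborel_affine:
  fixes f :: "'a::euclidean_space \<Rightarrow> 'b::{banach, second_countable_topology}"
  assumes c: "c \<noteq> 0" and f: "integrable lborel f"
  shows "integrable lborel (\<lambda>x. f (t + c *\<^sub>R x))"
proof -
  have [measurable]: "f \<in> borel_measurable borel" using f by simp
  have "(\<integral>\<^sup>+x. norm (f x) \<partial>lborel) < \<infinity>" using f by (simp add: integrable_iff_bounded)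
  then have "ennreal (\<bar>c\<bar> ^ DIM('a)) * (\<integral>\<^sup>+x. norm (f (t + c *\<^sub>R x)) \<partial>lborel) < \<infinity>"
    by (subst (asm) nn_integral_lborel_affine[OF c, of _ t]) simp_all
  then show ?thesis
    using c by (auto simp: integrable_iff_bounded ennreal_mult_less_top)
qed

text \<open>The integrability needed for Fubini arguments with an oscillating kernel \<open>k\<close>.\<close>

lemma integrable_tensor:
  fixes f :: "'a::euclidean_space \<Rightarrow> complex" and g :: "'b::euclidean_space \<Rightarrow> complex"
  assumes f: "integrable lborel f" and g: "integrable lborel g"
    and k [measurable]: "(\<lambda>(x, y). k x y) \<in> borel_measurable (lborel \<Otimes>\<^sub>M lborel)"
    and kb: "\<And>x y. norm (k x y) \<le> 1"
  shows "integrable (lborel \<Otimes>\<^sub>M lborel) (\<lambda>(x, y). f x * g y * k x y)"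
proof (rule Bochner_Integration.integrable_bound)
  have [measurable]: "f \<in> borel_measurable borel" "g \<in> borel_measurable borel" using f g by simp_all
  show "integrable (lborel \<Otimes>\<^sub>M lborel) (\<lambda>(x, y). f x * g y)"
  proof (rule lborel_pair.Fubini_integrable)
    show "integrable lborel (\<lambda>x. LINT y|lborel. norm (case (x, y) of (x, y) \<Rightarrow> f x * g y))"
      using f by (simp add: norm_mult)
    show "AE x in lborel. integrable lborel (\<lambda>y. case (x, y) of (x, y) \<Rightarrow> f x * g y)"
      using g by simp
  qed measurable
  show "(\<lambda>(x, y). f x * g y * k x y) \<in> borel_measurable (lborel \<Otimes>\<^sub>M lborel)" by measurable
  show "AE p in lborel \<Otimes>\<^sub>M lborel. norm (case p of (x, y) \<Rightarrow> f x * g y * k x y)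
      \<le> norm (case p of (x, y) \<Rightarrow> f x * g y)"
    using kb by (auto simp: norm_mult intro!: mult_right_le_one_le AE_I2)
qed

lemma fourier_lborel:
  fixes f :: "real^'n \<Rightarrow> complex"
  assumes [measurable]: "f \<in> borel_measurable borel"
  shows "fourier f \<xi> = (LINT x|lborel. f x * cis (- 2 * pi * (x \<bullet> \<xi>)))"
  unfolding fourier_def by (rule integral_completion) measurable

lemma fourier_cong_AE:
  fixes f g :: "real^'n \<Rightarrow> complex"
  assumes "AE x in lebesgue. f x = g x"
    and [measurable]: "f \<in> borel_measurable lebesgue" "g \<in> borel_measurable lebesgue"
  shows "fourier f = fourier g"
proof
  fix \<xi> :: "real^'n"
  have [measurable]: "(\<lambda>x. cis (- 2 * pi * (x \<bullet> \<xi>))) \<in> borel_measurable lebesgue"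
    by (rule measurable_completion) measurable
  show "fourier f \<xi> = fourier g \<xi>"
    unfolding fourier_def
  proof (rule integral_cong_AE)
    show "AE x in lebesgue. f x * cis (- 2 * pi * (x \<bullet> \<xi>)) = g x * cis (- 2 * pi * (x \<bullet> \<xi>))"
      using assms(1) by eventually_elim simp
  qed measurable
qed

lemma integrable_fourier_integrand:
  fixes f :: "real^'n \<Rightarrow> complex"
  assumes "integrable lborel f"
  shows "integrable lborel (\<lambda>x. f x * cis (- 2 * pi * (x \<bullet> \<xi>)))"
proof (rule Bochner_Integration.integrable_bound[OF assms])
  have [measurable]: "f \<in> borel_measurable borel" using assms by simp
  show "(\<lambda>x. f x * cis (- 2 * pi * (x \<bullet> \<xi>))) \<in> borel_measurable lborel" by measurable
qed (simp add: norm_mult)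

lemma norm_fourier_le:
  fixes f :: "real^'n \<Rightarrow> complex"
  assumes "integrable lborel f"
  shows "norm (fourier f \<xi>) \<le> (LINT x|lborel. norm (f x))"
proof -
  have [measurable]: "f \<in> borel_measurable borel" using assms by simp
  have "norm (fourier f \<xi>) \<le> (LINT x|lborel. norm (f x * cis (- 2 * pi * (x \<bullet> \<xi>))))"
    by (simp add: fourier_lborel)
  then show ?thesis by (simp add: norm_mult)
qed

lemma continuous_on_fourier:
  fixes f :: "real^'n \<Rightarrow> complex"
  assumes "integrable lborel f"
  shows "continuous_on UNIV (fourier f)"
proof -
  have [measurable]: "f \<in> borel_measurable borel" using assms by simp
  show ?thesis
    unfolding continuous_on_sequentially comp_def
  proof (intro allI ballI impI, elim conjE)
    fix X :: "nat \<Rightarrow> real^'n" and \<xi> assume X: "X \<longlonglongrightarrow> \<xi>"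
    show "(\<lambda>n. fourier f (X n)) \<longlonglongrightarrow> fourier f \<xi>"
      unfolding fourier_lborel[OF \<open>f \<in> _\<close>]
    proof (rule integral_dominated_convergence[where w="\<lambda>x. norm (f x)"])
      have "isCont cis t" for t
        using continuous_on_cis[OF continuous_on_id[of UNIV]] by (simp add: continuous_on_eq_continuous_at)
      then show "AE x in lborel. (\<lambda>n. f x * cis (- 2 * pi * (x \<bullet> X n))) \<longlonglongrightarrow> f x * cis (- 2 * pi * (x \<bullet> \<xi>))"
        by (intro AE_I2 tendsto_mult tendsto_const isCont_tendsto_compose[where g=cis] tendsto_inner X)
    qed (use assms in \<open>auto simp: norm_mult\<close>)
  qed
qed

lemma fourier_measurable:
  fixes f :: "real^'n \<Rightarrow> complex"
  assumes "integrable lborel f" shows "fourier f \<in> borel_measurable borel"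
  by (rule borel_measurable_continuous_onI[OF continuous_on_fourier[OF assms]])

text \<open>Fubini: both sides are the double integral of \<open>u(x) v(\<xi>) e\<^bsup>-2\<pi>i x\<xi>\<^esup>\<close>.\<close>

lemma fourier_multiplication_formula:
  fixes u v :: "real^'n \<Rightarrow> complex"
  assumes u: "integrable lborel u" and v: "integrable lborel v"
  shows "(LINT \<xi>|lborel. fourier u \<xi> * v \<xi>) = (LINT x|lborel. u x * fourier v x)"
proof -
  have [measurable]: "u \<in> borel_measurable borel" "v \<in> borel_measurable borel" using u v by simp_all
  have i: "integrable (lborel \<Otimes>\<^sub>M lborel) (\<lambda>(x, \<xi>). u x * v \<xi> * cis (- 2 * pi * (x \<bullet> \<xi>)))"
    by (rule integrable_tensor[OF u v borel_measurable_cis_inner]) simp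
  have "(LINT \<xi>|lborel. fourier u \<xi> * v \<xi>)
      = (LINT \<xi>|lborel. LINT x|lborel. u x * v \<xi> * cis (- 2 * pi * (x \<bullet> \<xi>)))"
    by (rule Bochner_Integration.integral_cong)
       (simp_all add: fourier_lborel ac_simps flip: integral_mult_left_zero integral_mult_right_zero)
  also have "\<dots> = (LINT x|lborel. LINT \<xi>|lborel. u x * v \<xi> * cis (- 2 * pi * (x \<bullet> \<xi>)))"
    by (rule lborel_pair.Fubini_integral[OF i])
  also have "\<dots> = (LINT x|lborel. u x * fourier v x)"
    by (rule Bochner_Integration.integral_cong)
       (simp_all add: fourier_lborel inner_commute mult.assoc)
  finally show ?thesis .
qed

section \<open>Gaussian regularisation and the Plancherel inequality\<close>

definition gauss :: "real^'n \<Rightarrow> real" where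
  "gauss x = (\<Prod>b\<in>Basis. std_normal_density (x \<bullet> b))"

lemma gauss_eq: "gauss x = (1 / sqrt (2 * pi)) ^ CARD('n) * exp (- ((norm x)\<^sup>2 / 2))" for x :: "real^'n"
proof -
  have "gauss x = (1 / sqrt (2 * pi)) ^ DIM(real^'n) * (\<Prod>b\<in>Basis. exp (- ((x \<bullet> b)\<^sup>2 / 2)))"
    unfolding gauss_def std_normal_density_def prod.distrib by simp
  also have "(\<Prod>b\<in>Basis. exp (- ((x \<bullet> b)\<^sup>2 / 2))) = exp (\<Sum>b\<in>Basis. - ((x \<bullet> b)\<^sup>2 / 2))"
    by (simp add: exp_sum)
  also have "(\<Sum>b\<in>Basis. - ((x \<bullet> b)\<^sup>2 / 2)) = - ((norm x)\<^sup>2 / 2)"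
    unfolding norm_squared_Basis[of x] by (simp add: sum_negf sum_divide_distrib)
  finally show ?thesis by simp
qed

lemma gauss_pos: "gauss x > 0" for x :: "real^'n" by (simp add: gauss_eq)

lemma gauss_measurable [measurable]: "gauss \<in> borel_measurable borel"
  unfolding gauss_def by measurable

lemma nn_integral_gauss: "(\<integral>\<^sup>+x. ennreal (gauss (x :: real^'n)) \<partial>lborel) = 1"
proof -
  have 1: "(\<integral>\<^sup>+x. ennreal (std_normal_density x) \<partial>lborel) = 1"
    using nn_integral_eq_integral[OF integrable_normal_density[of 1 0]] by simp
  have "(\<integral>\<^sup>+x. ennreal (gauss (x :: real^'n)) \<partial>lborel)
      = (\<integral>\<^sup>+x. (\<Prod>b\<in>Basis. ennreal (std_normal_density ((x :: real^'n) \<bullet> b))) \<partial>lborel)"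
    by (simp add: gauss_def prod_ennreal)
  also have "\<dots> = 1"
    by (subst nn_integral_lborel_prod) (simp_all add: 1)
  finally show ?thesis .
qed

lemma integrable_gauss: "integrable lborel (gauss :: real^'n \<Rightarrow> real)"
  using nn_integral_gauss[where 'n='n] gauss_pos
  by (intro integrableI_nonneg) (auto intro!: AE_I2 less_imp_le)

lemma integral_gauss: "(LINT x|lborel. gauss (x :: real^'n)) = 1"
  using nn_integral_gauss[where 'n='n] gauss_pos
  by (subst integral_eq_nn_integral) (auto intro!: AE_I2 less_imp_le)

lemma char_gauss_1d:
  "(CLINT x|lborel. std_normal_density x *\<^sub>R iexp (t * x)) = of_real (exp (- (t\<^sup>2) / 2))"
  using fun_cong[OF char_std_normal_distribution, of t]
  unfolding char_def by (subst (asm) integral_density) auto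

lemma char_gauss:
  fixes \<xi> :: "real^'n"
  shows "(CLINT x|lborel. of_real (gauss x) * cis (x \<bullet> \<xi>)) = of_real (exp (- ((norm \<xi>)\<^sup>2 / 2)))"
proof -
  interpret P: product_sigma_finite "\<lambda>_ :: real^'n. lborel :: real measure" by standard
  let ?f = "\<lambda>(b :: real^'n) t. std_normal_density t *\<^sub>R iexp ((\<xi> \<bullet> b) * t)"
  have eq: "complex_of_real (gauss x) * cis (x \<bullet> \<xi>) = (\<Prod>b\<in>Basis. ?f b (x \<bullet> b))" for x
  proof -
    have "cis (x \<bullet> \<xi>) = (\<Prod>b\<in>Basis. iexp ((\<xi> \<bullet> b) * (x \<bullet> b)))"
      unfolding cis_conv_exp exp_sum[OF finite_Basis, symmetric]
      by (subst euclidean_inner) (simp add: sum_distrib_left mult.commute)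
    then show ?thesis
      by (simp add: gauss_def scaleR_conv_of_real prod.distrib)
  qed
  have int: "integrable lborel (?f b)" for b
    by (rule Bochner_Integration.integrable_bound[OF integrable_normal_density[of 1 0]]) auto
  have "(CLINT x|lborel. of_real (gauss x) * cis (x \<bullet> \<xi>))
      = (CLINT g|(\<Pi>\<^sub>M b\<in>Basis. lborel). \<Prod>b\<in>Basis. ?f b ((\<Sum>b\<in>Basis. g b *\<^sub>R b) \<bullet> b))"
    unfolding eq by (subst lborel_eq, subst integral_distr) auto
  also have "\<dots> = (CLINT g|(\<Pi>\<^sub>M b\<in>Basis. lborel). \<Prod>b\<in>Basis. ?f b (g b))"
    by (intro Bochner_Integration.integral_cong prod.cong refl) (simp add: inner_sum_left_Basis)
  also have "\<dots> = (\<Prod>b\<in>Basis. CLINT t|lborel. ?f b t)"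
    by (rule P.product_integral_prod[OF finite_Basis int])
  also have "\<dots> = (\<Prod>b\<in>Basis. of_real (exp (- ((\<xi> \<bullet> b)\<^sup>2) / 2)))"
    by (simp only: char_gauss_1d)
  also have "\<dots> = of_real (exp (\<Sum>b\<in>Basis. - ((\<xi> \<bullet> b)\<^sup>2) / 2))"
    by (simp add: exp_sum)
  also have "(\<Sum>b\<in>Basis. - ((\<xi> \<bullet> b)\<^sup>2) / 2) = - ((norm \<xi>)\<^sup>2 / 2)"
    unfolding norm_squared_Basis[of \<xi>] by (simp add: sum_negf sum_divide_distrib)
  finally show ?thesis .
qed

text \<open>The scaling is the one for which the Fourier transform of this weight is the probability density \<open>gauss_kernel \<tau>\<close>.\<close>

definition gauss_weight :: "real \<Rightarrow> real^'n \<Rightarrow> real" where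
  "gauss_weight \<tau> \<xi> = exp (- (2 * pi\<^sup>2 * \<tau>\<^sup>2 * (norm \<xi>)\<^sup>2))"

definition gauss_kernel :: "real \<Rightarrow> real^'n \<Rightarrow> real" where
  "gauss_kernel \<tau> x = gauss ((1 / \<tau>) *\<^sub>R x) / \<tau> ^ CARD('n)"

lemma gauss_weight_bounds: "0 < gauss_weight \<tau> \<xi>" "gauss_weight \<tau> \<xi> \<le> 1"
  by (simp_all add: gauss_weight_def)

lemma gauss_weight_eq:
  fixes \<xi> :: "real^'n"
  shows "gauss_weight \<tau> \<xi> = sqrt (2 * pi) ^ CARD('n) * gauss ((2 * pi * \<tau>) *\<^sub>R \<xi>)"
  by (simp add: gauss_weight_def gauss_eq power_mult_distrib power_divide mult_ac)

lemma gauss_weight_measurable [measurable]: "gauss_weight \<tau> \<in> borel_measurable borel"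
  unfolding gauss_weight_def by measurable

lemma gauss_kernel_measurable [measurable]: "gauss_kernel \<tau> \<in> borel_measurable borel"
  unfolding gauss_kernel_def by measurable

lemma integrable_gauss_weight:
  assumes "\<tau> > 0" shows "integrable lborel (gauss_weight \<tau> :: real^'n \<Rightarrow> real)"
  unfolding gauss_weight_eq
  using integrable_lborel_affine[OF _ integrable_gauss, of "2 * pi * \<tau>" 0] assms by simp

lemma gauss_kernel_minus: "gauss_kernel \<tau> (- x) = gauss_kernel \<tau> x"
  by (simp add: gauss_kernel_def gauss_eq)

lemma gauss_kernel_nonneg: "\<tau> > 0 \<Longrightarrow> gauss_kernel \<tau> x \<ge> 0"
  by (simp add: gauss_kernel_def less_imp_le[OF gauss_pos])

lemma nn_integral_gauss_kernel:
  fixes x :: "real^'n"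
  assumes \<tau>: "\<tau> > 0"
  shows "(\<integral>\<^sup>+y. ennreal (gauss_kernel \<tau> (x - y)) \<partial>lborel) = 1"
proof -
  have "(\<integral>\<^sup>+y. ennreal (gauss_kernel \<tau> (x - y)) \<partial>lborel)
      = ennreal (\<tau> ^ CARD('n)) * (\<integral>\<^sup>+y. ennreal (gauss_kernel \<tau> (x - (x + (- \<tau>) *\<^sub>R y))) \<partial>lborel)"
    using \<tau> by (subst nn_integral_lborel_affine[of "- \<tau>" _ x]) auto
  also have "\<dots> = ennreal (\<tau> ^ CARD('n)) * (\<integral>\<^sup>+y. ennreal (1 / \<tau> ^ CARD('n)) * ennreal (gauss (y :: real^'n)) \<partial>lborel)"
    using \<tau> gauss_pos by (simp add: gauss_kernel_def ennreal_mult'[symmetric])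
  also have "\<dots> = 1"
    using \<tau> by (subst nn_integral_cmult) (simp_all add: nn_integral_gauss ennreal_mult''[symmetric])
  finally show ?thesis .
qed

lemma fourier_gauss_weight:
  fixes x y :: "real^'n"
  assumes \<tau>: "\<tau> > 0"
  shows "fourier (\<lambda>\<xi>. of_real (gauss_weight \<tau> \<xi>) * cis (2 * pi * (x \<bullet> \<xi>))) y = of_real (gauss_kernel \<tau> (x - y))"
proof -
  let ?c = "1 / (2 * pi * \<tau>)"
  have c: "?c > 0" using \<tau> by simp
  have "fourier (\<lambda>\<xi>. of_real (gauss_weight \<tau> \<xi>) * cis (2 * pi * (x \<bullet> \<xi>))) y
      = (CLINT \<xi>|lborel. of_real (gauss_weight \<tau> \<xi>) * cis (2 * pi * (\<xi> \<bullet> (x - y))))"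
    by (subst fourier_lborel)
       (auto simp: mult.assoc cis_mult inner_diff_right inner_commute algebra_simps
         intro!: Bochner_Integration.integral_cong)
  also have "\<dots> = ?c ^ CARD('n) *\<^sub>R
      (CLINT \<xi>|lborel. of_real (gauss_weight \<tau> (0 + ?c *\<^sub>R \<xi>)) * cis (2 * pi * ((0 + ?c *\<^sub>R \<xi>) \<bullet> (x - y))))"
    using c by (subst integral_lborel_affine[of ?c _ 0]) auto
  also have "(\<lambda>\<xi>. complex_of_real (gauss_weight \<tau> (0 + ?c *\<^sub>R \<xi>)) * cis (2 * pi * ((0 + ?c *\<^sub>R \<xi>) \<bullet> (x - y))))
      = (\<lambda>\<xi>. of_real (sqrt (2 * pi) ^ CARD('n)) * (of_real (gauss \<xi>) * cis (\<xi> \<bullet> ((1 / \<tau>) *\<^sub>R (x - y)))))"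
    using \<tau> by (simp add: gauss_weight_eq fun_eq_iff)
  also have "(CLINT \<xi>|lborel. \<dots> \<xi>)
      = of_real (sqrt (2 * pi) ^ CARD('n)) * of_real (exp (- ((norm ((1 / \<tau>) *\<^sub>R (x - y)))\<^sup>2 / 2)))"
    by (simp only: integral_mult_right_zero char_gauss)
  also have "?c ^ CARD('n) *\<^sub>R \<dots> = of_real (gauss_kernel \<tau> (x - y))"
  proof -
    have s: "sqrt (2 * pi) * sqrt (2 * pi) = 2 * pi" by simp
    have "?c ^ CARD('n) * sqrt (2 * pi) ^ CARD('n) = (1 / sqrt (2 * pi)) ^ CARD('n) / \<tau> ^ CARD('n)"
    proof -
      have "?c * sqrt (2 * pi) = (1 / sqrt (2 * pi)) / \<tau>"
        using \<tau> s by (simp add: field_simps)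
      then have "(?c * sqrt (2 * pi)) ^ CARD('n) = ((1 / sqrt (2 * pi)) / \<tau>) ^ CARD('n)"
        by (simp only:)
      then show ?thesis
        by (simp only: power_mult_distrib power_divide[of _ \<tau>])
    qed
    then show ?thesis
      unfolding gauss_kernel_def gauss_eq scaleR_conv_of_real of_real_mult[symmetric]
      by (simp add: mult.assoc[symmetric])
  qed
  finally show ?thesis .
qed

lemma integral_norm_bound_ennreal':
  fixes f :: "'a \<Rightarrow> 'b::{banach, second_countable_topology}"
  shows "ennreal (norm (integral\<^sup>L M f)) \<le> (\<integral>\<^sup>+x. norm (f x) \<partial>M)"
  by (cases "integrable M f") (simp_all add: integral_norm_bound_ennreal not_integrable_integral_eq)

text \<open>Fourier inversion with a Gaussian convergence factor. It is the multiplication formula applied to a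
  modulated Gaussian, whose transform is a translated Gaussian.\<close>

lemma fourier_inversion_gauss:
  fixes u :: "real^'n \<Rightarrow> complex"
  assumes u: "integrable lborel u" and \<tau>: "\<tau> > 0"
  shows "(LINT \<xi>|lborel. fourier u \<xi> * (of_real (gauss_weight \<tau> \<xi>) * cis (2 * pi * (x \<bullet> \<xi>))))
    = (LINT y|lborel. u y * of_real (gauss_kernel \<tau> (x - y)))"
proof -
  have i: "integrable lborel (\<lambda>\<xi>. complex_of_real (gauss_weight \<tau> \<xi>) * cis (2 * pi * (x \<bullet> \<xi>)))"
    by (rule Bochner_Integration.integrable_bound[OF integrable_gauss_weight[OF \<tau>]])
       (auto simp: norm_mult)
  show ?thesis
    by (subst fourier_multiplication_formula[OF u i]) (simp add: fourier_gauss_weight \<tau>)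
qed

lemma integrable_bounded_mult:
  fixes f g :: "'a \<Rightarrow> complex"
  assumes "integrable M f" and [measurable]: "g \<in> borel_measurable M" and "\<And>x. norm (g x) \<le> B"
  shows "integrable M (\<lambda>x. g x * f x)"
proof (rule Bochner_Integration.integrable_bound)
  have [measurable]: "f \<in> borel_measurable M" using assms by simp
  show "integrable M (\<lambda>x. of_real B * f x)" using assms by simp
  show "(\<lambda>x. g x * f x) \<in> borel_measurable M" by measurable
  have "B \<ge> 0" using assms(3) norm_ge_zero order_trans by blast
  then show "AE x in M. norm (g x * f x) \<le> norm (of_real B * f x)"
    using assms(3) by (auto simp: norm_mult intro!: mult_right_mono)
qed

text \<open>The regularised Bessel inequality. The left side is the pairing of \<open>\<phi>\<close> with its convolution with a
  Gaussian of mass 1, which is estimated by \<open>2|\<phi>(x) \<phi>(y)| \<le> |\<phi>(x)|\<^sup>2 + |\<phi>(y)|\<^sup>2\<close>.\<close>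

lemma bessel_gauss:
  fixes \<phi> :: "real^'n \<Rightarrow> complex"
  assumes \<phi>: "integrable lborel \<phi>" and sq: "integrable lborel (\<lambda>x. (norm (\<phi> x))\<^sup>2)" and \<tau>: "\<tau> > 0"
  shows "integrable lborel (\<lambda>\<xi>. (norm (fourier \<phi> \<xi>))\<^sup>2 * gauss_weight \<tau> \<xi>)"
    and "(LINT \<xi>|lborel. (norm (fourier \<phi> \<xi>))\<^sup>2 * gauss_weight \<tau> \<xi>) \<le> (LINT x|lborel. (norm (\<phi> x))\<^sup>2)"
proof -
  have [measurable]: "\<phi> \<in> borel_measurable borel" "fourier \<phi> \<in> borel_measurable borel"
    using \<phi> fourier_measurable by simp_all
  define B where "B = (LINT x|lborel. norm (\<phi> x))"
  have B: "norm (fourier \<phi> \<xi>) \<le> B" for \<xi> using norm_fourier_le[OF \<phi>] by (simp add: B_def)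
  have iv: "integrable lborel (\<lambda>\<xi>. cnj (fourier \<phi> \<xi>) * complex_of_real (gauss_weight \<tau> \<xi>))"
    by (rule integrable_bounded_mult[of _ _ _ B]) (use integrable_gauss_weight[OF \<tau>, where 'n='n] B in simp_all)
  have "integrable lborel (\<lambda>\<xi>. fourier \<phi> \<xi> * (cnj (fourier \<phi> \<xi>) * complex_of_real (gauss_weight \<tau> \<xi>)))"
    by (rule integrable_bounded_mult[OF iv _ B]) simp
  then have ic: "integrable lborel (\<lambda>\<xi>. complex_of_real ((norm (fourier \<phi> \<xi>))\<^sup>2 * gauss_weight \<tau> \<xi>))"
    by (simp add: complex_norm_square mult.assoc del: of_real_power)
  then show i: "integrable lborel (\<lambda>\<xi>. (norm (fourier \<phi> \<xi>))\<^sup>2 * gauss_weight \<tau> \<xi>)"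
    using integrable_Re[OF ic] by (simp del: of_real_mult of_real_power)
  have fv: "fourier (\<lambda>\<xi>. cnj (fourier \<phi> \<xi>) * complex_of_real (gauss_weight \<tau> \<xi>)) x
      = cnj (LINT y|lborel. \<phi> y * of_real (gauss_kernel \<tau> (x - y)))" for x
  proof -
    have "fourier (\<lambda>\<xi>. cnj (fourier \<phi> \<xi>) * complex_of_real (gauss_weight \<tau> \<xi>)) x
        = (LINT \<xi>|lborel. cnj (fourier \<phi> \<xi> * (of_real (gauss_weight \<tau> \<xi>) * cis (2 * pi * (x \<bullet> \<xi>)))))"
      by (subst fourier_lborel) (simp_all add: cis_cnj inner_commute mult.assoc)
    then show ?thesis by (simp only: Bochner_Integration.integral_cnj fourier_inversion_gauss[OF \<phi> \<tau>])
  qed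
  have "complex_of_real (LINT \<xi>|lborel. (norm (fourier \<phi> \<xi>))\<^sup>2 * gauss_weight \<tau> \<xi>)
      = (LINT \<xi>|lborel. fourier \<phi> \<xi> * (cnj (fourier \<phi> \<xi>) * complex_of_real (gauss_weight \<tau> \<xi>)))"
    unfolding integral_complex_of_real[symmetric]
    by (simp add: complex_norm_square mult.assoc del: of_real_power)
  also have "\<dots> = (LINT x|lborel. \<phi> x * cnj (LINT y|lborel. \<phi> y * of_real (gauss_kernel \<tau> (x - y))))"
    by (subst fourier_multiplication_formula[OF \<phi> iv]) (simp only: fv)
  finally have eq: "complex_of_real (LINT \<xi>|lborel. (norm (fourier \<phi> \<xi>))\<^sup>2 * gauss_weight \<tau> \<xi>) = \<dots>" .
  have "ennreal (LINT \<xi>|lborel. (norm (fourier \<phi> \<xi>))\<^sup>2 * gauss_weight \<tau> \<xi>)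
      \<le> ennreal (norm (LINT x|lborel. \<phi> x * cnj (LINT y|lborel. \<phi> y * of_real (gauss_kernel \<tau> (x - y)))))"
    unfolding eq[symmetric] by (intro ennreal_leI) simp
  also have "\<dots> \<le> (\<integral>\<^sup>+x. norm (\<phi> x * cnj (LINT y|lborel. \<phi> y * of_real (gauss_kernel \<tau> (x - y)))) \<partial>lborel)"
    by (rule integral_norm_bound_ennreal') 
  also have "\<dots> \<le> (\<integral>\<^sup>+x. \<integral>\<^sup>+y. ennreal (norm (\<phi> x) * norm (\<phi> y) * gauss_kernel \<tau> (x - y)) \<partial>lborel \<partial>lborel)"
  proof (rule nn_integral_mono)
    fix x
    have "ennreal (norm (\<phi> x * cnj (LINT y|lborel. \<phi> y * of_real (gauss_kernel \<tau> (x - y)))))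
        = ennreal (norm (\<phi> x)) * ennreal (norm (LINT y|lborel. \<phi> y * of_real (gauss_kernel \<tau> (x - y))))"
      by (simp add: norm_mult ennreal_mult')
    also have "\<dots> \<le> ennreal (norm (\<phi> x)) * (\<integral>\<^sup>+y. norm (\<phi> y * of_real (gauss_kernel \<tau> (x - y))) \<partial>lborel)"
      by (intro mult_left_mono integral_norm_bound_ennreal') simp
    also have "\<dots> = (\<integral>\<^sup>+y. ennreal (norm (\<phi> x) * norm (\<phi> y) * gauss_kernel \<tau> (x - y)) \<partial>lborel)"
      by (subst nn_integral_cmult[symmetric])
         (simp_all add: norm_mult gauss_kernel_nonneg[OF \<tau>] ennreal_mult'[symmetric] mult.assoc)
    finally show "ennreal (norm (\<phi> x * cnj (LINT y|lborel. \<phi> y * of_real (gauss_kernel \<tau> (x - y))))) \<le> \<dots>" .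
  qed
  also have "\<dots> \<le> (\<integral>\<^sup>+x. \<integral>\<^sup>+y. ennreal ((norm (\<phi> x))\<^sup>2 / 2) * ennreal (gauss_kernel \<tau> (x - y))
      + ennreal ((norm (\<phi> y))\<^sup>2 / 2) * ennreal (gauss_kernel \<tau> (x - y)) \<partial>lborel \<partial>lborel)"
  proof (intro nn_integral_mono)
    fix x y
    have "norm (\<phi> x) * norm (\<phi> y) \<le> (norm (\<phi> x))\<^sup>2 / 2 + (norm (\<phi> y))\<^sup>2 / 2"
      using sum_squares_bound[of "norm (\<phi> x)" "norm (\<phi> y)"] by simp
    then have "norm (\<phi> x) * norm (\<phi> y) * gauss_kernel \<tau> (x - y)
        \<le> ((norm (\<phi> x))\<^sup>2 / 2 + (norm (\<phi> y))\<^sup>2 / 2) * gauss_kernel \<tau> (x - y)"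
      by (intro mult_right_mono gauss_kernel_nonneg \<tau>)
    then show "ennreal (norm (\<phi> x) * norm (\<phi> y) * gauss_kernel \<tau> (x - y))
        \<le> ennreal ((norm (\<phi> x))\<^sup>2 / 2) * ennreal (gauss_kernel \<tau> (x - y))
          + ennreal ((norm (\<phi> y))\<^sup>2 / 2) * ennreal (gauss_kernel \<tau> (x - y))"
      using gauss_kernel_nonneg[OF \<tau>, of "x - y"]
      by (simp add: ennreal_mult'[symmetric] ennreal_plus[symmetric] distrib_right del: ennreal_plus)
  qed
  also have "\<dots> = (\<integral>\<^sup>+x. \<integral>\<^sup>+y. ennreal ((norm (\<phi> x))\<^sup>2 / 2) * ennreal (gauss_kernel \<tau> (x - y)) \<partial>lborel \<partial>lborel)
      + (\<integral>\<^sup>+x. \<integral>\<^sup>+y. ennreal ((norm (\<phi> y))\<^sup>2 / 2) * ennreal (gauss_kernel \<tau> (x - y)) \<partial>lborel \<partial>lborel)"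
    by (subst nn_integral_add[symmetric]) (simp_all add: nn_integral_add)
  also have "(\<integral>\<^sup>+x. \<integral>\<^sup>+y. ennreal ((norm (\<phi> x))\<^sup>2 / 2) * ennreal (gauss_kernel \<tau> (x - y)) \<partial>lborel \<partial>lborel)
      = (\<integral>\<^sup>+x. ennreal ((norm (\<phi> x))\<^sup>2 / 2) \<partial>lborel)"
    by (intro nn_integral_cong) (simp add: nn_integral_cmult nn_integral_gauss_kernel[OF \<tau>])
  also have "(\<integral>\<^sup>+x. \<integral>\<^sup>+y. ennreal ((norm (\<phi> y))\<^sup>2 / 2) * ennreal (gauss_kernel \<tau> (x - y)) \<partial>lborel \<partial>lborel)
      = (\<integral>\<^sup>+x. ennreal ((norm (\<phi> x))\<^sup>2 / 2) \<partial>lborel)"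
  proof (subst lborel_pair.Fubini')
    show "(\<integral>\<^sup>+y. \<integral>\<^sup>+x. ennreal ((norm (\<phi> y))\<^sup>2 / 2) * ennreal (gauss_kernel \<tau> (x - y)) \<partial>lborel \<partial>lborel)
        = (\<integral>\<^sup>+x. ennreal ((norm (\<phi> x))\<^sup>2 / 2) \<partial>lborel)"
    proof (intro nn_integral_cong)
      fix y :: "real^'n"
      have "(\<integral>\<^sup>+x. ennreal (gauss_kernel \<tau> (x - y)) \<partial>lborel) = 1"
        using nn_integral_gauss_kernel[OF \<tau>, of y] gauss_kernel_minus[of \<tau> "_ - y"] by simp
      then show "(\<integral>\<^sup>+x. ennreal ((norm (\<phi> y))\<^sup>2 / 2) * ennreal (gauss_kernel \<tau> (x - y)) \<partial>lborel)
          = ennreal ((norm (\<phi> y))\<^sup>2 / 2)"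
        by (simp add: nn_integral_cmult)
    qed
  qed measurable
  also have "(\<integral>\<^sup>+x. ennreal ((norm (\<phi> x))\<^sup>2 / 2) \<partial>lborel) + (\<integral>\<^sup>+x. ennreal ((norm (\<phi> x))\<^sup>2 / 2) \<partial>lborel)
      = ennreal (LINT x|lborel. (norm (\<phi> x))\<^sup>2)"
    using sq by (subst (1 2) nn_integral_eq_integral) (simp_all add: ennreal_plus[symmetric] del: ennreal_plus)
  finally show "(LINT \<xi>|lborel. (norm (fourier \<phi> \<xi>))\<^sup>2 * gauss_weight \<tau> \<xi>) \<le> (LINT x|lborel. (norm (\<phi> x))\<^sup>2)"
    by (subst (asm) ennreal_le_iff) simp_all
qed

text \<open>Gaussians of shrinking width are an approximate identity on bounded continuous functions.\<close>

lemma gauss_kernel_approximation: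
  fixes f :: "real^'n \<Rightarrow> complex"
  assumes f: "continuous_on UNIV f" and M: "\<And>x. norm (f x) \<le> M" and \<tau>: "\<And>n. \<tau> n > 0" "\<tau> \<longlonglongrightarrow> 0"
  shows "(\<lambda>n. LINT y|lborel. f y * of_real (gauss_kernel (\<tau> n) (x - y))) \<longlonglongrightarrow> f x"
    and "\<And>n. norm (LINT y|lborel. f y * of_real (gauss_kernel (\<tau> n) (x - y))) \<le> M"
proof -
  have [measurable]: "f \<in> borel_measurable borel" using f by (rule borel_measurable_continuous_onI)
  have eq: "(LINT y|lborel. f y * of_real (gauss_kernel (\<tau> n) (x - y)))
      = (LINT z|lborel. f (x + (- \<tau> n) *\<^sub>R z) * of_real (gauss z))" for n
  proof -
    have "(LINT y|lborel. f y * of_real (gauss_kernel (\<tau> n) (x - y)))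
        = \<tau> n ^ CARD('n) *\<^sub>R (LINT z|lborel. f (x + (- \<tau> n) *\<^sub>R z) * of_real (gauss_kernel (\<tau> n) (x - (x + (- \<tau> n) *\<^sub>R z))))"
      using \<tau>(1)[of n] by (subst integral_lborel_affine[of "- \<tau> n" _ x]) auto
    also have "\<dots> = (LINT z|lborel. \<tau> n ^ CARD('n) *\<^sub>R (f (x + (- \<tau> n) *\<^sub>R z) * of_real (gauss_kernel (\<tau> n) (x - (x + (- \<tau> n) *\<^sub>R z)))))"
      by simp
    also have "\<dots> = (LINT z|lborel. f (x + (- \<tau> n) *\<^sub>R z) * of_real (gauss z))"
      using \<tau>(1)[of n]
      by (intro Bochner_Integration.integral_cong refl)
         (simp add: gauss_kernel_def scaleR_conv_of_real[where 'a=complex] less_imp_neq[THEN not_sym])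
    finally show ?thesis .
  qed
  have "(\<lambda>n. LINT z|lborel. f (x + (- \<tau> n) *\<^sub>R z) * of_real (gauss z)) \<longlonglongrightarrow> (LINT z|lborel. f x * of_real (gauss (z :: real^'n)))"
  proof (rule integral_dominated_convergence[where w="\<lambda>z. M * gauss z"])
    show "AE z in lborel. (\<lambda>n. f (x + (- \<tau> n) *\<^sub>R z) * of_real (gauss z)) \<longlonglongrightarrow> f x * of_real (gauss (z :: real^'n))"
    proof (intro AE_I2 tendsto_mult tendsto_const)
      fix z :: "real^'n"
      have "(\<lambda>n. x + (- \<tau> n) *\<^sub>R z) \<longlonglongrightarrow> x + (- 0) *\<^sub>R z" by (intro tendsto_intros \<tau>)
      then show "(\<lambda>n. f (x + (- \<tau> n) *\<^sub>R z)) \<longlonglongrightarrow> f x"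
        using f by (intro isCont_tendsto_compose[where g=f]) (simp_all add: continuous_on_eq_continuous_at)
    qed
  qed (use M integrable_gauss[where 'n='n] less_imp_le[OF gauss_pos[where 'n='n]]
       in \<open>auto simp: norm_mult abs_of_nonneg intro!: mult_right_mono\<close>)
  moreover have "(LINT z|lborel. f x * of_real (gauss (z :: real^'n))) = f x"
    by (simp add: integral_gauss)
  ultimately show "(\<lambda>n. LINT y|lborel. f y * of_real (gauss_kernel (\<tau> n) (x - y))) \<longlonglongrightarrow> f x"
    by (simp only: eq)
  fix n
  have "norm (LINT z|lborel. f (x + (- \<tau> n) *\<^sub>R z) * of_real (gauss z)) \<le> (LINT z|lborel. M * gauss (z :: real^'n))"
  proof (rule Bochner_Integration.integral_norm_bound_integral)
    show "integrable lborel (\<lambda>z. f (x + (- \<tau> n) *\<^sub>R z) * of_real (gauss z))"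
      using integrable_gauss[where 'n='n] by (intro integrable_bounded_mult[of _ _ _ M]) (use M in simp_all)
  qed (use M integrable_gauss[where 'n='n] less_imp_le[OF gauss_pos[where 'n='n]] in \<open>auto simp: norm_mult abs_of_nonneg intro!: mult_right_mono\<close>)
  then show "norm (LINT y|lborel. f y * of_real (gauss_kernel (\<tau> n) (x - y))) \<le> M"
    by (simp add: eq integral_gauss)
qed

text \<open>Duality: \<open>\<phi>\<close> is a limit of the functions \<open>fourier (v n)\<close>, where \<open>v n\<close> is the transform of the reflected \<open>\<phi>\<close>,
  damped by a Gaussian. For these the pairing with \<open>u\<close> equals the pairing of \<open>fourier u\<close> with \<open>v n\<close>, which
  the regularised Bessel inequality controls.\<close>

lemma pairing_bound_continuous:
  fixes u \<phi> :: "real^'n \<Rightarrow> complex"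
  assumes u: "integrable lborel u" and U: "integrable lborel (\<lambda>\<xi>. (norm (fourier u \<xi>))\<^sup>2)"
    and \<phi>: "continuous_on UNIV \<phi>" and supp: "\<And>x. norm x > R \<Longrightarrow> \<phi> x = 0"
  shows "norm (LINT x|lborel. u x * \<phi> x)
    \<le> ((LINT \<xi>|lborel. (norm (fourier u \<xi>))\<^sup>2) + (LINT x|lborel. (norm (\<phi> x))\<^sup>2)) / 2"
proof -
  have [measurable]: "u \<in> borel_measurable borel" "fourier u \<in> borel_measurable borel"
    using u fourier_measurable by simp_all
  have [measurable]: "\<phi> \<in> borel_measurable borel" by (rule borel_measurable_continuous_onI[OF \<phi>])
  obtain M where M: "\<And>x. norm (\<phi> x) \<le> M" "M \<ge> 0" using compact_support_bounded[OF \<phi> supp] by metis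
  define \<kappa> where "\<kappa> x = \<phi> (- x)" for x
  have c\<kappa>: "continuous_on UNIV \<kappa>"
    unfolding \<kappa>_def by (intro continuous_on_compose2[OF \<phi>] continuous_intros) auto
  have [measurable]: "\<kappa> \<in> borel_measurable borel" by (rule borel_measurable_continuous_onI[OF c\<kappa>])
  have i\<kappa>: "integrable lborel \<kappa>"
    by (rule compact_support_integrable[OF c\<kappa>, of R]) (simp add: \<kappa>_def supp)
  have sq\<kappa>: "integrable lborel (\<lambda>x. (norm (\<kappa> x))\<^sup>2)"
    by (rule compact_support_integrable[of _ R]) (auto simp: \<kappa>_def supp intro!: continuous_intros c\<kappa>[unfolded \<kappa>_def])
  have sq\<kappa>_eq: "(LINT x|lborel. (norm (\<kappa> x))\<^sup>2) = (LINT x|lborel. (norm (\<phi> x))\<^sup>2)"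
    using \<phi> by (subst (2) integral_lborel_affine[of "-1" _ 0])
      (auto simp: \<kappa>_def intro!: borel_measurable_continuous_onI continuous_intros)
  have [measurable]: "fourier \<kappa> \<in> borel_measurable borel" using fourier_measurable[OF i\<kappa>] .
  define \<tau> where "\<tau> n = inverse (real (Suc n))" for n
  have \<tau>: "\<tau> n > 0" "\<tau> \<longlonglongrightarrow> 0" for n
    using LIMSEQ_inverse_real_of_nat by (simp_all add: \<tau>_def[abs_def])
  \<comment> \<open>a second transform reflects, so starting from the reflection \<open>\<kappa>\<close> of \<open>\<phi>\<close> recovers \<open>\<phi>\<close>\<close>
  define v where "v n \<xi> = fourier \<kappa> \<xi> * of_real (gauss_weight (\<tau> n) \<xi>)" for n \<xi>
  have fv: "fourier (v n) x = (LINT y|lborel. \<phi> y * of_real (gauss_kernel (\<tau> n) (x - y)))" for n x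
  proof -
    have "fourier (v n) x = (LINT \<xi>|lborel. fourier \<kappa> \<xi> * (of_real (gauss_weight (\<tau> n) \<xi>) * cis (2 * pi * ((- x) \<bullet> \<xi>))))"
      unfolding v_def by (subst fourier_lborel) (simp_all add: mult.assoc inner_commute)
    also have "\<dots> = (LINT y|lborel. \<kappa> y * of_real (gauss_kernel (\<tau> n) (- x - y)))"
      by (rule fourier_inversion_gauss[OF i\<kappa> \<tau>(1)])
    also have "\<dots> = (LINT y|lborel. \<phi> y * of_real (gauss_kernel (\<tau> n) (x - y)))"
      using c\<kappa> gauss_kernel_minus[of "\<tau> n" "x - _"]
      by (subst integral_lborel_affine[of "-1" _ 0])
         (auto simp: \<kappa>_def[of "- _"] borel_measurable_continuous_onI)
    finally show ?thesis .
  qed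
  have iv: "integrable lborel (v n)" for n
    unfolding v_def
    by (rule integrable_bounded_mult[OF _ _ norm_fourier_le[OF i\<kappa>]])
       (use integrable_gauss_weight[OF \<tau>(1), where 'n='n] in simp_all)
  have "(\<lambda>n. LINT x|lborel. u x * fourier (v n) x) \<longlonglongrightarrow> (LINT x|lborel. u x * \<phi> x)"
  proof (rule integral_dominated_convergence[where w="\<lambda>x. norm (u x) * M"])
    show "(\<lambda>x. u x * \<phi> x) \<in> borel_measurable lborel"
      by measurable
    show "(\<lambda>x. u x * fourier (v n) x) \<in> borel_measurable lborel" for n
      using fourier_measurable[OF iv] by simp
    show "AE x in lborel. (\<lambda>n. u x * fourier (v n) x) \<longlonglongrightarrow> u x * \<phi> x"
      unfolding fv by (intro AE_I2 tendsto_mult tendsto_const gauss_kernel_approximation(1)[OF \<phi> M(1) \<tau>])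
    show "AE x in lborel. norm (u x * fourier (v n) x) \<le> norm (u x) * M" for n
      unfolding fv norm_mult
      by (intro AE_I2 mult_left_mono gauss_kernel_approximation(2)[OF \<phi> M(1) \<tau>]) simp
  qed (use u in simp)
  moreover have "norm (LINT x|lborel. u x * fourier (v n) x)
      \<le> ((LINT \<xi>|lborel. (norm (fourier u \<xi>))\<^sup>2) + (LINT x|lborel. (norm (\<phi> x))\<^sup>2)) / 2" for n
  proof -
    note bes = bessel_gauss[OF i\<kappa> sq\<kappa> \<tau>(1)[of n]]
    have "norm (LINT x|lborel. u x * fourier (v n) x) = norm (LINT \<xi>|lborel. fourier u \<xi> * v n \<xi>)"
      by (simp add: fourier_multiplication_formula[OF u iv])
    also have "\<dots> \<le> (LINT \<xi>|lborel. (norm (fourier u \<xi>))\<^sup>2 / 2 + (norm (fourier \<kappa> \<xi>))\<^sup>2 * gauss_weight (\<tau> n) \<xi> / 2)"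
    proof (rule Bochner_Integration.integral_norm_bound_integral)
      show "integrable lborel (\<lambda>\<xi>. fourier u \<xi> * v n \<xi>)"
        by (rule integrable_bounded_mult[OF iv _ norm_fourier_le[OF u]]) simp
      show "integrable lborel (\<lambda>\<xi>. (norm (fourier u \<xi>))\<^sup>2 / 2 + (norm (fourier \<kappa> \<xi>))\<^sup>2 * gauss_weight (\<tau> n) \<xi> / 2)"
        using U bes(1) by simp
      fix \<xi> :: "real^'n"
      let ?w = "gauss_weight (\<tau> n) \<xi>"
      have w: "0 < ?w" "?w \<le> 1" by (rule gauss_weight_bounds)+
      have "norm (fourier u \<xi> * v n \<xi>) = (norm (fourier u \<xi>) * norm (fourier \<kappa> \<xi>)) * ?w"
        using w by (simp add: v_def norm_mult)
      also have "\<dots> \<le> ((norm (fourier u \<xi>))\<^sup>2 / 2 + (norm (fourier \<kappa> \<xi>))\<^sup>2 / 2) * ?w"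
        using sum_squares_bound[of "norm (fourier u \<xi>)" "norm (fourier \<kappa> \<xi>)"] w
        by (intro mult_right_mono) auto
      also have "\<dots> \<le> (norm (fourier u \<xi>))\<^sup>2 / 2 + (norm (fourier \<kappa> \<xi>))\<^sup>2 * ?w / 2"
        using w by (simp add: distrib_right mult_left_le)
      finally show "norm (fourier u \<xi> * v n \<xi>) \<le> (norm (fourier u \<xi>))\<^sup>2 / 2 + (norm (fourier \<kappa> \<xi>))\<^sup>2 * ?w / 2" .
    qed
    also have "\<dots> = ((LINT \<xi>|lborel. (norm (fourier u \<xi>))\<^sup>2) + (LINT \<xi>|lborel. (norm (fourier \<kappa> \<xi>))\<^sup>2 * gauss_weight (\<tau> n) \<xi>)) / 2"
      using U bes(1) by simp
    also have "\<dots> \<le> ((LINT \<xi>|lborel. (norm (fourier u \<xi>))\<^sup>2) + (LINT x|lborel. (norm (\<phi> x))\<^sup>2)) / 2"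
      using bes(2) sq\<kappa>_eq by simp
    finally show ?thesis .
  qed
  ultimately show ?thesis
    by (intro LIMSEQ_le_const2[OF tendsto_norm]) auto
qed

text \<open>Any measurable function is an almost everywhere limit of continuous ones; radial clipping of the
  values and a cut-off of the support restore the bounds.\<close>

lemma bounded_approximation:
  fixes f :: "real^'n \<Rightarrow> complex"
  assumes [measurable]: "f \<in> borel_measurable borel" and M: "M > 0" "\<And>x. norm (f x) \<le> M"
    and R: "\<And>x. norm x > R \<Longrightarrow> f x = 0"
  obtains g where "\<And>n. continuous_on UNIV (g n)" "\<And>n x. norm (g n x) \<le> M"
    "\<And>n x. norm x > R + 1 \<Longrightarrow> g n x = 0" "AE x in lborel. (\<lambda>n. g n x) \<longlonglongrightarrow> f x"
proof -
  have "f \<in> borel_measurable (lebesgue_on UNIV)"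
    using measurable_completion[of f lborel borel] by (simp add: lebesgue_on_UNIV_eq)
  then have "f measurable_on UNIV" by (simp add: measurable_on_iff_borel_measurable)
  then obtain N g where N: "negligible N" and g: "\<And>n. continuous_on UNIV (g n :: real^'n \<Rightarrow> complex)"
    and lim: "\<And>x. x \<notin> N \<Longrightarrow> (\<lambda>n. g n x) \<longlonglongrightarrow> f x"
    unfolding measurable_on_def by auto
  define c where "c z = (1 / max 1 (norm z / M)) *\<^sub>R z" for z :: complex
  define k where "k x = max 0 (min 1 (R + 1 - norm x))" for x :: "real^'n"
  have cc: "continuous_on UNIV c"
    unfolding c_def using M by (intro continuous_intros) auto
  have cM: "norm (c z) \<le> M" for z
  proof -
    have "norm (c z) = norm z / max 1 (norm z / M)" by (simp add: c_def)
    also have "\<dots> \<le> M" using M by (auto simp: max_def divide_le_eq field_simps)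
    finally show ?thesis .
  qed
  have cf: "c z = z" if "norm z \<le> M" for z
    using that M by (simp add: c_def max_def field_simps)
  show thesis
  proof
    show "continuous_on UNIV (\<lambda>x. k x *\<^sub>R c (g n x))" for n
      unfolding k_def by (intro continuous_intros continuous_on_compose2[OF cc g]) auto
    show "norm (k x *\<^sub>R c (g n x)) \<le> M" for n x
    proof -
      have "0 \<le> k x" "k x \<le> 1" by (auto simp: k_def)
      then have "k x * norm (c (g n x)) \<le> 1 * M" using cM M by (intro mult_mono) auto
      then show ?thesis using \<open>0 \<le> k x\<close> by simp
    qed
    show "k x *\<^sub>R c (g n x) = 0" if "norm x > R + 1" for n x
      using that by (simp add: k_def)
    have "AE x in lebesgue. x \<notin> N" using N by (simp add: AE_not_in negligible_iff_null_sets)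
    then have "AE x in lebesgue. (\<lambda>n. k x *\<^sub>R c (g n x)) \<longlonglongrightarrow> f x"
    proof eventually_elim
      case (elim x)
      have "(\<lambda>n. k x *\<^sub>R c (g n x)) \<longlonglongrightarrow> k x *\<^sub>R c (f x)"
        using cc lim[OF elim]
        by (intro tendsto_scaleR tendsto_const isCont_tendsto_compose[where g=c])
           (simp_all add: continuous_on_eq_continuous_at)
      moreover have "k x *\<^sub>R c (f x) = f x"
        using R[of x] cf[OF M(2)] by (cases "norm x > R") (auto simp: k_def c_def)
      ultimately show ?case by simp
    qed
    then show "AE x in lborel. (\<lambda>n. k x *\<^sub>R c (g n x)) \<longlonglongrightarrow> f x"
      by (simp add: AE_completion_iff)
  qed
qed

lemma pairing_bound:
  fixes u f :: "real^'n \<Rightarrow> complex"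
  assumes u: "integrable lborel u" and U: "integrable lborel (\<lambda>\<xi>. (norm (fourier u \<xi>))\<^sup>2)"
    and f [measurable]: "f \<in> borel_measurable borel" and M: "M > 0" "\<And>x. norm (f x) \<le> M"
    and R: "\<And>x. norm x > R \<Longrightarrow> f x = 0"
  shows "norm (LINT x|lborel. u x * f x)
    \<le> ((LINT \<xi>|lborel. (norm (fourier u \<xi>))\<^sup>2) + (LINT x|lborel. (norm (f x))\<^sup>2)) / 2"
proof -
  have [measurable]: "u \<in> borel_measurable borel" using u by simp
  obtain g where g: "\<And>n. continuous_on UNIV (g n)" "\<And>n x. norm (g n x) \<le> M"
    "\<And>n x. norm x > R + 1 \<Longrightarrow> g n x = 0" and lim: "AE x in lborel. (\<lambda>n. g n x) \<longlonglongrightarrow> f x"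
    using bounded_approximation[OF f M R] by blast
  have [measurable]: "g n \<in> borel_measurable borel" for n by (rule borel_measurable_continuous_onI[OF g(1)])
  have 1: "(\<lambda>n. LINT x|lborel. u x * g n x) \<longlonglongrightarrow> (LINT x|lborel. u x * f x)"
  proof (rule integral_dominated_convergence[where w="\<lambda>x. norm (u x) * M"])
    show "AE x in lborel. (\<lambda>n. u x * g n x) \<longlonglongrightarrow> u x * f x"
      using lim by eventually_elim (intro tendsto_mult tendsto_const)
    show "AE x in lborel. norm (u x * g n x) \<le> norm (u x) * M" for n
      using g(2) by (intro AE_I2) (simp add: norm_mult mult_left_mono)
  qed (use u in simp_all)
  have 2: "(\<lambda>n. LINT x|lborel. (norm (g n x))\<^sup>2) \<longlonglongrightarrow> (LINT x|lborel. (norm (f x))\<^sup>2)"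
  proof (rule integral_dominated_convergence[where w="\<lambda>x. M\<^sup>2 * indicator (cball 0 (R + 1)) x"])
    show "AE x in lborel. (\<lambda>n. (norm (g n x))\<^sup>2) \<longlonglongrightarrow> (norm (f x))\<^sup>2"
      using lim by eventually_elim (intro tendsto_power tendsto_norm)
    show "AE x in lborel. norm ((norm (g n x))\<^sup>2) \<le> M\<^sup>2 * indicator (cball 0 (R + 1)) x" for n
    proof (intro AE_I2)
      fix x
      show "norm ((norm (g n x))\<^sup>2) \<le> M\<^sup>2 * indicator (cball 0 (R + 1)) x"
        using g(2)[of n x] g(3)[of x n]
        by (cases "norm x > R + 1") (auto simp: indicator_def intro!: power_mono)
    qed
    show "integrable lborel (\<lambda>x. M\<^sup>2 * indicator (cball 0 (R + 1)) (x :: real^'n))"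
      by (intro integrable_mult_right integrable_real_indicator) (use emeasure_bounded_finite[OF bounded_cball] in \<open>auto simp: less_top\<close>)
  qed measurable
  show ?thesis
  proof (rule LIMSEQ_le)
    show "(\<lambda>n. norm (LINT x|lborel. u x * g n x)) \<longlonglongrightarrow> norm (LINT x|lborel. u x * f x)"
      by (rule tendsto_norm[OF 1])
    show "(\<lambda>n. ((LINT \<xi>|lborel. (norm (fourier u \<xi>))\<^sup>2) + (LINT x|lborel. (norm (g n x))\<^sup>2)) / 2)
        \<longlonglongrightarrow> ((LINT \<xi>|lborel. (norm (fourier u \<xi>))\<^sup>2) + (LINT x|lborel. (norm (f x))\<^sup>2)) / 2"
      by (intro tendsto_intros 2) simp
    show "\<exists>N. \<forall>n\<ge>N. norm (LINT x|lborel. u x * g n x)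
        \<le> ((LINT \<xi>|lborel. (norm (fourier u \<xi>))\<^sup>2) + (LINT x|lborel. (norm (g n x))\<^sup>2)) / 2"
      using pairing_bound_continuous[OF u U g(1) g(3)] by blast
  qed
qed

text \<open>Only this inequality between the two sides of Plancherel's identity is used. The pairing bound is
  applied to truncations of the complex conjugate of \<open>u\<close>: if \<open>N\<close> is the squared norm of a truncation and \<open>S\<close>
  that of the transform, it reads \<open>N \<le> (S + N) / 2\<close>.\<close>

lemma plancherel_le:
  fixes u :: "real^'n \<Rightarrow> complex"
  assumes u: "integrable lborel u"
  shows "(\<integral>\<^sup>+x. ennreal ((norm (u x))\<^sup>2) \<partial>lborel) \<le> (\<integral>\<^sup>+\<xi>. ennreal ((norm (fourier u \<xi>))\<^sup>2) \<partial>lborel)"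
proof (cases "(\<integral>\<^sup>+\<xi>. ennreal ((norm (fourier u \<xi>))\<^sup>2) \<partial>lborel) = \<infinity>")
  case False
  have [measurable]: "u \<in> borel_measurable borel" "fourier u \<in> borel_measurable borel"
    using u fourier_measurable by simp_all
  have U: "integrable lborel (\<lambda>\<xi>. (norm (fourier u \<xi>))\<^sup>2)"
    using False by (intro integrableI_nonneg) (auto simp: less_top)
  define S where "S = (LINT \<xi>|lborel. (norm (fourier u \<xi>))\<^sup>2)"
  define T where "T n = {x. norm x \<le> real n \<and> norm (u x) \<le> real n}" for n
  have [measurable]: "T n \<in> sets borel" for n unfolding T_def by measurable
  have le: "(\<integral>\<^sup>+x. ennreal ((norm (u x))\<^sup>2) * indicator (T n) x \<partial>lborel) \<le> ennreal S" for n
  proof -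
    let ?f = "\<lambda>x. cnj (u x) * indicator (T n) x"
    have b: "norm (?f x) \<le> real n + 1" for x
      by (auto simp: T_def indicator_def)
    have s: "?f x = 0" if "norm x > real n" for x using that by (auto simp: T_def indicator_def)
    have i: "integrable lborel (\<lambda>x. (norm (u x))\<^sup>2 * indicator (T n) x)"
    proof (rule Bochner_Integration.integrable_bound)
      show "integrable lborel (\<lambda>x. (real n)\<^sup>2 * indicator (cball 0 (real n)) (x :: real^'n))"
        by (intro integrable_mult_right integrable_real_indicator) (use emeasure_bounded_finite[OF bounded_cball] in \<open>auto simp: less_top\<close>)
      show "AE x in lborel. norm ((norm (u x))\<^sup>2 * indicator (T n) x) \<le> norm ((real n)\<^sup>2 * indicator (cball 0 (real n)) x)"
        by (intro AE_I2) (auto simp: T_def indicator_def intro!: power_mono)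
    qed measurable
    have "norm (LINT x|lborel. u x * ?f x) \<le> (S + (LINT x|lborel. (norm (?f x))\<^sup>2)) / 2"
      unfolding S_def by (rule pairing_bound[OF u U _ _ b s]) auto
    moreover have "(LINT x|lborel. u x * ?f x) = complex_of_real (LINT x|lborel. (norm (u x))\<^sup>2 * indicator (T n) x)"
      unfolding integral_complex_of_real[symmetric]
      by (intro Bochner_Integration.integral_cong refl)
         (simp add: complex_norm_square mult.assoc of_real_indicator del: of_real_power)
    moreover have "(LINT x|lborel. (norm (?f x))\<^sup>2) = (LINT x|lborel. (norm (u x))\<^sup>2 * indicator (T n) x)"
      by (intro Bochner_Integration.integral_cong refl) (simp add: norm_mult power_mult_distrib indicator_def)
    ultimately have "(LINT x|lborel. (norm (u x))\<^sup>2 * indicator (T n) x) \<le> S" by simp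
    moreover have "(\<integral>\<^sup>+x. ennreal ((norm (u x))\<^sup>2) * indicator (T n) x \<partial>lborel)
        = ennreal (LINT x|lborel. (norm (u x))\<^sup>2 * indicator (T n) x)"
      by (subst nn_integral_eq_integral[OF i, symmetric])
         (auto intro!: nn_integral_cong simp: ennreal_mult' split: split_indicator)
    ultimately show ?thesis by (simp add: ennreal_leI)
  qed
  have "(\<integral>\<^sup>+x. ennreal ((norm (u x))\<^sup>2) \<partial>lborel)
      = (\<integral>\<^sup>+x. (SUP n. ennreal ((norm (u x))\<^sup>2) * indicator (T n) x) \<partial>lborel)"
  proof (intro nn_integral_cong antisym)
    fix x
    obtain n where "max (norm x) (norm (u x)) \<le> real n" using real_arch_simple by blast
    then have "x \<in> T n" by (simp add: T_def)
    then show "ennreal ((norm (u x))\<^sup>2) \<le> (SUP n. ennreal ((norm (u x))\<^sup>2) * indicator (T n) x)"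
      by (intro SUP_upper2[of n]) auto
    show "(SUP n. ennreal ((norm (u x))\<^sup>2) * indicator (T n) x) \<le> ennreal ((norm (u x))\<^sup>2)"
      by (intro SUP_least) (auto split: split_indicator)
  qed
  also have "\<dots> = (SUP n. \<integral>\<^sup>+x. ennreal ((norm (u x))\<^sup>2) * indicator (T n) x \<partial>lborel)"
  proof (rule nn_integral_monotone_convergence_SUP)
    show "incseq (\<lambda>n x. ennreal ((norm (u x))\<^sup>2) * indicator (T n) x)"
      by (auto simp: incseq_def le_fun_def T_def split: split_indicator intro: order_trans)
  qed measurable
  also have "\<dots> \<le> ennreal S" by (intro SUP_least le)
  also have "ennreal S = (\<integral>\<^sup>+\<xi>. ennreal ((norm (fourier u \<xi>))\<^sup>2) \<partial>lborel)"
    unfolding S_def by (rule nn_integral_eq_integral[OF U, symmetric]) simp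
  finally show ?thesis .
qed simp

section \<open>Fourier transforms of test functions\<close>

lemma continuous_AE_zero:
  fixes h :: "'a::euclidean_space \<Rightarrow> 'b::real_normed_vector"
  assumes h: "continuous_on UNIV h" and ae: "AE x in lborel. h x = 0"
  shows "h x = 0"
proof -
  have op: "open {x. h x \<noteq> 0}" by (intro open_Collect_neq h continuous_on_const)
  have "AE x in lebesgue. x \<notin> {x. h x \<noteq> 0}" using ae by (simp add: AE_completion)
  then have "{x. h x \<noteq> 0} \<in> null_sets lebesgue"
    using op by (subst (asm) AE_iff_null_sets[symmetric]) auto
  then have "negligible {x. h x \<noteq> 0}" by (simp add: negligible_iff_null_sets)
  then show ?thesis using open_not_negligible[OF op] by blast
qed

lemma line_has_vector_derivative:
  fixes f :: "real^'n \<Rightarrow> complex"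
  assumes "f differentiable (at (x + s *\<^sub>R v))"
  shows "((\<lambda>s. f (x + s *\<^sub>R v)) has_vector_derivative (\<Sum>i\<in>UNIV. v $ i *\<^sub>R partial_deriv i f (x + s *\<^sub>R v))) (at s)"
proof -
  have "((\<lambda>s. x + s *\<^sub>R v) has_derivative (\<lambda>s. s *\<^sub>R v)) (at s)"
    by (auto intro!: derivative_eq_intros)
  from has_derivative_compose[OF this derivative_eq_sum_partial[OF assms]]
  show ?thesis
    by (simp add: has_vector_derivative_def scaleR_sum_right)
qed

lemma vector_derivative_bound:
  fixes g :: "real \<Rightarrow> 'a::real_normed_vector"
  assumes "\<And>s. 0 \<le> s \<Longrightarrow> s \<le> t \<Longrightarrow> (g has_vector_derivative g' s) (at s)"
    and "\<And>s. 0 \<le> s \<Longrightarrow> s \<le> t \<Longrightarrow> norm (g' s) \<le> B" and "t \<ge> 0"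
  shows "norm (g t - g 0) \<le> B * t"
proof (cases "t = 0")
  case False
  have "norm (g t - g 0) \<le> (\<lambda>s. B * s) t - (\<lambda>s. B * s) 0"
  proof (rule differentiable_bound_general)
    show "continuous_on {0..t} g"
      using assms(1) by (intro continuous_at_imp_continuous_on ballI has_vector_derivative_continuous) auto
    show "((\<lambda>s. B * s) has_vector_derivative B) (at s)" for s
      using has_vector_derivative_mult_right[OF has_vector_derivative_id, of B] by simp
    show "(g has_vector_derivative g' s) (at s)" if "0 < s" "s < t" for s
      using assms(1)[of s] that by simp
    show "norm (g' s) \<le> B" if "0 < s" "s < t" for s
      using assms(2)[of s] that by simp
  qed (use assms False in \<open>auto intro!: continuous_intros\<close>)
  then show ?thesis by simp
qed simp

lemma vector_derivative_quotient:
  assumes "(g has_vector_derivative d) (at 0)"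
  shows "((\<lambda>h. (g h - g 0) /\<^sub>R h) \<longlongrightarrow> d) (at 0)"
proof (rule LIM_zero_cancel, rule tendsto_norm_zero_cancel)
  have "((\<lambda>h. norm (g (0 + h) - g 0 - h *\<^sub>R d) / norm h) \<longlongrightarrow> 0) (at 0)"
    using assms unfolding has_vector_derivative_def has_derivative_at by blast
  moreover have "eventually (\<lambda>h. norm (g (0 + h) - g 0 - h *\<^sub>R d) / norm h
      = norm ((g h - g 0) /\<^sub>R h - d)) (at 0)"
    unfolding eventually_at_filter
  proof (intro always_eventually allI impI)
    fix h :: real assume "h \<noteq> 0"
    then have "(g h - g 0) /\<^sub>R h - d = (1 / h) *\<^sub>R (g (0 + h) - g 0 - h *\<^sub>R d)"
      by (simp add: algebra_simps divide_inverse)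
    then show "norm (g (0 + h) - g 0 - h *\<^sub>R d) / norm h = norm ((g h - g 0) /\<^sub>R h - d)"
      by simp
  qed
  ultimately show "((\<lambda>h. norm ((g h - g 0) /\<^sub>R h - d)) \<longlongrightarrow> 0) (at 0)"
    by (rule Lim_transform_eventually)
qed

lemma fourier_translate:
  fixes f :: "real^'n \<Rightarrow> complex"
  assumes "integrable lborel f"
  shows "fourier (\<lambda>x. f (x + a)) \<xi> = cis (2 * pi * (a \<bullet> \<xi>)) * fourier f \<xi>"
proof -
  have [measurable]: "f \<in> borel_measurable borel" using assms by simp
  have "fourier f \<xi> = (LINT x|lborel. f (a + 1 *\<^sub>R x) * cis (- 2 * pi * ((a + 1 *\<^sub>R x) \<bullet> \<xi>)))"
    by (subst fourier_lborel, measurable, subst integral_lborel_affine[of 1 _ a]) simp_all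
  also have "\<dots> = (LINT x|lborel. cis (- 2 * pi * (a \<bullet> \<xi>)) * (f (x + a) * cis (- 2 * pi * (x \<bullet> \<xi>))))"
    by (intro Bochner_Integration.integral_cong refl)
       (simp add: inner_add_left cis_mult algebra_simps)
  also have "\<dots> = cis (- 2 * pi * (a \<bullet> \<xi>)) * fourier (\<lambda>x. f (x + a)) \<xi>"
    by (subst fourier_lborel) simp_all
  finally show ?thesis by (simp add: mult.assoc[symmetric] cis_mult)
qed

text \<open>The transform of a translate is the transform times a phase; dominated
  convergence of the difference quotients, supported in a fixed
  ball, gives the derivative.\<close>

lemma fourier_partial_deriv:
  fixes f :: "real^'n \<Rightarrow> complex"
  assumes f: "test_function f"
  shows "fourier (partial_deriv j f) \<xi> = 2 * pi * \<i> * of_real (\<xi> $ j) * fourier f \<xi>"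
proof -
  let ?e = "axis j 1 :: real^'n"
  have dt: "test_function (partial_deriv j f)" by (rule test_function_partial_deriv[OF f])
  obtain B where B: "\<And>x. norm (partial_deriv j f x) \<le> B" "B \<ge> 0" using test_function_bounded[OF dt] by blast
  obtain R where R: "\<And>x. norm x > R \<Longrightarrow> f x = 0" using f unfolding test_function_iff by blast
  have intf: "integrable lborel f" by (rule test_function_integrable[OF f])
  have [measurable]: "f \<in> borel_measurable borel" "partial_deriv j f \<in> borel_measurable borel"
    using intf test_function_integrable[OF dt] by simp_all
  have diff: "f differentiable (at x)" for x
    using f smooth_differentiable unfolding test_function_def by blast
  have der: "((\<lambda>s. f (x + s *\<^sub>R ?e)) has_vector_derivative partial_deriv j f (x + s *\<^sub>R ?e)) (at s)" for x s
    using line_has_vector_derivative[OF diff, where x=x and s=s and v="?e"]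
    by (simp add: axis_def if_distrib[of "\<lambda>c. c *\<^sub>R _"] cong: if_cong)
  define s where "s n = inverse (real (Suc n))" for n
  have s: "s n > 0" "s n \<le> 1" "s \<longlonglongrightarrow> 0" for n
    using LIMSEQ_inverse_real_of_nat by (simp_all add: s_def[abs_def] inverse_le_1_iff)
  have s0: "filterlim s (at 0) sequentially"
    using s by (simp add: filterlim_at less_imp_neq[THEN not_sym])
  define q where "q n x = (f (x + s n *\<^sub>R ?e) - f x) /\<^sub>R s n" for n x
  have [measurable]: "q n \<in> borel_measurable borel" for n unfolding q_def by measurable
  have lim: "(\<lambda>n. q n x) \<longlonglongrightarrow> partial_deriv j f x" for x
  proof -
    have "((\<lambda>h. (f (x + h *\<^sub>R ?e) - f x) /\<^sub>R h) \<longlongrightarrow> partial_deriv j f x) (at 0)"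
      using vector_derivative_quotient[OF der[where x=x and s=0]] by simp
    then show ?thesis unfolding q_def using s0 by (rule filterlim_compose)
  qed
  have bound: "norm (q n x) \<le> B * indicator (cball 0 (R + 1)) x" for n x
  proof (cases "norm x > R + 1")
    case True
    then have "norm (x + s n *\<^sub>R ?e) > R"
      using norm_triangle_ineq4[of "x + s n *\<^sub>R ?e" "s n *\<^sub>R ?e"] s(1,2)[of n] by simp
    then show ?thesis using True R by (simp add: q_def indicator_def)
  next
    case False
    have "norm ((\<lambda>s. f (x + s *\<^sub>R ?e)) (s n) - (\<lambda>s. f (x + s *\<^sub>R ?e)) 0) \<le> B * s n"
      by (rule vector_derivative_bound[OF der B(1)]) (use s(1,2)[of n] in auto)
    then have "norm (q n x) \<le> B"
      using s(1)[of n] unfolding q_def norm_scaleR by (simp add: divide_le_eq flip: divide_inverse_commute)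
    then show ?thesis using False by (simp add: indicator_def)
  qed
  have "(\<lambda>n. fourier (q n) \<xi>) \<longlonglongrightarrow> fourier (partial_deriv j f) \<xi>"
    unfolding fourier_lborel[OF \<open>q _ \<in> _\<close>] fourier_lborel[OF \<open>partial_deriv j f \<in> _\<close>]
  proof (rule integral_dominated_convergence[where w="\<lambda>x. B * indicator (cball 0 (R + 1)) x"])
    show "integrable lborel (\<lambda>x. B * indicator (cball 0 (R + 1)) (x :: real^'n))"
      by (intro integrable_mult_right integrable_real_indicator)
         (use emeasure_bounded_finite[OF bounded_cball] in \<open>auto simp: less_top\<close>)
    show "AE x in lborel. (\<lambda>n. q n x * cis (- 2 * pi * (x \<bullet> \<xi>))) \<longlonglongrightarrow> partial_deriv j f x * cis (- 2 * pi * (x \<bullet> \<xi>))"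
      by (intro AE_I2 tendsto_mult lim tendsto_const)
  qed (use bound in \<open>auto simp: norm_mult\<close>)
  moreover have "fourier (q n) \<xi> = ((cis (2 * pi * (s n * \<xi> $ j)) - 1) /\<^sub>R s n) * fourier f \<xi>" for n
  proof -
    have i: "integrable lborel (\<lambda>x. f (x + a))" for a
      using integrable_lborel_affine[OF _ intf, of 1 a] by (simp add: add.commute)
    have "fourier (q n) \<xi> = (LINT x|lborel. (1 / s n) *\<^sub>R (f (x + s n *\<^sub>R ?e) * cis (- 2 * pi * (x \<bullet> \<xi>))
        - f x * cis (- 2 * pi * (x \<bullet> \<xi>))))"
      by (subst fourier_lborel) (simp_all add: q_def divide_inverse algebra_simps)
    also have "\<dots> = (1 / s n) *\<^sub>R (fourier (\<lambda>x. f (x + s n *\<^sub>R ?e)) \<xi> - fourier f \<xi>)"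
      by (subst integral_scaleR_right, subst Bochner_Integration.integral_diff[OF
            integrable_fourier_integrand[OF i] integrable_fourier_integrand[OF intf]])
         (simp add: fourier_lborel)
    also have "\<dots> = ((cis (2 * pi * (s n * \<xi> $ j)) - 1) /\<^sub>R s n) * fourier f \<xi>"
      by (simp add: fourier_translate[OF intf] inner_axis inner_commute[of _ \<xi>] algebra_simps divide_inverse)
    finally show ?thesis .
  qed
  moreover have "(\<lambda>n. ((cis (2 * pi * (s n * \<xi> $ j)) - 1) /\<^sub>R s n) * fourier f \<xi>)
      \<longlonglongrightarrow> (2 * pi * \<i> * of_real (\<xi> $ j)) * fourier f \<xi>"
  proof (intro tendsto_mult tendsto_const)
    have "((\<lambda>t. exp (\<i> * of_real (2 * pi * \<xi> $ j) * of_real t)) has_vector_derivative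
        (\<i> * of_real (2 * pi * \<xi> $ j))) (at 0)"
    proof -
      have "((\<lambda>z. exp (\<i> * of_real (2 * pi * \<xi> $ j) * z)) has_field_derivative
          (\<i> * of_real (2 * pi * \<xi> $ j))) (at (of_real 0))"
        by (auto intro!: derivative_eq_intros)
      from has_vector_derivative_real_field[OF this] show ?thesis .
    qed
    then have "((\<lambda>t. cis (2 * pi * (t * \<xi> $ j))) has_vector_derivative (2 * pi * \<i> * of_real (\<xi> $ j))) (at 0)"
      by (simp add: cis_conv_exp mult_ac)
    from vector_derivative_quotient[OF this]
    have "((\<lambda>h. (cis (2 * pi * (h * \<xi> $ j)) - 1) /\<^sub>R h) \<longlongrightarrow> 2 * pi * \<i> * of_real (\<xi> $ j)) (at 0)"
      by simp
    then show "(\<lambda>n. (cis (2 * pi * (s n * \<xi> $ j)) - 1) /\<^sub>R s n) \<longlonglongrightarrow> 2 * pi * \<i> * of_real (\<xi> $ j)"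
      using s0 by (rule filterlim_compose)
  qed
  ultimately show ?thesis using LIMSEQ_unique by simp
qed

lemma fourier_add:
  fixes f g :: "real^'n \<Rightarrow> complex"
  assumes f: "integrable lborel f" and g: "integrable lborel g"
  shows "fourier (\<lambda>x. f x + g x) \<xi> = fourier f \<xi> + fourier g \<xi>"
proof -
  have [measurable]: "f \<in> borel_measurable borel" "g \<in> borel_measurable borel" using f g by simp_all
  show ?thesis
    using Bochner_Integration.integral_add[OF integrable_fourier_integrand[OF f, of \<xi>] integrable_fourier_integrand[OF g, of \<xi>]]
    by (simp add: fourier_lborel distrib_right)
qed

lemma fourier_cmult:
  fixes f :: "real^'n \<Rightarrow> complex"
  assumes f: "integrable lborel f"
  shows "fourier (\<lambda>x. c * f x) \<xi> = c * fourier f \<xi>"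
proof -
  have [measurable]: "f \<in> borel_measurable borel" using f by simp
  show ?thesis by (simp add: fourier_lborel mult.assoc)
qed

lemma fourier_iter_partial_deriv:
  fixes f :: "real^'n \<Rightarrow> complex"
  assumes f: "test_function f"
  shows "fourier (iter_partial_deriv js f) \<xi>
    = (\<Prod>i\<in>UNIV. (2 * pi * \<i> * of_real (\<xi> $ i)) ^ count_list js i) * fourier f \<xi>"
proof (induction js)
  case (Cons j js)
  let ?m = "\<lambda>i. 2 * pi * \<i> * of_real (\<xi> $ i) :: complex"
  have "(\<Prod>i\<in>UNIV. ?m i ^ count_list (j # js) i)
      = (\<Prod>i\<in>UNIV. (if i = j then ?m i else 1) * ?m i ^ count_list js i)"
    by (intro prod.cong refl) auto
  also have "\<dots> = ?m j * (\<Prod>i\<in>UNIV. ?m i ^ count_list js i)"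
    by (simp add: prod.distrib)
  finally show ?case
    using fourier_partial_deriv[OF test_function_iter[OF f], of j js \<xi>] Cons by simp
qed simp

text \<open>The Plancherel inequality for the difference, which is continuous.\<close>

lemma fourier_injective_test_function:
  fixes f g :: "real^'n \<Rightarrow> complex"
  assumes f: "test_function f" and g: "test_function g" and eq: "fourier f = fourier g"
  shows "f = g"
proof
  fix x
  let ?h = "\<lambda>x. f x + (-1) * g x"
  have h: "test_function ?h" by (rule test_function_add[OF f test_function_cmult[OF g]])
  have [measurable]: "f \<in> borel_measurable borel" "g \<in> borel_measurable borel"
    by (rule borel_measurable_continuous_onI[OF test_function_continuous[OF f]],
        rule borel_measurable_continuous_onI[OF test_function_continuous[OF g]])
  have "fourier ?h \<xi> = fourier f \<xi> + (-1) * fourier g \<xi>" for \<xi>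
    using fourier_add[OF test_function_integrable[OF f] test_function_integrable[OF test_function_cmult[OF g, of "-1"]]]
      fourier_cmult[OF test_function_integrable[OF g], of "-1"] by simp
  then have "fourier ?h \<xi> = 0" for \<xi> using eq by simp
  then have "(\<integral>\<^sup>+x. ennreal ((norm (?h x))\<^sup>2) \<partial>lborel) = 0"
    using plancherel_le[OF test_function_integrable[OF h]] by simp
  then have "AE x in lborel. ?h x = 0"
    by (subst (asm) nn_integral_0_iff_AE) auto
  from continuous_AE_zero[OF test_function_continuous[OF h] this]
  show "f x = g x" by simp
qed

text \<open>Partial derivatives commute: on the Fourier side they become multiplications.
  Thus the order of differentiation in \<open>multi_deriv\<close> does not matter for test functions.\<close>

lemma iter_partial_deriv_cong_count:
  fixes f :: "real^'n \<Rightarrow> complex"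
  assumes f: "test_function f" and c: "\<And>i. count_list js i = count_list ks i"
  shows "iter_partial_deriv js f = iter_partial_deriv ks f"
  by (rule fourier_injective_test_function)
     (simp_all add: test_function_iter f fun_eq_iff fourier_iter_partial_deriv c)

lemma multi_deriv_count_list:
  fixes f :: "real^'n \<Rightarrow> complex"
  assumes f: "test_function f"
  shows "multi_deriv (count_list js) f = iter_partial_deriv js f"
  unfolding multi_deriv_def
  by (rule iter_partial_deriv_cong_count[OF f]) (rule someI2[of _ js], auto)

lemma multi_order_count_list: "multi_order (count_list js) = length js"
  unfolding multi_order_def
proof (induction js)
  case (Cons j js)
  have "(\<Sum>i\<in>UNIV. count_list (j # js) i) = (\<Sum>i\<in>UNIV. (if i = j then 1 else 0) + count_list js i)"
    by (intro sum.cong refl) auto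
  then show ?case using Cons by (simp add: sum.distrib)
qed simp

text \<open>Multiplying the transform by a coordinate is, up to a constant, a partial derivative of the function.\<close>

lemma polynomial_multiplier:
  fixes q :: "real^'n \<Rightarrow> real" and f :: "real^'n \<Rightarrow> complex"
  assumes "real_polynomial_function q" "test_function f"
  shows "\<exists>g. test_function g \<and> (\<forall>\<xi>. fourier g \<xi> = of_real (q \<xi>) * fourier f \<xi>)"
  using assms
proof (induction arbitrary: f)
  case (const c)
  then show ?case
    using test_function_cmult fourier_cmult[OF test_function_integrable] by blast
next
  case (add p q)
  obtain g h where g: "test_function g" "\<And>\<xi>. fourier g \<xi> = of_real (p \<xi>) * fourier f \<xi>"
    and h: "test_function h" "\<And>\<xi>. fourier h \<xi> = of_real (q \<xi>) * fourier f \<xi>" using add by meson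
  then show ?case
    using test_function_add[OF g(1) h(1)]
      fourier_add[OF test_function_integrable[OF g(1)] test_function_integrable[OF h(1)]]
    by (intro exI[of _ "\<lambda>x. g x + h x"]) (simp add: distrib_right)
next
  case (mult p q)
  obtain g where g: "test_function g" "\<And>\<xi>. fourier g \<xi> = of_real (q \<xi>) * fourier f \<xi>" using mult by meson
  obtain h where "test_function h" "\<And>\<xi>. fourier h \<xi> = of_real (p \<xi>) * fourier g \<xi>" using mult g by meson
  then show ?case using g by (intro exI[of _ h]) simp
next
  case (linear q)
  interpret q: bounded_linear q by fact
  have "\<exists>g. test_function g \<and> (\<forall>\<xi>. fourier g \<xi> = of_real (\<Sum>i\<in>S. \<xi> $ i * q (axis i 1)) * fourier f \<xi>)" for S
  proof (induction S rule: infinite_finite_induct)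
    case empty
    show ?case
      using linear test_function_cmult[of f 0] fourier_cmult[OF test_function_integrable, of f 0]
      by (intro exI[of _ "\<lambda>x. 0 * f x"]) simp
  next
    case (insert i S)
    then obtain g where g: "test_function g"
      "\<And>\<xi>. fourier g \<xi> = of_real (\<Sum>i\<in>S. \<xi> $ i * q (axis i 1)) * fourier f \<xi>" by meson
    define c where "c = of_real (q (axis i 1)) / (2 * pi * \<i>)"
    have c0: "c * (2 * pi * \<i>) = of_real (q (axis i 1))" by (simp add: c_def)
    have c: "c * (2 * pi * \<i> * z) = of_real (q (axis i 1)) * z" for z
      unfolding c0[symmetric] by (simp only: mult.assoc)
    have d: "test_function (partial_deriv i f)" by (rule test_function_partial_deriv[OF linear(2)])
    have "fourier (\<lambda>x. c * partial_deriv i f x + g x) \<xi>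
        = c * (2 * pi * \<i> * (of_real (\<xi> $ i) * fourier f \<xi>)) + fourier g \<xi>" for \<xi>
      by (simp add: fourier_add[OF test_function_integrable[OF test_function_cmult[OF d]] test_function_integrable[OF g(1)]]
          fourier_cmult[OF test_function_integrable[OF d]] fourier_partial_deriv[OF linear(2)] mult.assoc)
    then have "fourier (\<lambda>x. c * partial_deriv i f x + g x) \<xi>
        = of_real (\<Sum>i\<in>insert i S. \<xi> $ i * q (axis i 1)) * fourier f \<xi>" for \<xi>
      unfolding c g(2) using insert.hyps by (simp add: distrib_right)
    then show ?case using test_function_add[OF test_function_cmult[OF d] g(1)] by blast
  qed simp
  moreover have "q \<xi> = (\<Sum>i\<in>UNIV. \<xi> $ i * q (axis i 1))" for \<xi>
  proof -
    have "q \<xi> = q (\<Sum>i\<in>UNIV. \<xi> $ i *\<^sub>R axis i 1)"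
      using basis_expansion[of \<xi>] by (simp add: scalar_mult_eq_scaleR)
    then show ?thesis by (simp add: q.sum q.scaleR)
  qed
  ultimately show ?case by metis
qed

text \<open>The product of the transform with a polynomial of high degree is
  again a transform of a test function, hence bounded.\<close>

lemma fourier_test_function_decay:
  fixes f :: "real^'n \<Rightarrow> complex"
  assumes f: "test_function f"
  obtains C where "C \<ge> 0" "\<And>\<xi>. norm (fourier f \<xi>) * (1 + norm \<xi>) ^ N \<le> C"
proof -
  \<comment> \<open>a polynomial that dominates \<open>(1 + norm \<xi>)\<^sup>N\<close>, because \<open>1 + r \<le> 2 (1 + r\<^sup>2)\<close>\<close>
  let ?q = "\<lambda>\<xi> :: real^'n. (2 * (1 + (\<Sum>i\<in>UNIV. \<xi> $ i * \<xi> $ i))) ^ N"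
  have "real_polynomial_function ?q"
    by (intro real_polynomial_function_power real_polynomial_function.intros real_polynomial_function_sum
        bounded_linear_vec_nth) auto
  from polynomial_multiplier[OF this f] obtain g where g: "test_function g"
    "\<And>\<xi>. fourier g \<xi> = of_real (?q \<xi>) * fourier f \<xi>" by blast
  show thesis
  proof
    show "(LINT x|lborel. norm (g x)) \<ge> 0" by simp
    fix \<xi> :: "real^'n"
    have n: "(\<Sum>i\<in>UNIV. \<xi> $ i * \<xi> $ i) = (norm \<xi>)\<^sup>2"
      by (simp add: power2_norm_eq_inner inner_vec_def)
    have "1 + norm \<xi> \<le> 2 * (1 + (norm \<xi>)\<^sup>2)"
      using sum_squares_bound[of 1 "norm \<xi>"] by (simp add: power2_eq_square)
         (smt (verit) mult_nonneg_nonneg norm_ge_zero)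
    then have "(1 + norm \<xi>) ^ N \<le> ?q \<xi>" unfolding n by (intro power_mono) auto
    then have "norm (fourier f \<xi>) * (1 + norm \<xi>) ^ N \<le> norm (fourier f \<xi>) * ?q \<xi>"
      by (intro mult_left_mono) auto
    also have "\<dots> = norm (fourier g \<xi>)"
      unfolding g(2) norm_mult norm_of_real n by simp
    also have "\<dots> \<le> (LINT x|lborel. norm (g x))"
      by (rule norm_fourier_le[OF test_function_integrable[OF g(1)]])
    finally show "norm (fourier f \<xi>) * (1 + norm \<xi>) ^ N \<le> (LINT x|lborel. norm (g x))" .
  qed
qed

lemma polynomial_growth:
  fixes q :: "'a::real_normed_vector \<Rightarrow> real"
  assumes "real_polynomial_function q"
  shows "\<exists>C N. C \<ge> 0 \<and> (\<forall>x. \<bar>q x\<bar> \<le> C * (1 + norm x) ^ N)"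
  using assms
proof induction
  case (linear f)
  interpret bounded_linear f by fact
  obtain K where "K \<ge> 0" "\<And>x. norm (f x) \<le> norm x * K" using nonneg_bounded by blast
  then have "\<bar>f x\<bar> \<le> K * (1 + norm x) ^ 1" for x
    using add_increasing[of K "\<bar>f x\<bar>" "norm x * K"] by (simp add: algebra_simps)
  then show ?case using \<open>K \<ge> 0\<close> by blast
next
  case (const c)
  show ?case by (intro exI[of _ "\<bar>c\<bar>"] exI[of _ 0]) simp
next
  case (add f g)
  then obtain C N D M where f: "C \<ge> 0" "\<And>x. \<bar>f x\<bar> \<le> C * (1 + norm x) ^ N"
    and g: "D \<ge> 0" "\<And>x. \<bar>g x\<bar> \<le> D * (1 + norm x) ^ M" by blast
  have "\<bar>f x + g x\<bar> \<le> (C + D) * (1 + norm x) ^ (N + M)" for x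
  proof -
    have "\<bar>f x\<bar> \<le> C * (1 + norm x) ^ (N + M)"
      using f by (rule_tac order_trans[OF f(2)]) (auto intro!: mult_left_mono power_increasing)
    moreover have "\<bar>g x\<bar> \<le> D * (1 + norm x) ^ (N + M)"
      using g by (rule_tac order_trans[OF g(2)]) (auto intro!: mult_left_mono power_increasing)
    ultimately show ?thesis by (simp add: distrib_right)
  qed
  then show ?case using f(1) g(1) by (meson add_nonneg_nonneg)
next
  case (mult f g)
  then obtain C N D M where f: "C \<ge> 0" "\<And>x. \<bar>f x\<bar> \<le> C * (1 + norm x) ^ N"
    and g: "D \<ge> 0" "\<And>x. \<bar>g x\<bar> \<le> D * (1 + norm x) ^ M" by blast
  have "\<bar>f x * g x\<bar> \<le> (C * D) * (1 + norm x) ^ (N + M)" for x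
    using mult_mono[OF f(2)[of x] g(2)[of x]] f(1) g(1) by (simp add: abs_mult power_add mult_ac)
  then show ?case using f(1) g(1) by (meson mult_nonneg_nonneg)
qed

lemma polynomial_lipschitz:
  fixes q :: "'a::real_normed_vector \<Rightarrow> real"
  assumes "real_polynomial_function q"
  shows "\<exists>C N. C \<ge> 0 \<and> (\<forall>x y. \<bar>q x - q y\<bar> \<le> C * norm (x - y) * (1 + norm x + norm y) ^ N)"
  using assms
proof induction
  case (linear f)
  interpret bounded_linear f by fact
  obtain K where "K \<ge> 0" "\<And>x. norm (f x) \<le> norm x * K" using nonneg_bounded by blast
  then show ?case
    by (intro exI[of _ K] exI[of _ 0]) (auto simp: mult.commute simp flip: diff)
next
  case (const c)
  show ?case by (intro exI[of _ 0]) simp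
next
  case (add f g)
  then obtain C N D M where f: "C \<ge> 0" "\<And>x y. \<bar>f x - f y\<bar> \<le> C * norm (x - y) * (1 + norm x + norm y) ^ N"
    and g: "D \<ge> 0" "\<And>x y. \<bar>g x - g y\<bar> \<le> D * norm (x - y) * (1 + norm x + norm y) ^ M" by blast
  have "\<bar>(f x + g x) - (f y + g y)\<bar> \<le> (C + D) * norm (x - y) * (1 + norm x + norm y) ^ (N + M)" for x y
  proof -
    have "\<bar>f x - f y\<bar> \<le> C * norm (x - y) * (1 + norm x + norm y) ^ (N + M)"
      using f by (rule_tac order_trans[OF f(2)]) (auto intro!: mult_left_mono power_increasing)
    moreover have "\<bar>g x - g y\<bar> \<le> D * norm (x - y) * (1 + norm x + norm y) ^ (N + M)"
      using g by (rule_tac order_trans[OF g(2)]) (auto intro!: mult_left_mono power_increasing)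
    ultimately show ?thesis by (simp add: distrib_right)
  qed
  then show ?case using f(1) g(1) by (meson add_nonneg_nonneg)
next
  case (mult f g)
  then obtain C N D M where f: "C \<ge> 0" "\<And>x y. \<bar>f x - f y\<bar> \<le> C * norm (x - y) * (1 + norm x + norm y) ^ N"
    and g: "D \<ge> 0" "\<And>x y. \<bar>g x - g y\<bar> \<le> D * norm (x - y) * (1 + norm x + norm y) ^ M" by blast
  obtain C' N' D' M' where f': "C' \<ge> 0" "\<And>x. \<bar>f x\<bar> \<le> C' * (1 + norm x) ^ N'"
    and g': "D' \<ge> 0" "\<And>x. \<bar>g x\<bar> \<le> D' * (1 + norm x) ^ M'"
    using polynomial_growth[OF mult(1)] polynomial_growth[OF mult(2)] by blast
  have "\<bar>f x * g x - f y * g y\<bar> \<le> (C' * D + D' * C) * norm (x - y) * (1 + norm x + norm y) ^ (N' + M + (M' + N))" for x y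
  proof -
    let ?r = "1 + norm x + norm y"
    have r: "?r \<ge> 1" by simp
    have "f x * g x - f y * g y = f x * (g x - g y) + g y * (f x - f y)" by (simp add: algebra_simps)
    then have "\<bar>f x * g x - f y * g y\<bar> \<le> \<bar>f x\<bar> * \<bar>g x - g y\<bar> + \<bar>g y\<bar> * \<bar>f x - f y\<bar>"
      by (metis abs_mult abs_triangle_ineq)
    also have "\<dots> \<le> (C' * ?r ^ N') * (D * norm (x - y) * ?r ^ M) + (D' * ?r ^ M') * (C * norm (x - y) * ?r ^ N)"
    proof (intro add_mono mult_mono f(2) g(2))
      show "\<bar>f x\<bar> \<le> C' * ?r ^ N'"
        using f'(1) by (rule_tac order_trans[OF f'(2)]) (auto intro!: mult_left_mono power_mono)
      show "\<bar>g y\<bar> \<le> D' * ?r ^ M'"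
        using g'(1) by (rule_tac order_trans[OF g'(2)]) (auto intro!: mult_left_mono power_mono)
    qed (use f g f' g' in auto)
    also have "\<dots> = C' * D * norm (x - y) * ?r ^ (N' + M) + D' * C * norm (x - y) * ?r ^ (M' + N)"
      by (simp add: power_add)
    also have "\<dots> \<le> C' * D * norm (x - y) * ?r ^ (N' + M + (M' + N)) + D' * C * norm (x - y) * ?r ^ (N' + M + (M' + N))"
    proof -
      have "?r ^ (N' + M) \<le> ?r ^ (N' + M + (M' + N))" "?r ^ (M' + N) \<le> ?r ^ (N' + M + (M' + N))"
        by (rule power_increasing[OF _ r], simp)+
      then show ?thesis using f g f' g' by (intro add_mono mult_left_mono) auto
    qed
    finally show ?thesis by (simp add: distrib_right)
  qed
  moreover have "0 \<le> C' * D + D' * C" using f g f' g' by simp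
  ultimately show ?case by meson
qed

section \<open>Linear change of variables in Lebesgue integrals\<close>

lemma involution_image:
  assumes "\<And>x. F (F x) = x" and "\<And>x. x \<in> D \<longleftrightarrow> F x \<in> C"
  shows "F ` C = D"
proof (intro set_eqI iffI)
  show "x \<in> D" if "x \<in> F ` C" for x using that assms by auto
  show "x \<in> F ` C" if "x \<in> D" for x using image_eqI[of x F "F x" C] that assms by auto
qed

text \<open>Every matrix is a product of elementary ones: a matrix with a zero row has a negligible image, a
  diagonal matrix stretches the axes, and coordinate transpositions and shears preserve the volume
  of boxes.\<close>

lemma matrix_image_measure:
  fixes A :: "real^'n^'n"
  shows "\<forall>S\<in>lmeasurable. (*v) A ` S \<in> lmeasurable \<and> measure lebesgue ((*v) A ` S) = \<bar>det A\<bar> * measure lebesgue S"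
proof (induction A rule: induct_matrix_elementary_alt)
  case (1 A B)
  show ?case
  proof
    fix S :: "(real^'n) set" assume S: "S \<in> lmeasurable"
    have "(*v) (A ** B) ` S = (*v) A ` (*v) B ` S"
      by (simp add: image_image matrix_vector_mul_assoc)
    then show "(*v) (A ** B) ` S \<in> lmeasurable \<and> measure lebesgue ((*v) (A ** B) ` S) = \<bar>det (A ** B)\<bar> * measure lebesgue S"
      using 1 S by (simp add: det_mul abs_mult)
  qed
next
  case (2 A i)
  have d: "det A = 0" using 2 by (rule det_zero_row)
  have "\<not> inj ((*v) A)"
    using d det_nz_iff_inj[OF matrix_vector_mul_linear[of A]] by simp
  then have neg: "negligible ((*v) A ` S)" for S
    by (intro negligible_linear_singular_image matrix_vector_mul_linear)
  show ?case
    using negligible_imp_measurable[OF neg] negligible_imp_measure0[OF neg] unfolding d by simp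
next
  case (3 A)
  have "(\<Sum>j\<in>UNIV. A $ i $ j * x $ j) = (\<Sum>j\<in>UNIV. if j = i then A $ i $ i * x $ i else 0)" for i and x :: "real^'n"
  proof (intro sum.cong refl)
    fix j show "A $ i $ j * x $ j = (if j = i then A $ i $ i * x $ i else 0)"
      using 3[of i j] by (cases "i = j") simp_all
  qed
  then have A: "(*v) A = (\<lambda>x. \<chi> k. A $ k $ k * x $ k)"
    by (simp add: fun_eq_iff vec_eq_iff matrix_vector_mult_def)
  have d: "det A = (\<Prod>k\<in>UNIV. A $ k $ k)" by (rule det_diagonal) (rule 3)
  show ?case
  proof
    fix S :: "(real^'n) set" assume S: "S \<in> lmeasurable"
    show "(*v) A ` S \<in> lmeasurable \<and> measure lebesgue ((*v) A ` S) = \<bar>det A\<bar> * measure lebesgue S"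
      unfolding d unfolding A
      using measurable_stretch[OF S, of "\<lambda>k. A $ k $ k"] measure_stretch[OF S, of "\<lambda>k. A $ k $ k"] by blast
  qed
next
  case (4 m n)
  let ?A = "\<chi> i j. mat 1 $ i $ Transposition.transpose m n j :: real^'n^'n"
  have A: "(*v) ?A = (\<lambda>x. \<chi> i. x $ Transposition.transpose m n i)"
  proof
    fix x :: "real^'n"
    have "(mat 1 :: real^'n^'n) $ i $ Transposition.transpose m n j * x $ j
        = (if j = Transposition.transpose m n i then x $ j else 0)" for i j
      by (auto simp: mat_def)
    then show "?A *v x = (\<chi> i. x $ Transposition.transpose m n i)"
      by (simp add: vec_eq_iff matrix_vector_mult_def)
  qed
  have d: "\<bar>det ?A\<bar> = 1"
    by (simp add: det_permute_columns permutes_swap_id sign_swap_id abs_mult)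
  have "measure lebesgue ((*v) ?A ` cbox a b) = 1 * measure lebesgue (cbox a b)" for a b
  proof (cases "cbox a b = {}")
    case False
    have AA: "?A *v (?A *v x) = x" for x unfolding A by (simp add: vec_eq_iff)
    have mem: "x \<in> cbox (?A *v a) (?A *v b) \<longleftrightarrow> ?A *v x \<in> cbox a b" for x
      unfolding A mem_box_cart by simp (metis transpose_involutory)
    have eq: "(*v) ?A ` cbox a b = cbox (?A *v a) (?A *v b)"
      by (rule involution_image[OF AA mem])
    moreover have "cbox (?A *v a) (?A *v b) \<noteq> {}" using False eq by blast
    ultimately show ?thesis
      using False prod.permute[OF permutes_swap_id[of m UNIV n], of "\<lambda>i. b $ i - a $ i"]
      by (simp add: content_cbox_cart A comp_def)
  qed simp
  note box = this
  show ?case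
  proof
    fix S :: "(real^'n) set" assume S: "S \<in> lmeasurable"
    show "(*v) ?A ` S \<in> lmeasurable \<and> measure lebesgue ((*v) ?A ` S) = \<bar>det ?A\<bar> * measure lebesgue S"
      using measure_linear_sufficient[OF matrix_vector_mul_linear S box] unfolding d by simp
  qed
next
  case (5 m n)
  let ?A = "\<chi> i j. of_bool (i = m \<and> j = n \<or> i = j) :: real^'n^'n"
  have A: "(*v) ?A = (\<lambda>x. \<chi> i. if i = m then x $ m + x $ n else x $ i)"
  proof
    fix x :: "real^'n"
    have "(\<Sum>j\<in>UNIV. of_bool (i = m \<and> j = n \<or> i = j) * x $ j)
        = (\<Sum>j\<in>UNIV. (if j = i then x $ i else 0) + (if j = n then of_bool (i = m) * x $ n else 0))" for i
      using 5 by (intro sum.cong refl) auto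
    then show "?A *v x = (\<chi> i. if i = m then x $ m + x $ n else x $ i)"
      by (simp add: vec_eq_iff matrix_vector_mult_def sum.distrib)
  qed
  have "?A = (\<chi> k. if k = m then row m (mat 1) + 1 *s row n (mat 1) else row k (mat 1))"
    using 5 by (auto simp: vec_eq_iff row_def mat_def)
  then have "det ?A = 1" using det_row_operation[OF 5, of "mat 1" 1] by simp
  then have d: "\<bar>det ?A\<bar> = 1" by (simp only: abs_one)
  have "measure lebesgue ((*v) ?A ` cbox a b) = 1 * measure lebesgue (cbox a b)" for a b
  proof (cases "cbox a b = {}")
    case False
    have tr: "cbox a b = (+) a ` cbox 0 (b - a)" using cbox_translation[of a 0 "b - a"] by simp
    have ne: "cbox 0 (b - a) \<noteq> {}" using False unfolding tr by simp
    have "(*v) ?A ` cbox a b = (+) (?A *v a) ` (*v) ?A ` cbox 0 (b - a)"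
      unfolding tr image_image by (simp add: matrix_vector_right_distrib)
    then have "measure lebesgue ((*v) ?A ` cbox a b) = measure lebesgue ((*v) ?A ` cbox 0 (b - a))"
      by (simp only: measure_translation)
    also have "\<dots> = measure lebesgue (cbox 0 (b - a))"
      unfolding A by (rule measure_shear_interval[OF 5 ne]) simp
    also have "\<dots> = measure lebesgue (cbox a b)"
      unfolding tr by (simp only: measure_translation)
    finally show ?thesis by simp
  qed simp
  note box = this
  show ?case
  proof
    fix S :: "(real^'n) set" assume S: "S \<in> lmeasurable"
    show "(*v) ?A ` S \<in> lmeasurable \<and> measure lebesgue ((*v) ?A ` S) = \<bar>det ?A\<bar> * measure lebesgue S"
      using measure_linear_sufficient[OF matrix_vector_mul_linear S box] unfolding d by simp
  qed
qed

lemma lborel_matrix: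
  fixes A :: "real^'n^'n"
  assumes A: "invertible A"
  shows "lborel = density (distr lborel borel ((*v) A)) (\<lambda>_. ennreal \<bar>det A\<bar>)"
proof (rule lborel_eqI)
  obtain B where B: "A ** B = mat 1" "B ** A = mat 1" using A by (auto simp: invertible_def)
  have dd: "det A * det B = 1" using B(1) det_mul[of A B] by simp
  have m [measurable]: "(*v) A \<in> borel_measurable borel"
    by (intro borel_measurable_continuous_onI linear_continuous_on matrix_vector_mul_bounded_linear)
  fix l u :: "real^'n" assume lu: "\<And>b. b \<in> Basis \<Longrightarrow> l \<bullet> b \<le> u \<bullet> b"
  have pre: "(*v) A -` box l u = (*v) B ` box l u"
  proof safe
    fix x assume "A *v x \<in> box l u"
    moreover have "x = B *v (A *v x)" using B by (simp add: matrix_vector_mul_assoc)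
    ultimately show "x \<in> (*v) B ` box l u" by blast
  qed (use B in \<open>simp add: matrix_vector_mul_assoc\<close>)
  have img: "(*v) B ` box l u \<in> lmeasurable" "measure lebesgue ((*v) B ` box l u) = \<bar>det B\<bar> * measure lebesgue (box l u)"
    using matrix_image_measure[of B] by auto
  have sb: "(*v) A -` box l u \<in> sets borel" using measurable_sets[OF m, of "box l u"] by simp
  have "emeasure lborel ((*v) A -` box l u) = emeasure lebesgue ((*v) B ` box l u)"
    using sb unfolding pre by simp
  also have "\<dots> = ennreal (\<bar>det B\<bar> * measure lebesgue (box l u))"
    unfolding emeasure_eq_measure2[OF img(1)] img(2) ..
  also have "\<dots> = ennreal \<bar>det B\<bar> * emeasure lebesgue (box l u)"
    using emeasure_eq_measure2[OF lmeasurable_box[of l u]] by (simp only: ennreal_mult' abs_ge_zero)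
  also have "emeasure lebesgue (box l u) = (\<Prod>b\<in>Basis. (u - l) \<bullet> b)"
    using emeasure_lborel_box[OF lu] by simp
  finally have e: "emeasure lborel ((*v) A -` box l u) = ennreal \<bar>det B\<bar> * ennreal (\<Prod>b\<in>Basis. (u - l) \<bullet> b)" .
  have "emeasure (density (distr lborel borel ((*v) A)) (\<lambda>_. ennreal \<bar>det A\<bar>)) (box l u)
      = ennreal \<bar>det A\<bar> * emeasure lborel ((*v) A -` box l u)"
    by (subst emeasure_density_const) (simp_all add: emeasure_distr)
  also have "\<dots> = (ennreal \<bar>det A\<bar> * ennreal \<bar>det B\<bar>) * (\<Prod>b\<in>Basis. (u - l) \<bullet> b)"
    unfolding e by (simp add: mult.assoc)
  also have "ennreal \<bar>det A\<bar> * ennreal \<bar>det B\<bar> = 1"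
    using dd by (simp add: ennreal_mult'[symmetric] abs_mult[symmetric])
  finally show "emeasure (density (distr lborel borel ((*v) A)) (\<lambda>_. ennreal \<bar>det A\<bar>)) (box l u)
      = (\<Prod>b\<in>Basis. (u - l) \<bullet> b)" by simp
qed simp

lemma integral_lborel_matrix:
  fixes f :: "real^'n \<Rightarrow> 'b::{banach, second_countable_topology}"
  assumes A: "invertible A" and [measurable]: "f \<in> borel_measurable borel"
  shows "(LINT x|lborel. f x) = \<bar>det A\<bar> *\<^sub>R (LINT x|lborel. f (A *v x))"
proof -
  have [measurable]: "(*v) A \<in> borel_measurable borel"
    by (intro borel_measurable_continuous_onI linear_continuous_on matrix_vector_mul_bounded_linear)
  show ?thesis
    by (subst lborel_matrix[OF A], subst integral_density) (simp_all add: integral_distr)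
qed

lemma nn_integral_lborel_matrix:
  fixes f :: "real^'n \<Rightarrow> ennreal"
  assumes A: "invertible A" and [measurable]: "f \<in> borel_measurable borel"
  shows "(\<integral>\<^sup>+x. f x \<partial>lborel) = ennreal \<bar>det A\<bar> * (\<integral>\<^sup>+x. f (A *v x) \<partial>lborel)"
proof -
  have [measurable]: "(*v) A \<in> borel_measurable borel"
    by (intro borel_measurable_continuous_onI linear_continuous_on matrix_vector_mul_bounded_linear)
  show ?thesis
    by (subst lborel_matrix[OF A], subst nn_integral_density) (simp_all add: nn_integral_distr nn_integral_cmult)
qed

section \<open>Continuous distributional derivatives and vanishing moments\<close>

lemma integral_cbox_eq_lborel:
  fixes f :: "'a::euclidean_space \<Rightarrow> 'b::euclidean_space"
  assumes f: "continuous_on UNIV f" and supp: "\<And>x. norm x > R \<Longrightarrow> f x = 0" and ab: "cball 0 R \<subseteq> cbox a b"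
  shows "integral (cbox a b) f = (LINT x|lborel. f x)"
proof -
  have "f x = 0" if "x \<notin> cbox a b" for x using that ab supp[of x] by force
  then have "(\<lambda>x. if x \<in> cbox a b then f x else 0) = f" by auto
  then have "integral (cbox a b) f = integral UNIV f"
    using Henstock_Kurzweil_Integration.integral_restrict_UNIV[of "cbox a b" f] by simp
  then show ?thesis using integral_lborel[OF compact_support_integrable[OF f supp]] by simp
qed

text \<open>Differentiation under the integral; \<open>F\<close> is only continuous, so the derivative has to fall on the kernel.\<close>

lemma convolution_line_derivative:
  fixes F K :: "real^'n \<Rightarrow> complex"
  assumes F: "continuous_on UNIV F" and K: "test_function K"
  shows "((\<lambda>s. LINT u|lborel. F u * K (x + s *\<^sub>R v - u)) has_vector_derivative
    (LINT u|lborel. F u * (\<Sum>i\<in>UNIV. v $ i *\<^sub>R partial_deriv i K (x + s0 *\<^sub>R v - u)))) (at s0)"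
proof -
  obtain R where R: "\<And>w. norm w > R \<Longrightarrow> K w = 0" using K unfolding test_function_iff by blast
  have R': "partial_deriv i K w = 0" if "norm w > R" for i w by (rule partial_deriv_support[OF R that])
  \<comment> \<open>beyond radius \<open>S\<close> the kernel vanishes for all \<open>s\<close> in the unit ball about \<open>s0\<close>\<close>
  define S where "S = R + norm x + (\<bar>s0\<bar> + 1) * norm v"
  obtain a where a: "cball 0 S \<subseteq> cbox (- a) (a :: real^'n)"
    using bounded_subset_cbox_symmetric[OF bounded_cball] by blast
  let ?U = "ball s0 1"
  have far: "norm (x + s *\<^sub>R v - u) > R" if "s \<in> ?U" "norm u > S" for s u
  proof -
    have "norm (x + s *\<^sub>R v) \<le> norm x + \<bar>s\<bar> * norm v"
      using norm_triangle_ineq[of x "s *\<^sub>R v"] by simp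
    also have "\<bar>s\<bar> \<le> \<bar>s0\<bar> + 1" using that(1) by (auto simp: dist_real_def)
    then have "norm x + \<bar>s\<bar> * norm v \<le> norm x + (\<bar>s0\<bar> + 1) * norm v" by (intro add_left_mono mult_right_mono) auto
    finally have "norm (x + s *\<^sub>R v) \<le> S - R" by (simp add: S_def)
    then show ?thesis using that(2) norm_triangle_ineq2[of u "x + s *\<^sub>R v"] by (simp add: norm_minus_commute)
  qed
  define f where "f s u = F u * K (x + s *\<^sub>R v - u)" for s u
  define f' where "f' s u = F u * (\<Sum>i\<in>UNIV. v $ i *\<^sub>R partial_deriv i K (x + s *\<^sub>R v - u))" for s u
  have cK: "continuous_on UNIV K" by (rule test_function_continuous[OF K])
  have cdK: "continuous_on UNIV (partial_deriv i K)" for i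
    by (rule test_function_continuous[OF test_function_partial_deriv[OF K]])
  have cf: "continuous_on UNIV (f s)" for s
    unfolding f_def by (intro continuous_intros F continuous_on_compose2[OF cK]) auto
  have cf': "continuous_on UNIV (f' s)" for s
    unfolding f'_def by (intro continuous_intros F continuous_on_compose2[OF cdK]) auto
  have cf'2: "continuous_on (?U \<times> cbox (- a) a) (\<lambda>(s, u). f' s u)"
    unfolding f'_def split_beta
    by (intro continuous_intros continuous_on_compose2[OF F] continuous_on_compose2[OF cdK]) auto
  have diff: "K differentiable (at w)" for w using K smooth_differentiable unfolding test_function_def by blast
  have der: "((\<lambda>s. f s u) has_vector_derivative f' s u) (at s)" for s u
  proof -
    have "((\<lambda>s. K ((x - u) + s *\<^sub>R v)) has_vector_derivative
        (\<Sum>i\<in>UNIV. v $ i *\<^sub>R partial_deriv i K ((x - u) + s *\<^sub>R v))) (at s)"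
      by (rule line_has_vector_derivative[OF diff])
    from has_vector_derivative_mult_right[OF this, of "F u"]
    show ?thesis unfolding f_def f'_def by (simp add: algebra_simps)
  qed
  have "((\<lambda>s. integral (cbox (- a) a) (f s)) has_vector_derivative integral (cbox (- a) a) (f' s0)) (at s0 within ?U)"
  proof (rule leibniz_rule_vector_derivative)
    show "((\<lambda>s. f s u) has_vector_derivative f' s u) (at s within ?U)" for s u
      by (rule has_vector_derivative_at_within[OF der])
    show "f s integrable_on cbox (- a) a" for s
      by (rule integrable_continuous[OF continuous_on_subset[OF cf]]) simp
  qed (use cf'2 in auto)
  then have "((\<lambda>s. integral (cbox (- a) a) (f s)) has_vector_derivative integral (cbox (- a) a) (f' s0)) (at s0)"
    by (simp add: at_within_open[of _ ?U])
  moreover have "integral (cbox (- a) a) (f s) = (LINT u|lborel. f s u)" if "s \<in> ?U" for s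
    by (rule integral_cbox_eq_lborel[OF cf _ a]) (simp add: f_def R far[OF that])
  moreover have "integral (cbox (- a) a) (f' s0) = (LINT u|lborel. f' s0 u)"
    by (rule integral_cbox_eq_lborel[OF cf' _ a]) (simp add: f'_def R' far)
  ultimately have "((\<lambda>s. LINT u|lborel. f s u) has_vector_derivative (LINT u|lborel. f' s0 u)) (at s0)"
    using has_vector_derivative_transform_within_open[of "\<lambda>s. integral (cbox (- a) a) (f s)" _ s0 ?U "\<lambda>s. LINT u|lborel. f s u"]
    by simp
  then show ?thesis unfolding f_def f'_def .
qed

definition mollifier :: "(real^'n \<Rightarrow> real) \<Rightarrow> bool" where
  "mollifier \<rho> \<longleftrightarrow> test_function (\<lambda>x. complex_of_real (\<rho> x)) \<and> (\<forall>x. \<rho> x \<ge> 0) \<and> (\<forall>x. norm x > 1 \<longrightarrow> \<rho> x = 0)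
     \<and> integrable lborel \<rho> \<and> (LINT x|lborel. \<rho> x) = 1"

text \<open>The substitution \<open>z = (y - u) / \<epsilon>\<close> makes this the usual convolution with a rescaled kernel; written in this way, its value is visibly an
  average of \<open>F\<close> over the ball of radius \<open>\<epsilon>\<close> about \<open>y\<close>.\<close>

definition mollify :: "(real^'n \<Rightarrow> real) \<Rightarrow> real \<Rightarrow> (real^'n \<Rightarrow> complex) \<Rightarrow> real^'n \<Rightarrow> complex" where
  "mollify \<rho> \<epsilon> F y = (LINT z|lborel. F (y - \<epsilon> *\<^sub>R z) * of_real (\<rho> z))"

lemma mollify_close:
  fixes F :: "real^'n \<Rightarrow> complex"
  assumes \<rho>: "mollifier \<rho>" and F: "continuous_on UNIV F" and \<epsilon>: "\<epsilon> > 0"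
    and close: "\<And>w. norm (w - y) \<le> \<epsilon> \<Longrightarrow> norm (F w - c) \<le> e"
  shows "norm (mollify \<rho> \<epsilon> F y - c) \<le> e"
proof -
  have \<rho>': "test_function (\<lambda>x. complex_of_real (\<rho> x))" "\<And>x. \<rho> x \<ge> 0" "\<And>x. norm x > 1 \<Longrightarrow> \<rho> x = 0"
    "integrable lborel \<rho>" "(LINT x|lborel. \<rho> x) = 1" using \<rho> by (simp_all add: mollifier_def)
  have c\<rho>: "continuous_on UNIV (\<lambda>x. complex_of_real (\<rho> x))" by (rule test_function_continuous[OF \<rho>'(1)])
  have i: "integrable lborel (\<lambda>z. F (y - \<epsilon> *\<^sub>R z) * of_real (\<rho> z))"
    by (rule compact_support_integrable[of _ 1])
       (auto intro!: continuous_intros continuous_on_compose2[OF F] c\<rho> simp: \<rho>'(3))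
  have ic: "integrable lborel (\<lambda>z. c * complex_of_real (\<rho> z))" using \<rho>'(4) by simp
  have "mollify \<rho> \<epsilon> F y - c = (LINT z|lborel. F (y - \<epsilon> *\<^sub>R z) * of_real (\<rho> z) - c * of_real (\<rho> z))"
    using Bochner_Integration.integral_diff[OF i ic] \<rho>'(5) by (simp add: mollify_def)
  also have "norm \<dots> \<le> (LINT z|lborel. e * \<rho> z)"
  proof (rule Bochner_Integration.integral_norm_bound_integral)
    show "integrable lborel (\<lambda>z. F (y - \<epsilon> *\<^sub>R z) * of_real (\<rho> z) - c * of_real (\<rho> z))"
      by (rule Bochner_Integration.integrable_diff[OF i ic])
    show "norm (F (y - \<epsilon> *\<^sub>R z) * of_real (\<rho> z) - c * of_real (\<rho> z)) \<le> e * \<rho> z" for z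
    proof (cases "norm z > 1")
      case False
      then have "norm (F (y - \<epsilon> *\<^sub>R z) - c) \<le> e" using \<epsilon> by (intro close) simp
      then show ?thesis
        using \<rho>'(2)[of z] by (simp add: norm_mult mult_right_mono flip: left_diff_distrib)
    qed (simp add: \<rho>'(3))
  qed (use \<rho>'(4) in simp)
  also have "\<dots> = e" using \<rho>'(5) by simp
  finally show ?thesis .
qed

lemma mollify_tendsto:
  fixes F :: "real^'n \<Rightarrow> complex"
  assumes \<rho>: "mollifier \<rho>" and F: "continuous_on UNIV F" and \<epsilon>: "\<And>n. \<epsilon> n > 0" "\<epsilon> \<longlonglongrightarrow> 0"
  shows "(\<lambda>n. mollify \<rho> (\<epsilon> n) F y) \<longlonglongrightarrow> F y"
proof (rule tendstoI)
  fix e :: real assume e: "e > 0"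
  have "isCont F y" using F by (simp add: continuous_on_eq_continuous_at)
  then obtain d where d: "d > 0" "\<And>w. norm (w - y) < d \<Longrightarrow> norm (F w - F y) < e / 2"
    using e unfolding continuous_at_eps_delta dist_norm by (metis half_gt_zero)
  have "eventually (\<lambda>n. \<epsilon> n < d) sequentially" using \<epsilon>(2) d(1) by (rule order_tendstoD)
  then show "eventually (\<lambda>n. dist (mollify \<rho> (\<epsilon> n) F y) (F y) < e) sequentially"
  proof eventually_elim
    case (elim n)
    have "norm (mollify \<rho> (\<epsilon> n) F y - F y) \<le> e / 2"
      by (rule mollify_close[OF \<rho> F \<epsilon>(1)[of n]]) (use d(2) elim in \<open>force intro: less_imp_le\<close>)
    then show ?case using e by (simp add: dist_norm)
  qed
qed

lemma mollify_convolution: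
  fixes F :: "real^'n \<Rightarrow> complex"
  assumes \<rho>: "mollifier \<rho>" and F: "continuous_on UNIV F" and \<epsilon>: "\<epsilon> > 0"
  shows "(LINT u|lborel. F u * of_real (\<rho> ((1 / \<epsilon>) *\<^sub>R (y - u)))) = of_real (\<epsilon> ^ CARD('n)) * mollify \<rho> \<epsilon> F y"
proof -
  have c\<rho>: "continuous_on UNIV (\<lambda>x. complex_of_real (\<rho> x))"
    using \<rho> unfolding mollifier_def by (intro test_function_continuous) blast
  have [measurable]: "(\<lambda>u. F u * of_real (\<rho> ((1 / \<epsilon>) *\<^sub>R (y - u)))) \<in> borel_measurable borel"
    by (intro borel_measurable_continuous_onI continuous_intros F continuous_on_compose2[OF c\<rho>]) auto
  show ?thesis
    using \<epsilon> by (subst integral_lborel_affine[of "- \<epsilon>" _ y]) (simp_all add: mollify_def scaleR_conv_of_real[where 'a=complex])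
qed

text \<open>Continuous distributional partial derivatives are classical. Mollification turns them into classical ones,
  and near \<open>y\<close> the mollified derivatives are within \<open>e\<close> of the value at \<open>y\<close>, uniformly in the mollification
  parameter. The mean value inequality then passes to the limit.\<close>

lemma weak_derivative_line:
  fixes F :: "real^'n \<Rightarrow> complex" and G :: "'n \<Rightarrow> real^'n \<Rightarrow> complex"
  assumes F: "continuous_on UNIV F" and G: "\<And>i. continuous_on UNIV (G i)"
    and weak: "\<And>i \<phi>. test_function \<phi> \<Longrightarrow>
      (LINT x|lborel. G i x * \<phi> x) = - (LINT x|lborel. F x * partial_deriv i \<phi> x)"
  shows "((\<lambda>s. F (x + s *\<^sub>R v)) has_vector_derivative (\<Sum>i\<in>UNIV. v $ i *\<^sub>R G i (x + s *\<^sub>R v))) (at s)"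
proof -
  obtain \<rho> :: "real^'n \<Rightarrow> real" where \<rho>: "mollifier \<rho>"
    using mollifier_exists unfolding mollifier_def by metis
  have t\<rho>: "test_function (\<lambda>x. complex_of_real (\<rho> x))" using \<rho> by (simp add: mollifier_def)
  define H where "H w y = (\<Sum>i\<in>UNIV. w $ i *\<^sub>R G i y)" for w y
  have cH: "continuous_on UNIV (H w)" for w
    unfolding H_def by (intro continuous_intros G)
  \<comment> \<open>mollification commutes with the derivative\<close>
  have moll_der: "((\<lambda>s. mollify \<rho> \<epsilon> F (y + s *\<^sub>R w)) has_vector_derivative mollify \<rho> \<epsilon> (H w) (y + s *\<^sub>R w)) (at s)"
    if \<epsilon>: "\<epsilon> > 0" for \<epsilon> y w s
  proof -
    define K where "K u = complex_of_real (\<rho> ((1 / \<epsilon>) *\<^sub>R u))" for u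
    have K: "test_function K"
      using test_function_affine[OF t\<rho>, of "1 / \<epsilon>" 0] \<epsilon> by (simp add: K_def[abs_def])
    have mK: "mollify \<rho> \<epsilon> f z = (1 / \<epsilon> ^ CARD('n)) *\<^sub>R (LINT u|lborel. f u * K (z - u))"
      if "continuous_on UNIV f" for f z
      using mollify_convolution[OF \<rho> that \<epsilon>, of z] \<epsilon> by (simp add: K_def scaleR_conv_of_real)
    let ?z = "y + s *\<^sub>R w"
    have cdK: "continuous_on UNIV (partial_deriv i K)" for i
      by (rule test_function_continuous[OF test_function_partial_deriv[OF K]])
    obtain R where R: "\<And>w. norm w > R \<Longrightarrow> K w = 0" using K unfolding test_function_iff by blast
    have supp: "norm (?z - u) > R" if "norm u > norm ?z + R" for u
      using that norm_triangle_ineq2[of u ?z] by (simp add: norm_minus_commute)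
    have w1: "(LINT u|lborel. F u * partial_deriv i K (?z - u)) = (LINT u|lborel. G i u * K (?z - u))" for i
    proof -
      have tK: "test_function (\<lambda>u. K (?z - u))"
        using test_function_affine[OF K, of "-1" ?z] by (simp add: algebra_simps)
      have "partial_deriv i (\<lambda>u. K (?z - u)) u = - partial_deriv i K (?z - u)" for u
        using partial_deriv_affine[of K "-1" u ?z i] K
        by (simp add: test_function_def smooth_differentiable algebra_simps)
      then show ?thesis using weak[OF tK, of i] by simp
    qed
    have i1: "integrable lborel (\<lambda>u. F u * (w $ i *\<^sub>R partial_deriv i K (?z - u)))" for i
      by (rule compact_support_integrable[of _ "norm ?z + R"])
         (auto intro!: continuous_intros F continuous_on_compose2[OF cdK] simp: partial_deriv_support[OF R supp])
    have i2: "integrable lborel (\<lambda>u. (w $ i *\<^sub>R G i u) * K (?z - u))" for i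
      by (rule compact_support_integrable[of _ "norm ?z + R"])
         (auto intro!: continuous_intros G continuous_on_compose2[OF test_function_continuous[OF K]] simp: R[OF supp])
    have "(LINT u|lborel. F u * (\<Sum>i\<in>UNIV. w $ i *\<^sub>R partial_deriv i K (?z - u)))
        = (\<Sum>i\<in>UNIV. LINT u|lborel. F u * (w $ i *\<^sub>R partial_deriv i K (?z - u)))"
      unfolding sum_distrib_left by (rule Bochner_Integration.integral_sum[OF i1])
    also have "\<dots> = (\<Sum>i\<in>UNIV. LINT u|lborel. (w $ i *\<^sub>R G i u) * K (?z - u))"
      using w1 by simp
    also have "\<dots> = (LINT u|lborel. H w u * K (?z - u))"
      unfolding H_def sum_distrib_right by (rule Bochner_Integration.integral_sum[OF i2, symmetric])
    finally have eq: "(LINT u|lborel. F u * (\<Sum>i\<in>UNIV. w $ i *\<^sub>R partial_deriv i K (?z - u)))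
        = (LINT u|lborel. H w u * K (?z - u))" .
    have "((\<lambda>s. (1 / \<epsilon> ^ CARD('n)) *\<^sub>R (LINT u|lborel. F u * K (y + s *\<^sub>R w - u))) has_vector_derivative
        (1 / \<epsilon> ^ CARD('n)) *\<^sub>R (LINT u|lborel. H w u * K (?z - u))) (at s)"
      using has_vector_derivative_scaleR[OF DERIV_const[of "1 / \<epsilon> ^ CARD('n)"]
          convolution_line_derivative[OF F K, of y w s]] unfolding eq by simp
    then show ?thesis unfolding mK[OF F] mK[OF cH] .
  qed
  have core: "\<exists>d>0. \<forall>h. \<bar>h\<bar> < d \<longrightarrow> norm (F (y + h *\<^sub>R v) - F y - h *\<^sub>R H v y) \<le> e * \<bar>h\<bar>" if e: "e > 0" for e y
  proof -
    have "isCont (H v) y" using cH by (simp add: continuous_on_eq_continuous_at)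
    then obtain \<delta> where \<delta>: "\<delta> > 0" "\<And>w. norm (w - y) < \<delta> \<Longrightarrow> norm (H v w - H v y) < e"
      using e unfolding continuous_at_eps_delta dist_norm by metis
    define d where "d = \<delta> / (2 * (norm v + 1))"
    have v1: "norm v + 1 > 0" by (simp add: add_nonneg_pos)
    have d: "d > 0" using \<delta>(1) v1 by (simp add: d_def)
    define \<epsilon> where "\<epsilon> n = \<delta> / 2 * inverse (real (Suc n))" for n
    have \<epsilon>: "\<epsilon> n > 0" "\<epsilon> n \<le> \<delta> / 2" for n
      using \<delta>(1) by (simp_all add: \<epsilon>_def inverse_le_1_iff mult_le_cancel_left2)
    have \<epsilon>0: "\<epsilon> \<longlonglongrightarrow> 0"
      unfolding \<epsilon>_def using tendsto_mult_right_zero[OF LIMSEQ_inverse_real_of_nat, of "\<delta> / 2"] .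
    have "norm (F (y + h *\<^sub>R v) - F y - h *\<^sub>R H v y) \<le> e * \<bar>h\<bar>" if h: "\<bar>h\<bar> < d" for h
    proof -
      have hv: "\<bar>h\<bar> * norm v < \<delta> / 2"
      proof -
        have "\<bar>h\<bar> * norm v \<le> \<bar>h\<bar> * (norm v + 1)" by (intro mult_left_mono) auto
        also have "\<dots> < d * (norm v + 1)" using h v1 by (intro mult_strict_right_mono)
        also have "\<dots> = \<delta> / 2" using v1 by (simp add: d_def divide_simps)
        finally show ?thesis .
      qed
      have Hh: "H (h *\<^sub>R v) w = h *\<^sub>R H v w" for w by (simp add: H_def scaleR_sum_right)
      have mHh: "mollify \<rho> (\<epsilon> n) (H (h *\<^sub>R v)) w = h *\<^sub>R mollify \<rho> (\<epsilon> n) (H v) w" for n w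
        by (simp add: mollify_def Hh)
      have "norm (mollify \<rho> (\<epsilon> n) F (y + h *\<^sub>R v) - mollify \<rho> (\<epsilon> n) F y - h *\<^sub>R H v y) \<le> e * \<bar>h\<bar>" for n
      proof -
        define g where "g s = mollify \<rho> (\<epsilon> n) F (y + s *\<^sub>R (h *\<^sub>R v)) - s *\<^sub>R (h *\<^sub>R H v y)" for s
        define g' where "g' s = h *\<^sub>R mollify \<rho> (\<epsilon> n) (H v) (y + s *\<^sub>R (h *\<^sub>R v)) - h *\<^sub>R H v y" for s
        have "norm (g 1 - g 0) \<le> (e * \<bar>h\<bar>) * 1"
        proof (rule vector_derivative_bound)
          show "(g has_vector_derivative g' s) (at s)" for s
            unfolding g_def g'_def mHh[symmetric]
            by (rule has_vector_derivative_diff[OF moll_der[OF \<epsilon>(1)]])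
               (auto intro!: derivative_eq_intros simp: has_vector_derivative_def)
          show "norm (g' s) \<le> e * \<bar>h\<bar>" if s: "0 \<le> s" "s \<le> 1" for s
          proof -
            have "norm (mollify \<rho> (\<epsilon> n) (H v) (y + s *\<^sub>R (h *\<^sub>R v)) - H v y) \<le> e"
            proof (rule mollify_close[OF \<rho> cH \<epsilon>(1)])
              fix w assume w: "norm (w - (y + s *\<^sub>R h *\<^sub>R v)) \<le> \<epsilon> n"
              have "norm (w - y) \<le> norm (w - (y + s *\<^sub>R h *\<^sub>R v)) + norm (s *\<^sub>R h *\<^sub>R v)"
                using norm_triangle_ineq[of "w - (y + s *\<^sub>R h *\<^sub>R v)" "s *\<^sub>R h *\<^sub>R v"] by simp
              also have "norm (s *\<^sub>R h *\<^sub>R v) \<le> \<bar>h\<bar> * norm v"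
                using s by (simp add: abs_mult mult_right_mono mult_left_le_one_le)
              finally show "norm (H v w - H v y) \<le> e"
                using w \<epsilon>(2)[of n] hv by (intro less_imp_le \<delta>(2)) simp
            qed
            then have "\<bar>h\<bar> * norm (mollify \<rho> (\<epsilon> n) (H v) (y + s *\<^sub>R (h *\<^sub>R v)) - H v y) \<le> \<bar>h\<bar> * e"
              by (intro mult_left_mono) auto
            then show ?thesis
              unfolding g'_def scaleR_diff_right[symmetric] norm_scaleR by (simp add: mult.commute)
          qed
        qed simp
        then show ?thesis by (simp add: g_def algebra_simps)
      qed
      moreover have "(\<lambda>n. norm (mollify \<rho> (\<epsilon> n) F (y + h *\<^sub>R v) - mollify \<rho> (\<epsilon> n) F y - h *\<^sub>R H v y))
          \<longlonglongrightarrow> norm (F (y + h *\<^sub>R v) - F y - h *\<^sub>R H v y)"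
        by (intro tendsto_intros mollify_tendsto[OF \<rho> F \<epsilon>(1) \<epsilon>0])
      ultimately show ?thesis by (intro LIMSEQ_le_const2) auto
    qed
    then show ?thesis using d by blast
  qed
  show ?thesis
    unfolding has_vector_derivative_def has_derivative_at_alt
  proof (intro conjI allI impI)
    fix e :: real assume "e > 0"
    from core[OF this, of "x + s *\<^sub>R v"] obtain d where d: "d > 0"
      "\<And>h. \<bar>h\<bar> < d \<Longrightarrow> norm (F ((x + s *\<^sub>R v) + h *\<^sub>R v) - F (x + s *\<^sub>R v) - h *\<^sub>R H v (x + s *\<^sub>R v)) \<le> e * \<bar>h\<bar>"
      by blast
    have "norm (F (x + t *\<^sub>R v) - F (x + s *\<^sub>R v) - (t - s) *\<^sub>R H v (x + s *\<^sub>R v)) \<le> e * norm (t - s)"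
      if "norm (t - s) < d" for t
      using d(2)[of "t - s"] that by (simp add: algebra_simps)
    then show "\<exists>d>0. \<forall>t. norm (t - s) < d \<longrightarrow> norm (F (x + t *\<^sub>R v) - F (x + s *\<^sub>R v)
        - (t - s) *\<^sub>R (\<Sum>i\<in>UNIV. v $ i *\<^sub>R G i (x + s *\<^sub>R v))) \<le> e * norm (t - s)"
      using d(1) unfolding H_def by blast
  qed (rule bounded_linear_scaleR_left)
qed

text \<open>Testing with the mollifier shows that both functions have the same mollifications.\<close>

lemma weak_equality:
  fixes F G :: "real^'n \<Rightarrow> complex"
  assumes F: "continuous_on UNIV F" and G: "continuous_on UNIV G"
    and weak: "\<And>\<phi>. test_function \<phi> \<Longrightarrow> (LINT x|lborel. G x * \<phi> x) = (LINT x|lborel. F x * \<phi> x)"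
  shows "G = F"
proof
  fix y
  obtain \<rho> :: "real^'n \<Rightarrow> real" where \<rho>: "mollifier \<rho>"
    using mollifier_exists unfolding mollifier_def by metis
  have t\<rho>: "test_function (\<lambda>x. complex_of_real (\<rho> x))" using \<rho> by (simp add: mollifier_def)
  define \<epsilon> where "\<epsilon> n = inverse (real (Suc n))" for n
  have \<epsilon>: "\<epsilon> n > 0" for n by (simp add: \<epsilon>_def)
  have \<epsilon>0: "\<epsilon> \<longlonglongrightarrow> 0" unfolding \<epsilon>_def by (rule LIMSEQ_inverse_real_of_nat)
  have "mollify \<rho> (\<epsilon> n) G y = mollify \<rho> (\<epsilon> n) F y" for n
  proof -
    have t: "test_function (\<lambda>u. complex_of_real (\<rho> ((1 / \<epsilon> n) *\<^sub>R (y - u))))"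
      using test_function_affine[OF t\<rho>, of "- (1 / \<epsilon> n)" "(1 / \<epsilon> n) *\<^sub>R y"] \<epsilon>[of n]
      by (simp add: algebra_simps)
    show ?thesis
      using weak[OF t] mollify_convolution[OF \<rho> F \<epsilon>, of n y] mollify_convolution[OF \<rho> G \<epsilon>, of n y] \<epsilon>[of n]
      by simp
  qed
  then show "G y = F y"
    using mollify_tendsto[OF \<rho> F \<epsilon> \<epsilon>0, of y] mollify_tendsto[OF \<rho> G \<epsilon> \<epsilon>0, of y] LIMSEQ_unique by auto
qed

text \<open>Product measures and Fubini are available for Borel functions, hence the passage to a Borel version of \<open>f\<close>.\<close>

lemma borel_representative:
  fixes f :: "real^'n \<Rightarrow> complex"
  assumes f: "integrable lebesgue f"
  obtains g where "integrable lborel g" "AE x in lebesgue. f x = g x" "fourier f = fourier g"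
proof -
  have fm [measurable]: "f \<in> borel_measurable lebesgue" using f by simp
  have re: "(\<lambda>x. Re (f x)) \<in> borel_measurable lebesgue" and im: "(\<lambda>x. Im (f x)) \<in> borel_measurable lebesgue"
    by measurable
  from completion_ex_borel_measurable_real[OF re]
  obtain r where [measurable]: "r \<in> borel_measurable lborel" and r: "AE x in lborel. Re (f x) = r x" by blast
  from completion_ex_borel_measurable_real[OF im]
  obtain i where [measurable]: "i \<in> borel_measurable lborel" and i: "AE x in lborel. Im (f x) = i x" by blast
  define g where "g x = Complex (r x) (i x)" for x
  have gm: "g \<in> borel_measurable lborel" unfolding g_def Complex_eq by measurable
  have gl: "g \<in> borel_measurable lebesgue" by (rule measurable_completion[OF gm])
  have "AE x in lborel. f x = g x"
    using r i by eventually_elim (simp add: g_def complex_eq_iff)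
  then have fg: "AE x in lebesgue. f x = g x" by (rule AE_completion)
  have "integrable lebesgue g"
    using f integrable_cong_AE[OF fm gl fg] by simp
  then have "integrable lborel g" using integrable_completion[OF gm] by simp
  then show thesis using fg fourier_cong_AE[OF fg fm gl] that by blast
qed

lemma norm_sum_scaleR_le:
  fixes v :: "real^'n" and z :: "'n \<Rightarrow> complex"
  assumes "\<And>i. norm (z i) \<le> B"
  shows "norm (\<Sum>i\<in>UNIV. v $ i *\<^sub>R z i) \<le> B * (real CARD('n) * norm v)"
proof -
  have "norm (\<Sum>i\<in>UNIV. v $ i *\<^sub>R z i) \<le> (\<Sum>i\<in>(UNIV :: 'n set). norm v * B)"
    by (rule sum_norm_le) (auto intro!: mult_mono assms component_le_norm_cart)
  then show ?thesis by (simp add: mult_ac)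
qed

lemma multi_deriv_eq_iter:
  obtains ks where "multi_deriv (count_list js) = iter_partial_deriv ks" "count_list ks = count_list js"
proof
  let ?ks = "SOME ks. \<forall>i. count_list ks i = count_list js i"
  show "multi_deriv (count_list js) = iter_partial_deriv ?ks"
    by (simp add: multi_deriv_def fun_eq_iff)
  show "count_list ?ks = count_list js"
    using someI[of "\<lambda>ks. \<forall>i. count_list ks i = count_list js i" js] by (simp add: fun_eq_iff)
qed

text \<open>The continuous distributional derivatives of the transform are its classical ones, so the Schwartz
  norm bounds all of them by \<open>C / (1 + r)\<^sup>t\<close> on the segment from \<open>\<eta>\<close> to \<open>\<eta> + v\<close>. Those of order below \<open>t\<close> vanish
  at \<open>\<eta>\<close>, and integrating \<open>t\<close> times along the segment gains a factor \<open>norm v\<close> each time.\<close>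

lemma vanishing_moments_estimate:
  fixes \<psi> :: "real^'n \<Rightarrow> complex"
  assumes vm: "vanishing_moments Z t \<psi>" and sn: "schwartz_norm (real t) (real t) (fourier \<psi>) < \<infinity>"
  obtains C where "C \<ge> 0" "\<And>\<xi>. norm (fourier \<psi> \<xi>) \<le> C / (1 + norm \<xi>) ^ t"
    "\<And>\<eta> v r. \<eta> \<in> Z \<Longrightarrow> r \<ge> 0 \<Longrightarrow> (\<And>s. 0 \<le> s \<Longrightarrow> s \<le> 1 \<Longrightarrow> r \<le> norm (\<eta> + s *\<^sub>R v))
      \<Longrightarrow> norm (fourier \<psi> (\<eta> + v)) \<le> C * (norm v / (1 + r)) ^ t"
proof -
  let ?F = "fourier \<psi>"
  have int: "integrable lebesgue \<psi>" using vm by (simp add: vanishing_moments_def)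
  have cF: "continuous_on UNIV ?F"
  proof -
    obtain \<psi>' where "integrable lborel \<psi>'" "AE x in lebesgue. \<psi> x = \<psi>' x" "?F = fourier \<psi>'"
      by (rule borel_representative[OF int])
    then show ?thesis using continuous_on_fourier by simp
  qed
  have "\<exists>g. \<forall>\<alpha>. multi_order \<alpha> \<le> t \<longrightarrow> distr_deriv \<alpha> ?F (g \<alpha>) \<and> continuous_on UNIV (g \<alpha>)
      \<and> (multi_order \<alpha> < t \<longrightarrow> (\<forall>\<xi>\<in>Z. g \<alpha> \<xi> = 0))"
    using vm unfolding vanishing_moments_def by (intro choice) blast
  then obtain g where g: "\<And>\<alpha>. multi_order \<alpha> \<le> t \<Longrightarrow> distr_deriv \<alpha> ?F (g \<alpha>)"
    "\<And>\<alpha>. multi_order \<alpha> \<le> t \<Longrightarrow> continuous_on UNIV (g \<alpha>)"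
    "\<And>\<alpha> \<xi>. multi_order \<alpha> < t \<Longrightarrow> \<xi> \<in> Z \<Longrightarrow> g \<alpha> \<xi> = 0"
    by (metis less_imp_le)
  \<comment> \<open>\<open>G js\<close> depends only on the multiindex of \<open>js\<close>, so commuting derivatives is built in\<close>
  define G where "G js = g (count_list js)" for js
  have cG: "continuous_on UNIV (G js)" if "length js \<le> t" for js
    unfolding G_def using that by (intro g) (simp add: multi_order_count_list)
  have leb: "(LINT x|lebesgue. f x * \<phi> x) = (LINT x|lborel. f x * \<phi> x)"
    if "continuous_on UNIV f" "test_function \<phi>" for f \<phi> :: "real^'n \<Rightarrow> complex"
    by (rule integral_completion, unfold measurable_lborel2, rule borel_measurable_continuous_onI)
       (intro continuous_intros that(1) test_function_continuous[OF that(2)])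
  have dG: "(LINT x|lborel. G js x * \<phi> x) = (-1) ^ length js * (LINT x|lborel. ?F x * iter_partial_deriv js \<phi> x)"
    if "length js \<le> t" and \<phi>: "test_function \<phi>" for js \<phi>
  proof -
    have "distr_deriv (count_list js) ?F (G js)"
      unfolding G_def using that by (intro g) (simp add: multi_order_count_list)
    then have "(LINT x|lebesgue. G js x * \<phi> x) = (-1) ^ length js * (LINT x|lebesgue. ?F x * iter_partial_deriv js \<phi> x)"
      using \<phi> unfolding distr_deriv_def by (simp add: multi_order_count_list multi_deriv_count_list)
    then show ?thesis
      unfolding leb[OF cG[OF that(1)] \<phi>] leb[OF cF test_function_iter[OF \<phi>]] .
  qed
  have G0: "G [] = ?F"
    by (rule weak_equality[OF cF cG]) (use dG[of "[]"] in auto)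
  have line: "((\<lambda>s. G js (x + s *\<^sub>R v)) has_vector_derivative (\<Sum>i\<in>UNIV. v $ i *\<^sub>R G (i # js) (x + s *\<^sub>R v))) (at s)"
    if js: "length js < t" for js x v s
  proof (rule weak_derivative_line)
    show "continuous_on UNIV (G js)" "\<And>i. continuous_on UNIV (G (i # js))" using js by (auto intro: cG)
    fix i and \<phi> :: "real^'n \<Rightarrow> complex" assume \<phi>: "test_function \<phi>"
    have "iter_partial_deriv js (partial_deriv i \<phi>) = iter_partial_deriv (js @ [i]) \<phi>" by simp
    also have "\<dots> = iter_partial_deriv (i # js) \<phi>"
      by (rule iter_partial_deriv_cong_count[OF \<phi>]) simp
    finally have "iter_partial_deriv js (partial_deriv i \<phi>) = iter_partial_deriv (i # js) \<phi>" .
    then show "(LINT x|lborel. G (i # js) x * \<phi> x) = - (LINT x|lborel. G js x * partial_deriv i \<phi> x)"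
      using dG[of "i # js", OF _ \<phi>] dG[of js, OF _ test_function_partial_deriv[OF \<phi>, of i]] js by simp
  qed
  have iter: "iter_partial_deriv js ?F = G js" if "length js \<le> t" for js
    using that
  proof (induction js)
    case (Cons i js)
    have "partial_deriv i (G js) x = G (i # js) x" for x
    proof -
      have "((\<lambda>s. G js (x + s *\<^sub>R axis i 1)) has_vector_derivative G (i # js) x) (at 0)"
        using line[of js x "axis i 1" 0] Cons.prems
        by (simp add: axis_def if_distrib[of "\<lambda>c. c *\<^sub>R _"] cong: if_cong)
      then show ?thesis unfolding partial_deriv_def by (rule vector_derivative_at)
    qed
    then show ?case using Cons by auto
  qed (simp add: G0)
  obtain C where C: "C \<ge> 0" "\<And>js x. length js \<le> t \<Longrightarrow> (1 + norm x) ^ t * norm (G js x) \<le> C"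
  proof
    let ?S = "schwartz_norm (real t) (real t) ?F"
    show "enn2real ?S \<ge> 0" by simp
    fix js :: "'n list" and x assume js: "length js \<le> t"
    \<comment> \<open>\<open>multi_deriv\<close> differentiates in some order \<open>ks\<close>, perhaps not that of \<open>js\<close>\<close>
    obtain ks where ks: "multi_deriv (count_list js) = iter_partial_deriv ks" "count_list ks = count_list js"
      by (rule multi_deriv_eq_iter[of js])
    have "length ks = length js"
      unfolding multi_order_count_list[symmetric] ks(2) ..
    moreover have "G ks = G js" unfolding G_def ks(2) ..
    ultimately have md: "multi_deriv (count_list js) ?F = G js" using ks(1) iter[of ks] js by simp
    have "ennreal ((1 + norm x) powr real t * norm (multi_deriv (count_list js) ?F x)) \<le> ?S"
      unfolding schwartz_norm_def
      by (intro SUP_upper2[of x] SUP_upper2[of "count_list js"]) (use js in \<open>auto simp: multi_order_count_list\<close>)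
    then have "ennreal ((1 + norm x) ^ t * norm (G js x)) \<le> ?S"
      unfolding md by (simp add: powr_realpow add_pos_nonneg)
    then have "ennreal ((1 + norm x) ^ t * norm (G js x)) \<le> ennreal (enn2real ?S)"
      using sn by (simp add: ennreal_enn2real_if)
    then show "(1 + norm x) ^ t * norm (G js x) \<le> enn2real ?S"
      by (simp add: ennreal_le_iff)
  qed
  let ?d = "real CARD('n)"
  show thesis
  proof
    show "C * ?d ^ t \<ge> 0" using C(1) by simp
    have d1: "?d ^ t \<ge> 1" by (intro one_le_power) simp
    show "norm (?F \<xi>) \<le> (C * ?d ^ t) / (1 + norm \<xi>) ^ t" for \<xi>
    proof -
      have p: "(1 + norm \<xi>) ^ t > 0" by (simp add: add_pos_nonneg)
      have "norm (?F \<xi>) \<le> C / (1 + norm \<xi>) ^ t"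
        using C(2)[of "[]" \<xi>] p by (simp add: G0 le_divide_eq mult.commute)
      also have "\<dots> \<le> (C * ?d ^ t) / (1 + norm \<xi>) ^ t"
        using p C(1) d1 by (intro divide_right_mono) (auto simp: mult_le_cancel_left1)
      finally show ?thesis .
    qed
    fix \<eta> v :: "real^'n" and r :: real
    assume \<eta>: "\<eta> \<in> Z" and r: "r \<ge> 0" and far: "\<And>s. 0 \<le> s \<Longrightarrow> s \<le> 1 \<Longrightarrow> r \<le> norm (\<eta> + s *\<^sub>R v)"
    define B where "B = C / (1 + r) ^ t"
    have B: "B \<ge> 0" using C(1) r by (simp add: B_def)
    \<comment> \<open>induction on the number \<open>k\<close> of derivatives still missing to order \<open>t\<close>\<close>
    have "norm (G js (\<eta> + s *\<^sub>R v)) \<le> B * (?d * norm v) ^ k"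
      if "length js + k = t" "0 \<le> s" "s \<le> 1" for js k s
      using that
    proof (induction k arbitrary: js s)
      case 0
      have p: "(1 + r) ^ t > 0" using r by simp
      have "(1 + r) ^ t * norm (G js (\<eta> + s *\<^sub>R v)) \<le> (1 + norm (\<eta> + s *\<^sub>R v)) ^ t * norm (G js (\<eta> + s *\<^sub>R v))"
        using far[of s] 0 r by (intro mult_right_mono power_mono) auto
      also have "\<dots> \<le> C" using C(2)[of js] 0 by simp
      finally show ?case using p by (simp add: B_def le_divide_eq mult.commute)
    next
      case (Suc k)
      then have js: "length js < t" by simp
      have z: "G js (\<eta> + 0 *\<^sub>R v) = 0"
        using g(3)[of "count_list js" \<eta>] js \<eta> by (simp add: G_def multi_order_count_list)
      have "norm (G js (\<eta> + s *\<^sub>R v) - G js (\<eta> + 0 *\<^sub>R v)) \<le> (B * (?d * norm v) ^ k * (?d * norm v)) * s"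
      proof (rule vector_derivative_bound[where g="\<lambda>s. G js (\<eta> + s *\<^sub>R v)"])
        fix s' assume s': "0 \<le> s'" "s' \<le> s"
        show "((\<lambda>s. G js (\<eta> + s *\<^sub>R v)) has_vector_derivative (\<Sum>i\<in>UNIV. v $ i *\<^sub>R G (i # js) (\<eta> + s' *\<^sub>R v))) (at s')"
          by (rule line[OF js])
        show "norm (\<Sum>i\<in>UNIV. v $ i *\<^sub>R G (i # js) (\<eta> + s' *\<^sub>R v)) \<le> B * (?d * norm v) ^ k * (?d * norm v)"
          by (rule norm_sum_scaleR_le) (use Suc.IH[of "_ # js" s'] Suc.prems s' in auto)
      qed (use Suc.prems in simp)
      also have "\<dots> \<le> B * (?d * norm v) ^ k * (?d * norm v)"
        using Suc.prems B by (intro mult_left_le) auto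
      finally show ?case using z by (simp add: mult_ac)
    qed
    from this[of "[]" t 1] have "norm (?F (\<eta> + v)) \<le> B * (?d * norm v) ^ t" by (simp add: G0)
    then show "norm (?F (\<eta> + v)) \<le> C * ?d ^ t * (norm v / (1 + r)) ^ t"
      by (simp add: B_def power_mult_distrib power_divide)
  qed
qed

section \<open>The wavelet transform in the Fourier domain\<close>

lemma inner_matrix_vector_transpose: "(A *v x) \<bullet> y = x \<bullet> (transpose A *v y)" for A :: "real^'n^'n"
  by (metis dot_lmul_matrix inner_commute transpose_matrix_vector)

lemma measurable_matrix_vector_mult [measurable]: "(*v) A \<in> borel_measurable borel" for A :: "real^'n^'n"
  by (intro borel_measurable_continuous_onI linear_continuous_on matrix_vector_mul_bounded_linear)

lemma borel_measurable_matrix_vector_mult [measurable (raw)]: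
  fixes f :: "'a \<Rightarrow> real^'n^'n" and g :: "'a \<Rightarrow> real^'n"
  assumes "f \<in> borel_measurable M" "g \<in> borel_measurable M"
  shows "(\<lambda>x. f x *v g x) \<in> borel_measurable M"
  using assms
  by (rule borel_measurable_continuous_Pair)
     (unfold matrix_vector_mult_def, intro continuous_intros)

lemma integrable_lborel_matrix:
  fixes f :: "real^'n \<Rightarrow> complex" and A :: "real^'n^'n"
  assumes A: "invertible A" and f: "integrable lborel f"
  shows "integrable lborel (\<lambda>x. f (A *v x))"
proof -
  have [measurable]: "f \<in> borel_measurable borel" using f by simp
  have d: "\<bar>det A\<bar> > 0" using A by (simp add: invertible_det_nz)
  have "(\<integral>\<^sup>+x. norm (f x) \<partial>lborel) < \<infinity>" using f by (simp add: integrable_iff_bounded)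
  then have "ennreal \<bar>det A\<bar> * (\<integral>\<^sup>+x. norm (f (A *v x)) \<partial>lborel) < \<infinity>"
    by (subst (asm) nn_integral_lborel_matrix[OF A]) simp_all
  then show ?thesis using d by (auto simp: integrable_iff_bounded ennreal_mult_less_top)
qed

lemma fourier_reflected_dilate:
  fixes g :: "real^'n \<Rightarrow> complex"
  assumes h: "invertible h" and g: "integrable lborel g"
  shows "integrable lborel (\<lambda>z. cnj (g (matrix_inv h *v (- z))))"
    and "fourier (\<lambda>z. cnj (g (matrix_inv h *v (- z)))) \<xi> = of_real \<bar>det h\<bar> * cnj (fourier g (transpose h *v \<xi>))"
proof -
  have [measurable]: "g \<in> borel_measurable borel" using g by simp
  have hi: "invertible (matrix_inv h)"
    using matrix_inv_inverse[OF h] unfolding invertible_def by blast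
  have i: "integrable lborel (\<lambda>z. g (- z))" using integrable_lborel_affine[OF _ g, of "-1" 0] by simp
  have neg: "matrix_inv h *v (- z) = - (matrix_inv h *v z)" for z
    using matrix_vector_mult_diff_distrib[of "matrix_inv h" 0 z] by simp
  show int: "integrable lborel (\<lambda>z. cnj (g (matrix_inv h *v (- z))))"
    unfolding neg using integrable_lborel_matrix[OF hi i] by simp
  have "fourier (\<lambda>z. cnj (g (matrix_inv h *v (- z)))) \<xi>
      = (LINT z|lborel. cnj (g (matrix_inv h *v (- z))) * cis (- 2 * pi * (z \<bullet> \<xi>)))"
    by (rule fourier_lborel) measurable
  also have "\<dots> = \<bar>det h\<bar> *\<^sub>R (LINT w|lborel. cnj (g (matrix_inv h *v (- (h *v w)))) * cis (- 2 * pi * ((h *v w) \<bullet> \<xi>)))"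
    by (rule integral_lborel_matrix[OF h]) measurable
  also have "(LINT w|lborel. cnj (g (matrix_inv h *v (- (h *v w)))) * cis (- 2 * pi * ((h *v w) \<bullet> \<xi>)))
      = (LINT w|lborel. cnj (g (- w) * cis (- 2 * pi * ((- w) \<bullet> (transpose h *v \<xi>)))))"
    using matrix_inv_inverse[OF h]
    by (simp add: neg matrix_vector_mul_assoc inner_matrix_vector_transpose cis_cnj)
  also have "\<dots> = cnj (LINT w|lborel. g (- w) * cis (- 2 * pi * ((- w) \<bullet> (transpose h *v \<xi>))))"
    by (rule Bochner_Integration.integral_cnj)
  also have "(LINT w|lborel. g (- w) * cis (- 2 * pi * ((- w) \<bullet> (transpose h *v \<xi>)))) = fourier g (transpose h *v \<xi>)"
    by (subst fourier_lborel, measurable, subst (2) integral_lborel_affine[of "-1" _ 0]) simp_all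
  finally show "fourier (\<lambda>z. cnj (g (matrix_inv h *v (- z)))) \<xi> = of_real \<bar>det h\<bar> * cnj (fourier g (transpose h *v \<xi>))"
    by (simp add: scaleR_conv_of_real)
qed

lemma fourier_convolution:
  fixes u v :: "real^'n \<Rightarrow> complex"
  assumes u: "integrable lborel u" and v: "integrable lborel v"
  shows "integrable lborel (\<lambda>x. LINT y|lborel. u y * v (x - y))"
    and "fourier (\<lambda>x. LINT y|lborel. u y * v (x - y)) \<xi> = fourier u \<xi> * fourier v \<xi>"
proof -
  have [measurable]: "u \<in> borel_measurable borel" "v \<in> borel_measurable borel" using u v by simp_all
  have iv: "integrable lborel (\<lambda>x. v (x - y))" for y
    using integrable_lborel_affine[OF _ v, of 1 "- y"] by simp
  have inorm: "(LINT x|lborel. norm (v (x - y))) = (LINT x|lborel. norm (v x))" for y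
    using integral_lborel_affine[of 1 "\<lambda>x. norm (v x)" "- y"] by simp
  have pair: "integrable (lborel \<Otimes>\<^sub>M lborel) (\<lambda>(y, x). u y * v (x - y) * c x)"
    if [measurable]: "c \<in> borel_measurable borel" and c: "\<And>x. norm (c x) = 1" for c
  proof (rule lborel_pair.Fubini_integrable)
    show "integrable lborel (\<lambda>y. LINT x|lborel. norm (case (y, x) of (y, x) \<Rightarrow> u y * v (x - y) * c x))"
      using u by (simp add: norm_mult c inorm)
    show "AE y in lborel. integrable lborel (\<lambda>x. case (y, x) of (y, x) \<Rightarrow> u y * v (x - y) * c x)"
    proof (intro AE_I2)
      fix y
      have "integrable lborel (\<lambda>x. c x * (u y * v (x - y)))"
        by (rule integrable_bounded_mult[of _ _ _ 1]) (use iv c in simp_all)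
      then show "integrable lborel (\<lambda>x. case (y, x) of (y, x) \<Rightarrow> u y * v (x - y) * c x)"
        by (simp add: ac_simps)
    qed
  qed measurable
  show int: "integrable lborel (\<lambda>x. LINT y|lborel. u y * v (x - y))"
    using lborel_pair.integrable_snd[OF pair[of "\<lambda>_. 1"]] by simp
  have [measurable]: "(\<lambda>x. LINT y|lborel. u y * v (x - y)) \<in> borel_measurable borel" using int by simp
  let ?e = "\<lambda>x. cis (- 2 * pi * (x \<bullet> \<xi>))"
  have "fourier (\<lambda>x. LINT y|lborel. u y * v (x - y)) \<xi> = (LINT x|lborel. LINT y|lborel. u y * v (x - y) * ?e x)"
    by (subst fourier_lborel) simp_all
  also have "\<dots> = (LINT y|lborel. LINT x|lborel. u y * v (x - y) * ?e x)"
    by (rule lborel_pair.Fubini_integral[OF pair]) simp_all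
  also have "\<dots> = (LINT y|lborel. u y * (?e y * fourier v \<xi>))"
  proof (intro Bochner_Integration.integral_cong refl)
    fix y
    have "fourier (\<lambda>x. v (x + (- y))) \<xi> = ?e y * fourier v \<xi>"
      by (subst fourier_translate[OF v]) simp
    moreover have "fourier (\<lambda>x. v (x + (- y))) \<xi> = (LINT x|lborel. v (x - y) * ?e x)"
      by (subst fourier_lborel) simp_all
    ultimately show "(LINT x|lborel. u y * v (x - y) * ?e x) = u y * (?e y * fourier v \<xi>)"
      by (simp add: mult.assoc)
  qed
  also have "\<dots> = fourier u \<xi> * fourier v \<xi>"
    by (subst (2) fourier_lborel) (simp_all add: mult.assoc[symmetric])
  finally show "fourier (\<lambda>x. LINT y|lborel. u y * v (x - y)) \<xi> = fourier u \<xi> * fourier v \<xi>" .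
qed

lemma haar_space: "left_haar_measure H \<mu> \<Longrightarrow> space \<mu> = H"
  using sets_eq_imp_space_eq[of \<mu> "restrict_space borel H"] by (simp add: left_haar_measure_def space_restrict_space)

lemma haar_borel_measurable:
  assumes "left_haar_measure H \<mu>" "continuous_on H f"
  shows "f \<in> borel_measurable \<mu>"
  using borel_measurable_continuous_on_restrict[OF assms(2)] assms(1)
    measurable_cong_sets[of \<mu> "restrict_space borel H" borel borel] by (auto simp: left_haar_measure_def)

text \<open>The group is exhausted by the compact sets on which the norm and the inverse of the determinant are bounded.\<close>

lemma haar_sigma_finite:
  fixes H :: "(real^'n^'n) set"
  assumes H: "closed_matrix_group H" and \<mu>: "left_haar_measure H \<mu>"
  shows "sigma_finite_measure \<mu>"
proof
  obtain T where T: "closed T" "H = {A. invertible A} \<inter> T"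
    using H unfolding closed_matrix_group_def closedin_closed by auto
  define K where "K n = {A. norm A \<le> real n} \<inter> {A. 1 / real (Suc n) \<le> \<bar>det A\<bar>} \<inter> T" for n
  have "closed {A :: real^'n^'n. 1 / real (Suc n) \<le> \<bar>det A\<bar>}" for n
    by (intro closed_Collect_le continuous_intros continuous_on_det)
  moreover have "{A :: real^'n^'n. norm A \<le> real n} = cball 0 (real n)" for n by auto
  ultimately have cK: "compact (K n)" for n
    unfolding K_def using T(1) by (simp add: compact_Int_closed)
  have KH: "K n \<subseteq> H" for n
  proof
    fix A assume A: "A \<in> K n"
    have "0 < 1 / real (Suc n)" by simp
    then have "\<bar>det A\<bar> > 0" using A unfolding K_def by (blast intro: less_le_trans)
    then show "A \<in> H" using A T by (auto simp: K_def invertible_det_nz)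
  qed
  have KS: "K n \<in> sets \<mu>" for n
    using KH[of n] compact_imp_closed[OF cK[of n]] \<mu>
    by (auto simp: left_haar_measure_def sets_restrict_space image_iff intro!: bexI[of _ "K n"])
  have "\<Union>(range K) = H"
  proof (intro equalityI subsetI)
    fix A assume A: "A \<in> H"
    then have d: "\<bar>det A\<bar> > 0" using closed_matrix_groupD(7)[OF H A] by simp
    obtain n where n: "max (norm A) (1 / \<bar>det A\<bar>) \<le> real n" using real_arch_simple by blast
    then have "1 \<le> real (Suc n) * \<bar>det A\<bar>"
      using d by (simp add: divide_le_eq distrib_right add_increasing)
    then have "1 / real (Suc n) \<le> \<bar>det A\<bar>" by (simp add: divide_le_eq mult.commute del: of_nat_Suc)
    then have "A \<in> K n" using A T n by (simp add: K_def)
    then show "A \<in> \<Union>(range K)" by blast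
  qed (use KH in blast)
  moreover have "emeasure \<mu> (K n) < \<infinity>" for n
    using \<mu> cK[of n] KH[of n] unfolding left_haar_measure_def by blast
  ultimately show "\<exists>A. countable A \<and> A \<subseteq> sets \<mu> \<and> \<Union>A = space \<mu> \<and> (\<forall>a\<in>A. emeasure \<mu> a \<noteq> \<infinity>)"
    unfolding haar_space[OF \<mu>] using KS by (intro exI[of _ "range K"]) (simp add: image_subset_iff less_top)
qed

lemma haar_left_invariant:
  fixes H :: "(real^'n^'n) set"
  assumes H: "closed_matrix_group H" and \<mu>: "left_haar_measure H \<mu>" and g: "g \<in> H"
    and f: "f \<in> borel_measurable \<mu>"
  shows "(\<integral>\<^sup>+h. f (g ** h) \<partial>\<mu>) = (\<integral>\<^sup>+h. f h \<partial>\<mu>)"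
proof -
  have sp: "space \<mu> = H" by (rule haar_space[OF \<mu>])
  have gi: "matrix_inv g \<in> H" by (rule closed_matrix_groupD(3)[OF H g])
  have "(\<lambda>h. g ** h) \<in> borel_measurable \<mu>"
    by (rule haar_borel_measurable[OF \<mu> linear_continuous_on[OF matrix_mult.bounded_linear_right]])
  then have m: "(\<lambda>h. g ** h) \<in> measurable \<mu> \<mu>"
    using \<mu> closed_matrix_groupD(2)[OF H g] sp
    by (subst measurable_cong_sets[of \<mu> \<mu> \<mu> "restrict_space borel H"])
       (auto simp: left_haar_measure_def intro!: measurable_restrict_space2)
  have "distr \<mu> \<mu> (\<lambda>h. g ** h) = \<mu>"
  proof (rule measure_eqI)
    fix B assume "B \<in> sets (distr \<mu> \<mu> (\<lambda>h. g ** h))"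
    then have B: "B \<in> sets \<mu>" by simp
    have BH: "B \<subseteq> H" using sets.sets_into_space[OF B] sp by simp
    have "(\<lambda>h. g ** h) -` B \<inter> space \<mu> = (\<lambda>h. matrix_inv g ** h) ` B"
    proof (intro equalityI subsetI)
      fix h assume h: "h \<in> (\<lambda>h. g ** h) -` B \<inter> space \<mu>"
      then have "h = matrix_inv g ** (g ** h)"
        using closed_matrix_groupD(6)[OF H g] by (simp add: matrix_mul_assoc)
      then show "h \<in> (\<lambda>h. matrix_inv g ** h) ` B" using h by blast
    next
      fix h assume "h \<in> (\<lambda>h. matrix_inv g ** h) ` B"
      then obtain b where b: "b \<in> B" "h = matrix_inv g ** b" by blast
      then have "g ** h = b" using closed_matrix_groupD(5)[OF H g] by (simp add: matrix_mul_assoc)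
      moreover have "h \<in> H" using b BH closed_matrix_groupD(2)[OF H gi] by blast
      ultimately show "h \<in> (\<lambda>h. g ** h) -` B \<inter> space \<mu>" using b sp by simp
    qed
    then show "emeasure (distr \<mu> \<mu> (\<lambda>h. g ** h)) B = emeasure \<mu> B"
      using \<mu> gi B by (simp add: emeasure_distr[OF m B] left_haar_measure_def)
  qed simp
  then have "(\<integral>\<^sup>+h. f h \<partial>\<mu>) = (\<integral>\<^sup>+h. f h \<partial>distr \<mu> \<mu> (\<lambda>h. g ** h))" by simp
  also have "\<dots> = (\<integral>\<^sup>+h. f (g ** h) \<partial>\<mu>)" by (rule nn_integral_distr[OF m]) (simp add: f)
  finally show ?thesis by simp
qed

text \<open>A complete measure space does not see changes on null sets.\<close>

lemma completion_borel_measurable_AE: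
  fixes f g :: "'a \<Rightarrow> 'b::topological_space"
  assumes g: "g \<in> borel_measurable (completion M)" and ae: "AE x in completion M. f x = g x"
  shows "f \<in> borel_measurable (completion M)"
proof (rule measurableI)
  fix S :: "'b set" assume S: "S \<in> sets borel"
  show "f -` S \<inter> space (completion M) \<in> sets (completion M)"
  proof (rule completion.in_sets_AE)
    show "AE x in completion M. x \<in> g -` S \<inter> space (completion M) \<longleftrightarrow> x \<in> f -` S \<inter> space (completion M)"
      using ae by eventually_elim simp
    show "g -` S \<inter> space (completion M) \<in> sets (completion M)" by (rule measurable_sets[OF g S])
  qed blast
qed simp

lemma AE_lebesgue_affine:
  fixes P :: "real^'n \<Rightarrow> bool" and h :: "real^'n^'n"
  assumes h: "invertible h" and P: "AE x in lebesgue. P x"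
  shows "AE y in lebesgue. P (matrix_inv h *v (y - x))"
proof -
  define N where "N = {z. \<not> P z}"
  have "N \<in> null_sets lebesgue"
    using P unfolding completion.AE_iff_null_sets by (simp add: N_def)
  then have "negligible N" by (simp add: negligible_iff_null_sets)
  then have "negligible ((*v) h ` N)"
    using matrix_image_measure[of h] unfolding negligible_iff_measure by (metis mult_zero_right)
  then have "negligible ((+) x ` (*v) h ` N)" by (rule negligible_translation)
  then have "AE y in lebesgue. y \<notin> (+) x ` (*v) h ` N"
    by (simp add: AE_not_in negligible_iff_null_sets)
  then show ?thesis
  proof eventually_elim
    case (elim y)
    show ?case
    proof (rule ccontr)
      assume "\<not> P (matrix_inv h *v (y - x))"
      then have "matrix_inv h *v (y - x) \<in> N" by (simp add: N_def)
      moreover have "y = x + h *v (matrix_inv h *v (y - x))"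
        using matrix_inv_inverse[OF h] by (simp add: matrix_vector_mul_assoc)
      ultimately show False using elim by blast
    qed
  qed
qed

lemma wavelet_transform_eq:
  fixes \<psi> g :: "real^'n \<Rightarrow> complex"
  assumes h: "invertible h" and ae: "AE x in lebesgue. \<psi> x = g x" and g [measurable]: "g \<in> borel_measurable borel"
  shows "L2_inner \<psi> (quasi_regular x h \<psi>)
    = of_real (\<bar>det h\<bar> powr (-1/2)) * (LINT y|lborel. g y * cnj (g (matrix_inv h *v (y - x))))"
proof -
  let ?c = "complex_of_real (\<bar>det h\<bar> powr (-1/2))"
  let ?F = "\<lambda>y. ?c * (g y * cnj (g (matrix_inv h *v (y - x))))"
  have m: "?F \<in> borel_measurable lborel" by measurable
  have ml: "?F \<in> borel_measurable lebesgue" by (rule measurable_completion[OF m])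
  have eq: "AE y in lebesgue. \<psi> y * cnj (quasi_regular x h \<psi> y) = ?F y"
    using ae AE_lebesgue_affine[OF h ae, of x] by eventually_elim (simp add: quasi_regular_def)
  have "L2_inner \<psi> (quasi_regular x h \<psi>) = (LINT y|lebesgue. ?F y)"
    unfolding L2_inner_def
    by (rule integral_cong_AE[OF completion_borel_measurable_AE[OF ml eq] ml eq])
  also have "\<dots> = (LINT y|lborel. ?F y)" by (rule integral_completion[OF m])
  finally show ?thesis by simp
qed

lemma norm_powr_2: "norm z powr 2 = (norm z)\<^sup>2"
  by (cases "norm z = 0") (simp_all add: powr_numeral)

text \<open>For fixed \<open>h\<close> the matrix coefficient is, as a function of \<open>x\<close>, the convolution of \<open>g\<close> with a reflected and
  dilated copy of its conjugate. Its transform is \<open>|det h| fourier g \<xi> cnj (fourier g (h\<^sup>T\<xi>))\<close>, to which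
  Plancherel applies.\<close>

lemma wavelet_transform_slice:
  fixes g :: "real^'n \<Rightarrow> complex"
  assumes h: "invertible h" and g: "integrable lborel g"
  shows "(\<integral>\<^sup>+x. ennreal ((norm (of_real (\<bar>det h\<bar> powr (-1/2)) * (LINT y|lborel. g y * cnj (g (matrix_inv h *v (y - x))))))\<^sup>2) \<partial>lborel)
    \<le> ennreal \<bar>det h\<bar> * (\<integral>\<^sup>+\<xi>. ennreal ((norm (fourier g \<xi>))\<^sup>2) * ennreal ((norm (fourier g (transpose h *v \<xi>)))\<^sup>2) \<partial>lborel)"
proof -
  have d: "\<bar>det h\<bar> > 0" using h by (simp add: invertible_det_nz)
  have [measurable]: "g \<in> borel_measurable borel" "fourier g \<in> borel_measurable borel"
    using g fourier_measurable by simp_all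
  define \<phi> where "\<phi> z = cnj (g (matrix_inv h *v (- z)))" for z
  have i\<phi>: "integrable lborel \<phi>" unfolding \<phi>_def by (rule fourier_reflected_dilate(1)[OF h g])
  define C where "C x = (LINT y|lborel. g y * \<phi> (x - y))" for x
  have iC: "integrable lborel C" unfolding C_def by (rule fourier_convolution(1)[OF g i\<phi>])
  have [measurable]: "C \<in> borel_measurable borel" using iC by simp
  have fC: "fourier C \<xi> = fourier g \<xi> * (of_real \<bar>det h\<bar> * cnj (fourier g (transpose h *v \<xi>)))" for \<xi>
    unfolding C_def fourier_convolution(2)[OF g i\<phi>] unfolding \<phi>_def fourier_reflected_dilate(2)[OF h g] ..
  have C: "C x = (LINT y|lborel. g y * cnj (g (matrix_inv h *v (y - x))))" for x
    by (simp add: C_def \<phi>_def)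
  have p: "(\<bar>det h\<bar> powr (-1/2))\<^sup>2 = 1 / \<bar>det h\<bar>"
  proof -
    have "(\<bar>det h\<bar> powr (-1/2))\<^sup>2 = \<bar>det h\<bar> powr ((-1/2) + (-1/2))"
      unfolding power2_eq_square by (rule powr_add[symmetric])
    also have "\<dots> = \<bar>det h\<bar> powr (-1)" by simp
    also have "\<dots> = 1 / \<bar>det h\<bar>" using d by (simp add: powr_minus_divide)
    finally show ?thesis .
  qed
  have "(\<integral>\<^sup>+x. ennreal ((norm (of_real (\<bar>det h\<bar> powr (-1/2)) * C x))\<^sup>2) \<partial>lborel)
      = (\<integral>\<^sup>+x. ennreal (1 / \<bar>det h\<bar>) * ennreal ((norm (C x))\<^sup>2) \<partial>lborel)"
  proof (intro nn_integral_cong)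
    fix x
    have "(norm (of_real (\<bar>det h\<bar> powr (-1/2)) * C x))\<^sup>2 = (1 / \<bar>det h\<bar>) * (norm (C x))\<^sup>2"
      unfolding p[symmetric] by (simp add: norm_mult power_mult_distrib)
    then show "ennreal ((norm (of_real (\<bar>det h\<bar> powr (-1/2)) * C x))\<^sup>2) = ennreal (1 / \<bar>det h\<bar>) * ennreal ((norm (C x))\<^sup>2)"
      by (simp add: ennreal_mult'[symmetric])
  qed
  also have "\<dots> = ennreal (1 / \<bar>det h\<bar>) * (\<integral>\<^sup>+x. ennreal ((norm (C x))\<^sup>2) \<partial>lborel)"
    by (rule nn_integral_cmult) measurable
  also have "\<dots> \<le> ennreal (1 / \<bar>det h\<bar>) * (\<integral>\<^sup>+\<xi>. ennreal ((norm (fourier C \<xi>))\<^sup>2) \<partial>lborel)"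
    by (intro mult_left_mono plancherel_le[OF iC]) simp
  also have "\<dots> = (\<integral>\<^sup>+\<xi>. ennreal (1 / \<bar>det h\<bar>) * ennreal ((norm (fourier C \<xi>))\<^sup>2) \<partial>lborel)"
    using fourier_measurable[OF iC] by (intro nn_integral_cmult[symmetric]) measurable
  also have "\<dots> = (\<integral>\<^sup>+\<xi>. ennreal \<bar>det h\<bar> * (ennreal ((norm (fourier g \<xi>))\<^sup>2) * ennreal ((norm (fourier g (transpose h *v \<xi>)))\<^sup>2)) \<partial>lborel)"
  proof (intro nn_integral_cong)
    fix \<xi>
    have "1 / \<bar>det h\<bar> * (norm (fourier C \<xi>))\<^sup>2
        = \<bar>det h\<bar> * ((norm (fourier g \<xi>))\<^sup>2 * (norm (fourier g (transpose h *v \<xi>)))\<^sup>2)"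
      using d by (simp add: fC norm_mult power_mult_distrib power2_eq_square)
    then show "ennreal (1 / \<bar>det h\<bar>) * ennreal ((norm (fourier C \<xi>))\<^sup>2)
        = ennreal \<bar>det h\<bar> * (ennreal ((norm (fourier g \<xi>))\<^sup>2) * ennreal ((norm (fourier g (transpose h *v \<xi>)))\<^sup>2))"
      by (simp add: ennreal_mult'[symmetric])
  qed
  also have "\<dots> = ennreal \<bar>det h\<bar> * (\<integral>\<^sup>+\<xi>. ennreal ((norm (fourier g \<xi>))\<^sup>2) * ennreal ((norm (fourier g (transpose h *v \<xi>)))\<^sup>2) \<partial>lborel)"
    by (rule nn_integral_cmult) measurable
  finally show ?thesis unfolding C .
qed

text \<open>Integrating the slices over the group and exchanging the integrals leaves
  \<open>\<integral>|fourier \<psi> \<xi>|\<^sup>2 \<integral>|fourier \<psi> (h\<^sup>T\<xi>)|\<^sup>2 dh d\<xi>\<close>. The inner integral does not depend on \<open>\<xi>\<close>: writing \<open>\<xi> = k\<^sup>T\<xi>\<^sub>0\<close>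
  on the orbit, which has full measure, \<open>h\<^sup>T\<xi> = (kh)\<^sup>T\<xi>\<^sub>0\<close> and left invariance removes \<open>k\<close>.\<close>

lemma admissible_vectorI:
  fixes H :: "(real^'n^'n) set" and \<psi> :: "real^'n \<Rightarrow> complex"
  assumes H: "closed_matrix_group H" and \<mu>: "left_haar_measure H \<mu>"
    and Orb: "open_dual_orbit H \<O>" and \<xi>0: "\<xi>0 \<in> \<O>"
    and int: "integrable lebesgue \<psi>" and nz: "\<not> (AE x in lebesgue. \<psi> x = 0)"
    and sq: "(\<integral>\<^sup>+\<xi>. ennreal ((norm (fourier \<psi> \<xi>))\<^sup>2) \<partial>lborel) < \<infinity>"
    and fin: "(\<integral>\<^sup>+h. ennreal ((norm (fourier \<psi> (transpose h *v \<xi>0)))\<^sup>2) \<partial>\<mu>) < \<infinity>"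
  shows "admissible_vector \<mu> \<psi>"
proof -
  obtain g where g: "integrable lborel g" and ae: "AE x in lebesgue. \<psi> x = g x" and fg: "fourier \<psi> = fourier g"
    by (rule borel_representative[OF int])
  have gm [measurable]: "g \<in> borel_measurable borel" using g by simp
  have Fm [measurable]: "fourier g \<in> borel_measurable borel" by (rule fourier_measurable[OF g])
  interpret S: sigma_finite_measure \<mu> by (rule haar_sigma_finite[OF H \<mu>])
  interpret P: pair_sigma_finite lborel \<mu> ..
  have sp: "space \<mu> = H" by (rule haar_space[OF \<mu>])
  have [measurable]: "(\<lambda>h. h) \<in> borel_measurable \<mu>" "det \<in> borel_measurable \<mu>" "matrix_inv \<in> borel_measurable \<mu>"
    using closed_matrix_groupD(4)[OF H]
    by (auto intro!: haar_borel_measurable[OF \<mu>] continuous_on_id continuous_on_det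
        continuous_on_subset[OF continuous_on_matrix_inv])
  have tm [measurable]: "transpose \<in> borel_measurable \<mu>"
    by (rule haar_borel_measurable[OF \<mu>])
       (unfold Finite_Cartesian_Product.transpose_def, intro continuous_intros)
  let ?f = "\<lambda>\<xi>. ennreal ((norm (fourier g \<xi>))\<^sup>2)"
  let ?W = "\<lambda>x h. of_real (\<bar>det h\<bar> powr (-1/2)) * (LINT y|lborel. g y * cnj (g (matrix_inv h *v (y - x))))"
  have L2: "in_Lp 2 lebesgue \<psi>"
  proof -
    have gl: "g \<in> borel_measurable lebesgue" by (rule measurable_completion) simp
    have m: "\<psi> \<in> borel_measurable lebesgue" by (rule completion_borel_measurable_AE[OF gl ae])
    have "(\<integral>\<^sup>+x. ennreal ((norm (g x))\<^sup>2) \<partial>lborel) < \<infinity>"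
      using plancherel_le[OF g] sq unfolding fg by (rule le_less_trans)
    then have "integrable lborel (\<lambda>x. (norm (g x))\<^sup>2)" by (intro integrableI_nonneg) auto
    then have ig: "integrable lebesgue (\<lambda>x. (norm (g x))\<^sup>2)" by (simp add: integrable_completion)
    have ae2: "AE x in lebesgue. (norm (g x))\<^sup>2 = norm (\<psi> x) powr 2"
      using ae by eventually_elim (simp add: norm_powr_2)
    have m2: "(\<lambda>x. norm (\<psi> x) powr 2) \<in> borel_measurable lebesgue" using m by measurable
    have "integrable lebesgue (\<lambda>x. norm (\<psi> x) powr 2)"
      using ig integrable_cong_AE[OF borel_measurable_integrable[OF ig] m2 ae2] by simp
    then show ?thesis using m by (simp add: in_Lp_def)
  qed
  have W_eq: "L2_inner \<psi> (quasi_regular x h \<psi>) = ?W x h" if "h \<in> H" for x h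
    by (rule wavelet_transform_eq[OF closed_matrix_groupD(4)[OF H that] ae gm])
  have Wm [measurable]: "(\<lambda>(x, h). ?W x h) \<in> borel_measurable (lborel \<Otimes>\<^sub>M \<mu>)" by measurable
  have total: "(\<integral>\<^sup>+p. ennreal ((norm (case p of (x, h) \<Rightarrow> ?W x h))\<^sup>2) \<partial>affine_haar_measure \<mu>) < \<infinity>"
  proof -
    have orb: "dual_orbit H \<xi>0 = \<O>" by (rule open_dual_orbit_eq[OF H Orb \<xi>0])
    define c where "c = (\<integral>\<^sup>+h. ?f (transpose h *v \<xi>0) \<partial>\<mu>)"
    \<comment> \<open>left invariance makes the inner integral constant on the orbit\<close>
    have inner: "(\<integral>\<^sup>+h. ?f (transpose h *v \<xi>) \<partial>\<mu>) = c" if \<xi>: "\<xi> \<in> \<O>" for \<xi>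
    proof -
      obtain k where k: "k \<in> H" "\<xi> = transpose k *v \<xi>0" using \<xi> orb by (auto simp: dual_orbit_def)
      have "(\<integral>\<^sup>+h. ?f (transpose h *v \<xi>) \<partial>\<mu>) = (\<integral>\<^sup>+h. ?f (transpose (k ** h) *v \<xi>0) \<partial>\<mu>)"
        by (simp add: k(2) transpose_apply_mult)
      also have "\<dots> = c"
        unfolding c_def by (rule haar_left_invariant[OF H \<mu> k(1)]) measurable
      finally show ?thesis .
    qed
    have "- \<O> \<in> null_sets lebesgue" using Orb by (simp add: open_dual_orbit_def)
    then have "AE \<xi> in lebesgue. \<xi> \<notin> - \<O>" by (rule AE_not_in)
    then have aeO: "AE \<xi> in lborel. \<xi> \<in> \<O>" by (simp add: AE_completion_iff)
    have "(\<integral>\<^sup>+p. ennreal ((norm (case p of (x, h) \<Rightarrow> ?W x h))\<^sup>2) \<partial>affine_haar_measure \<mu>)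
        = (\<integral>\<^sup>+p. (case p of (x, h) \<Rightarrow> ennreal (1 / \<bar>det h\<bar>) * ennreal ((norm (?W x h))\<^sup>2)) \<partial>(lborel \<Otimes>\<^sub>M \<mu>))"
      unfolding affine_haar_measure_def
      by (subst nn_integral_density) (auto simp: split_beta intro!: nn_integral_cong)
    also have "\<dots> = (\<integral>\<^sup>+h. \<integral>\<^sup>+x. ennreal (1 / \<bar>det h\<bar>) * ennreal ((norm (?W x h))\<^sup>2) \<partial>lborel \<partial>\<mu>)"
      by (subst P.nn_integral_snd[symmetric]) auto
    also have "\<dots> \<le> (\<integral>\<^sup>+h. \<integral>\<^sup>+\<xi>. ?f \<xi> * ?f (transpose h *v \<xi>) \<partial>lborel \<partial>\<mu>)"
    proof (rule nn_integral_mono)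
      fix h assume "h \<in> space \<mu>"
      then have h: "h \<in> H" using sp by simp
      have d: "\<bar>det h\<bar> > 0" using closed_matrix_groupD(7)[OF H h] by simp
      have "(\<integral>\<^sup>+x. ennreal (1 / \<bar>det h\<bar>) * ennreal ((norm (?W x h))\<^sup>2) \<partial>lborel)
          = ennreal (1 / \<bar>det h\<bar>) * (\<integral>\<^sup>+x. ennreal ((norm (?W x h))\<^sup>2) \<partial>lborel)"
        by (rule nn_integral_cmult) measurable
      also have "\<dots> \<le> ennreal (1 / \<bar>det h\<bar>) * (ennreal \<bar>det h\<bar> * (\<integral>\<^sup>+\<xi>. ?f \<xi> * ?f (transpose h *v \<xi>) \<partial>lborel))"
        by (intro mult_left_mono wavelet_transform_slice[OF closed_matrix_groupD(4)[OF H h] g]) simp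
      also have "\<dots> = (\<integral>\<^sup>+\<xi>. ?f \<xi> * ?f (transpose h *v \<xi>) \<partial>lborel)"
        using d by (simp add: mult.assoc[symmetric] ennreal_mult'[symmetric])
      finally show "(\<integral>\<^sup>+x. ennreal (1 / \<bar>det h\<bar>) * ennreal ((norm (?W x h))\<^sup>2) \<partial>lborel)
          \<le> (\<integral>\<^sup>+\<xi>. ?f \<xi> * ?f (transpose h *v \<xi>) \<partial>lborel)" .
    qed
    also have "\<dots> = (\<integral>\<^sup>+\<xi>. \<integral>\<^sup>+h. ?f \<xi> * ?f (transpose h *v \<xi>) \<partial>\<mu> \<partial>lborel)"
      by (rule P.Fubini') measurable
    also have "\<dots> = (\<integral>\<^sup>+\<xi>. ?f \<xi> * c \<partial>lborel)"
    proof (rule nn_integral_cong_AE)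
      show "AE \<xi> in lborel. (\<integral>\<^sup>+h. ?f \<xi> * ?f (transpose h *v \<xi>) \<partial>\<mu>) = ?f \<xi> * c"
        using aeO by eventually_elim (simp add: nn_integral_cmult inner)
    qed
    also have "\<dots> = (\<integral>\<^sup>+\<xi>. ?f \<xi> \<partial>lborel) * c"
      by (rule nn_integral_multc) measurable
    also have "\<dots> < \<infinity>" using sq fin unfolding fg c_def by (simp add: ennreal_mult_less_top)
    finally show ?thesis .
  qed
  have sets_eq: "sets (affine_haar_measure \<mu>) = sets (lborel \<Otimes>\<^sub>M \<mu>)" by (simp add: affine_haar_measure_def)
  have space_eq: "space (affine_haar_measure \<mu>) = UNIV \<times> H"
    by (simp add: affine_haar_measure_def space_pair_measure sp)
  have Wm': "(\<lambda>(x, h). ?W x h) \<in> borel_measurable (affine_haar_measure \<mu>)"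
    using Wm measurable_cong_sets[OF sets_eq refl] by blast
  have iW: "integrable (affine_haar_measure \<mu>) (\<lambda>p. norm (case p of (x, h) \<Rightarrow> ?W x h) powr 2)"
    unfolding norm_powr_2 using total by (intro integrableI_nonneg) (use Wm' in auto)
  have eq: "(case p of (x, h) \<Rightarrow> L2_inner \<psi> (quasi_regular x h \<psi>)) = (case p of (x, h) \<Rightarrow> ?W x h)"
    if "p \<in> space (affine_haar_measure \<mu>)" for p
    using that W_eq by (auto simp: space_eq)
  have "in_Lp 2 (affine_haar_measure \<mu>) (\<lambda>(x, h). L2_inner \<psi> (quasi_regular x h \<psi>))"
    unfolding in_Lp_def
  proof
    show "(\<lambda>(x, h). L2_inner \<psi> (quasi_regular x h \<psi>)) \<in> borel_measurable (affine_haar_measure \<mu>)"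
      by (rule measurable_cong[THEN iffD2, OF eq Wm'])
    show "integrable (affine_haar_measure \<mu>) (\<lambda>p. norm (case p of (x, h) \<Rightarrow> L2_inner \<psi> (quasi_regular x h \<psi>)) powr 2)"
      using iW by (subst Bochner_Integration.integrable_cong[OF refl arg_cong[where f="\<lambda>z. norm z powr 2", OF eq]])
  qed
  then show ?thesis using L2 nz by (simp add: admissible_vector_def)
qed

section \<open>Decay estimates and admissible vectors\<close>

text \<open>A product of one-dimensional integrals dominates, since \<open>1 + |x| \<ge> 1 + |x\<^sub>b|\<close> for every coordinate; the
  exponent \<open>d + 1\<close> is distributed evenly over the \<open>d\<close> coordinates.\<close>

lemma nn_integral_decay_finite:
  assumes "real t > real CARD('n) / 2 + 1"
  shows "(\<integral>\<^sup>+x. ennreal (1 / (1 + norm (x :: real^'n)) ^ (2 * t)) \<partial>lborel) < \<infinity>"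
proof -
  let ?d = "CARD('n)"
  have t: "2 * t \<ge> ?d + 1" using assms by linarith
  have "(\<integral>\<^sup>+x. ennreal (1 / (1 + norm (x :: real^'n)) ^ (2 * t)) \<partial>lborel)
      \<le> (\<integral>\<^sup>+x. (\<Prod>b\<in>Basis. ennreal ((1 + \<bar>(x :: real^'n) \<bullet> b\<bar>) powr (- (1 + 1 / real ?d)))) \<partial>lborel)"
  proof (rule nn_integral_mono)
    fix x :: "real^'n"
    have x1: "1 + norm x \<ge> 1" by simp
    have "1 / (1 + norm x) ^ (2 * t) \<le> 1 / (1 + norm x) ^ (?d + 1)"
      using t by (intro divide_left_mono power_increasing mult_pos_pos zero_less_power) (auto simp: add_pos_nonneg)
    also have "\<dots> = (1 + norm x) powr (- real (?d + 1))"
      by (simp add: powr_minus powr_realpow add_pos_nonneg divide_inverse del: of_nat_add of_nat_Suc power_Suc)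
    also have "\<dots> = (\<Prod>b\<in>(Basis :: (real^'n) set). (1 + norm x) powr (- (1 + 1 / real ?d)))"
    proof -
      have y: "1 + norm x > 0" by (simp add: add_pos_nonneg)
      have "(\<Prod>b\<in>(Basis :: (real^'n) set). (1 + norm x) powr (- (1 + 1 / real ?d)))
          = ((1 + norm x) powr (- (1 + 1 / real ?d))) ^ ?d" by simp
      also have "\<dots> = ((1 + norm x) powr (- (1 + 1 / real ?d))) powr real ?d"
        using y by (intro powr_realpow[symmetric]) simp
      also have "\<dots> = (1 + norm x) powr (- (1 + 1 / real ?d) * real ?d)" by (rule powr_powr)
      also have "- (1 + 1 / real ?d) * real ?d = - real (?d + 1)" by (simp add: field_simps)
      finally show ?thesis by (rule sym)
    qed
    also have "\<dots> \<le> (\<Prod>b\<in>Basis. (1 + \<bar>x \<bullet> b\<bar>) powr (- (1 + 1 / real ?d)))"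
    proof -
      have "0 \<le> 1 / real ?d" by simp
      then have q: "- (1 + 1 / real ?d) \<le> 0" by linarith
      show ?thesis
        by (intro prod_mono conjI powr_mono2'[OF q]) (auto simp: Basis_le_norm add_pos_nonneg)
    qed
    finally show "ennreal (1 / (1 + norm x) ^ (2 * t)) \<le> (\<Prod>b\<in>Basis. ennreal ((1 + \<bar>x \<bullet> b\<bar>) powr (- (1 + 1 / real ?d))))"
      by (subst prod_ennreal) (auto intro: ennreal_leI)
  qed
  also have "\<dots> = (\<Prod>b\<in>(Basis :: (real^'n) set). \<integral>\<^sup>+s. ennreal ((1 + \<bar>s\<bar>) powr (- (1 + 1 / real ?d))) \<partial>lborel)"
    by (rule nn_integral_lborel_prod) auto
  also have "\<dots> < \<infinity>"
  proof -
    define p where "p = 1 / real ?d"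
    have p: "p > 0" by (simp add: p_def)
    have half: "(\<integral>\<^sup>+s. ennreal ((1 + s) powr (- (1 + p))) * indicator {0..} s \<partial>lborel) = ennreal (0 - (- (1 / p)))"
    proof (rule nn_integral_FTC_atLeast[where F="\<lambda>s. - ((1 + s) powr (- p)) / p", THEN trans])
      show "((\<lambda>s. - ((1 + s) powr (- p)) / p) has_real_derivative (1 + s) powr (- (1 + p))) (at s)" if "0 \<le> s" for s
        using that p by (auto intro!: derivative_eq_intros simp: add.commute minus_diff_commute)
      have "((\<lambda>s. (1 + s) powr (- p)) \<longlongrightarrow> 0) at_top"
        using p by (intro tendsto_neg_powr filterlim_tendsto_add_at_top[OF tendsto_const] filterlim_ident) auto
      from tendsto_divide[OF tendsto_minus[OF this] tendsto_const, of p]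
      show "((\<lambda>s. - ((1 + s) powr (- p)) / p) \<longlongrightarrow> 0) at_top" using p by simp
    qed auto
    have "(\<integral>\<^sup>+s. ennreal ((1 + \<bar>s\<bar>) powr (- (1 + p))) \<partial>lborel)
        \<le> (\<integral>\<^sup>+s. ennreal ((1 + s) powr (- (1 + p))) * indicator {0..} s
            + ennreal ((1 + (0 + (-1) *\<^sub>R s)) powr (- (1 + p))) * indicator {0..} (0 + (-1) *\<^sub>R s) \<partial>lborel)"
      by (intro nn_integral_mono) (auto simp: indicator_def)
    also have "\<dots> = (\<integral>\<^sup>+s. ennreal ((1 + s) powr (- (1 + p))) * indicator {0..} s \<partial>lborel)
        + (\<integral>\<^sup>+s. ennreal ((1 + (0 + (-1) *\<^sub>R s)) powr (- (1 + p))) * indicator {0..} (0 + (-1) *\<^sub>R s) \<partial>lborel)"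
      by (rule nn_integral_add) measurable
    also have "(\<integral>\<^sup>+s. ennreal ((1 + (0 + (-1) *\<^sub>R s)) powr (- (1 + p))) * indicator {0..} (0 + (-1) *\<^sub>R s) \<partial>lborel)
        = (\<integral>\<^sup>+s. ennreal ((1 + s) powr (- (1 + p))) * indicator {0..} s \<partial>lborel)"
      by (subst (2) nn_integral_lborel_affine[of "-1" _ 0]) simp_all
    finally have "(\<integral>\<^sup>+s. ennreal ((1 + \<bar>s\<bar>) powr (- (1 + p))) \<partial>lborel) < \<infinity>"
      unfolding half by (rule le_less_trans) (simp add: ennreal_plus[symmetric] del: ennreal_plus)
    then show ?thesis
      unfolding p_def[symmetric] by (simp add: power_less_top_ennreal)
  qed
  finally show ?thesis .
qed

text \<open>Since the complement of the orbit is a cone, the nearest point \<open>\<eta>\<close> of \<open>\<xi>\<close> in it is the foot of a perpendicular. By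
  Pythagoras the square root in the auxiliary function is \<open>norm \<eta>\<close>, and no point of the line through \<open>\<eta>\<close> and \<open>\<xi>\<close>
  is closer to the origin than \<open>\<eta>\<close>.\<close>

lemma orbit_aux_bounds:
  fixes H :: "(real^'n^'n) set"
  assumes H: "closed_matrix_group H" and Orb: "open_dual_orbit H \<O>" and \<xi>: "\<xi> \<in> \<O>"
  obtains \<eta> where "\<eta> \<notin> \<O>" "infdist \<xi> (- \<O>) = norm (\<xi> - \<eta>)" "norm (\<xi> - \<eta>) \<le> norm \<xi>"
    "norm \<eta> = sqrt ((norm \<xi>)\<^sup>2 - (norm (\<xi> - \<eta>))\<^sup>2)" "\<And>s. norm \<eta> \<le> norm (\<eta> + s *\<^sub>R (\<xi> - \<eta>))"
proof -
  have cl: "closed (- \<O>)" using Orb by (auto simp: open_dual_orbit_def)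
  have ne: "0 \<in> - \<O>" using zero_not_in_orbit[OF H Orb] by simp
  obtain \<eta> where \<eta>: "\<eta> \<in> - \<O>" "infdist \<xi> (- \<O>) = dist \<xi> \<eta>"
    using infdist_attains_inf[OF cl, of \<xi>] ne by blast
  have near: "norm (\<xi> - \<eta>) \<le> norm (\<xi> - z)" if "z \<in> - \<O>" for z
    using infdist_le[OF that, of \<xi>] \<eta>(2) by (simp add: dist_norm)
  have cone: "c *\<^sub>R \<eta> \<in> - \<O>" for c
    using orbit_complement_cone[OF H Orb, of \<eta> c] \<eta>(1) by simp
  have orth: "\<eta> \<bullet> (\<xi> - \<eta>) = 0"
  proof (cases "\<eta> = 0")
    case False
    define b where "b = \<eta> \<bullet> (\<xi> - \<eta>)"
    define a where "a = \<eta> \<bullet> \<eta>"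
    have a: "a > 0" using False by (simp add: a_def)
    \<comment> \<open>comparison with the orthogonal projection of \<open>\<xi>\<close> to the line of \<open>\<eta>\<close>\<close>
    have "(norm (\<xi> - \<eta>))\<^sup>2 \<le> (norm (\<xi> - (1 + b / a) *\<^sub>R \<eta>))\<^sup>2"
      by (intro power_mono near cone) simp
    also have "\<xi> - (1 + b / a) *\<^sub>R \<eta> = (\<xi> - \<eta>) - (b / a) *\<^sub>R \<eta>" by (simp add: algebra_simps)
    also have "(norm \<dots>)\<^sup>2 = (norm (\<xi> - \<eta>))\<^sup>2 - 2 * (b / a) * b + (b / a)\<^sup>2 * a"
    proof -
      have "(norm (w - k *\<^sub>R \<eta>))\<^sup>2 = (norm w)\<^sup>2 - 2 * k * (\<eta> \<bullet> w) + k\<^sup>2 * (\<eta> \<bullet> \<eta>)" for w k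
        unfolding power2_norm_eq_inner
        by (simp add: inner_diff_left inner_diff_right inner_commute[of w \<eta>] power2_eq_square algebra_simps)
      then show ?thesis by (simp only: a_def b_def)
    qed
    finally have "b\<^sup>2 / a \<le> 0" using a by (simp add: power2_eq_square field_simps)
    then show ?thesis using a by (simp add: b_def divide_le_0_iff)
  qed simp
  have pyth: "(norm (\<eta> + s *\<^sub>R (\<xi> - \<eta>)))\<^sup>2 = (norm \<eta>)\<^sup>2 + s\<^sup>2 * (norm (\<xi> - \<eta>))\<^sup>2" for s
    using orth unfolding power2_norm_eq_inner
    by (simp add: inner_add_left inner_add_right inner_commute power2_eq_square)
  show thesis
  proof
    show "\<eta> \<notin> \<O>" using \<eta>(1) by simp
    show "infdist \<xi> (- \<O>) = norm (\<xi> - \<eta>)" using \<eta>(2) by (simp add: dist_norm)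
    show "norm (\<xi> - \<eta>) \<le> norm \<xi>" using near[OF ne] by simp
    have "(norm \<xi>)\<^sup>2 - (norm (\<xi> - \<eta>))\<^sup>2 = (norm \<eta>)\<^sup>2" using pyth[of 1] by simp
    then show "norm \<eta> = sqrt ((norm \<xi>)\<^sup>2 - (norm (\<xi> - \<eta>))\<^sup>2)" by simp
    show "norm \<eta> \<le> norm (\<eta> + s *\<^sub>R (\<xi> - \<eta>))" for s
      by (rule power2_le_imp_le) (simp_all add: pyth)
  qed
qed

text \<open>For \<open>q = 2\<close> the power of the determinant disappears and the factor \<open>(1 + norm h)\<^bsup>d+1\<^esup>\<close> is at least 1.\<close>

lemma temperate_integral_finite:
  fixes H :: "(real^'n^'n) set" and F :: "real^'n \<Rightarrow> complex"
  assumes H: "closed_matrix_group H" and \<mu>: "left_haar_measure H \<mu>" and Orb: "open_dual_orbit H \<O>"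
    and te: "temperately_embedded H \<mu> \<O> 0 2 (\<lambda>h. 1) l"
    and F: "\<And>\<xi>. \<xi> \<in> \<O> \<Longrightarrow> norm (F \<xi>) \<le> C * orbit_aux \<O> \<xi> ^ l"
  obtains \<xi>0 where "\<xi>0 \<in> \<O>" "(\<integral>\<^sup>+h. ennreal ((norm (F (transpose h *v \<xi>0)))\<^sup>2) \<partial>\<mu>) < \<infinity>"
proof -
  obtain \<xi>0 where \<xi>0: "\<xi>0 \<in> \<O>"
    and L: "in_Lp 2 \<mu> (\<lambda>h. \<bar>det h\<bar> powr (1/2 - 1/2) * (1 + norm h) powr (0 + real CARD('n) + 1)
        * 1 * orbit_aux \<O> (transpose h *v \<xi>0) ^ l)"
    using te unfolding temperately_embedded_def by blast
  let ?G = "\<lambda>h. \<bar>det h\<bar> powr (1/2 - 1/2) * (1 + norm h) powr (0 + real CARD('n) + 1)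
        * 1 * orbit_aux \<O> (transpose h *v \<xi>0) ^ l :: real"
  have iG: "integrable \<mu> (\<lambda>h. norm (?G h) powr 2)" using L by (simp only: in_Lp_def)
  have le: "ennreal ((norm (F (transpose h *v \<xi>0)))\<^sup>2) \<le> ennreal (C\<^sup>2) * ennreal (norm (?G h) powr 2)"
    if h: "h \<in> H" for h
  proof -
    let ?a = "orbit_aux \<O> (transpose h *v \<xi>0) ^ l"
    have inO: "transpose h *v \<xi>0 \<in> \<O>"
      using open_dual_orbit_eq[OF H Orb \<xi>0] h by (auto simp: dual_orbit_def)
    have d: "\<bar>det h\<bar> powr (1/2 - 1/2) = 1" using closed_matrix_groupD(7)[OF H h] by simp
    have one: "1 \<le> (1 + norm h) powr (0 + real CARD('n) + 1)" by (intro ge_one_powr_ge_zero) auto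
    have "norm (F (transpose h *v \<xi>0)) \<le> \<bar>C\<bar> * \<bar>?a\<bar>"
      using order_trans[OF F[OF inO] abs_ge_self] unfolding abs_mult .
    also have "\<dots> \<le> \<bar>C\<bar> * norm (?G h)"
    proof (intro mult_left_mono)
      have "1 * \<bar>?a\<bar> \<le> (1 + norm h) powr (0 + real CARD('n) + 1) * \<bar>?a\<bar>"
        using one by (rule mult_right_mono) simp
      then show "\<bar>?a\<bar> \<le> norm (?G h)" unfolding d by (simp add: abs_mult)
    qed simp
    finally have "(norm (F (transpose h *v \<xi>0)))\<^sup>2 \<le> (\<bar>C\<bar> * norm (?G h))\<^sup>2" by (intro power_mono) auto
    then have "(norm (F (transpose h *v \<xi>0)))\<^sup>2 \<le> C\<^sup>2 * (norm (?G h) powr 2)"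
      unfolding norm_powr_2 power_mult_distrib by simp
    then show ?thesis by (simp only: ennreal_mult'[symmetric] zero_le_power2 ennreal_leI)
  qed
  have "(\<integral>\<^sup>+h. ennreal ((norm (F (transpose h *v \<xi>0)))\<^sup>2) \<partial>\<mu>) \<le> (\<integral>\<^sup>+h. ennreal (C\<^sup>2) * ennreal (norm (?G h) powr 2) \<partial>\<mu>)"
    by (rule nn_integral_mono) (rule le, simp only: haar_space[OF \<mu>])
  also have "\<dots> = ennreal (C\<^sup>2) * (\<integral>\<^sup>+h. ennreal (norm (?G h) powr 2) \<partial>\<mu>)"
    by (rule nn_integral_cmult, rule measurable_compose[OF borel_measurable_integrable[OF iG] measurable_ennreal])
  also have "(\<integral>\<^sup>+h. ennreal (norm (?G h) powr 2) \<partial>\<mu>) = ennreal (LINT h|\<mu>. norm (?G h) powr 2)"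
    by (rule nn_integral_eq_integral[OF iG]) simp
  also have "ennreal (C\<^sup>2) * \<dots> < \<infinity>" by (simp add: ennreal_mult_less_top)
  finally show thesis using that[OF \<xi>0] by blast
qed

lemma square_integrable_if_decay:
  fixes F :: "real^'n \<Rightarrow> complex"
  assumes F: "\<And>\<xi>. norm (F \<xi>) \<le> C / (1 + norm \<xi>) ^ t" and t: "real t > real CARD('n) / 2 + 1"
  shows "(\<integral>\<^sup>+\<xi>. ennreal ((norm (F \<xi>))\<^sup>2) \<partial>lborel) < \<infinity>"
proof -
  have "(\<integral>\<^sup>+\<xi>. ennreal ((norm (F \<xi>))\<^sup>2) \<partial>lborel)
      \<le> (\<integral>\<^sup>+\<xi>. ennreal (C\<^sup>2) * ennreal (1 / (1 + norm (\<xi> :: real^'n)) ^ (2 * t)) \<partial>lborel)"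
  proof (rule nn_integral_mono)
    fix \<xi> :: "real^'n"
    have "(norm (F \<xi>))\<^sup>2 \<le> (C / (1 + norm \<xi>) ^ t)\<^sup>2" by (intro power_mono F) simp
    also have "\<dots> = C\<^sup>2 * (1 / (1 + norm \<xi>) ^ (2 * t))"
      by (simp add: power_divide power_mult[symmetric] mult.commute)
    finally show "ennreal ((norm (F \<xi>))\<^sup>2) \<le> ennreal (C\<^sup>2) * ennreal (1 / (1 + norm \<xi>) ^ (2 * t))"
      by (simp only: ennreal_mult'[symmetric] zero_le_power2 ennreal_leI)
  qed
  also have "\<dots> = ennreal (C\<^sup>2) * (\<integral>\<^sup>+\<xi>. ennreal (1 / (1 + norm (\<xi> :: real^'n)) ^ (2 * t)) \<partial>lborel)"
    by (rule nn_integral_cmult) measurable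
  also have "\<dots> < \<infinity>"
    using nn_integral_decay_finite[OF t] by (simp add: ennreal_mult_less_top)
  finally show ?thesis .
qed

text \<open>Vanishing at the nearest point of the complement bounds \<open>|P \<xi>|\<close> by a multiple of the distance, with
  polynomial growth. Dividing by a high power of \<open>1 + norm \<xi>\<close> leaves a bound by both terms of the minimum
  that defines the auxiliary function.\<close>

lemma polynomial_times_decay:
  fixes H :: "(real^'n^'n) set" and P :: "real^'n \<Rightarrow> real"
  assumes H: "closed_matrix_group H" and Orb: "open_dual_orbit H \<O>"
    and P: "real_polynomial_function P" and P0: "\<And>\<xi>. \<xi> \<notin> \<O> \<Longrightarrow> P \<xi> = 0"
  obtains M C where "\<And>\<xi>. \<xi> \<in> \<O> \<Longrightarrow> \<bar>P \<xi>\<bar> / (1 + norm \<xi>) ^ M \<le> C * orbit_aux \<O> \<xi>"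
proof -
  obtain A K where A: "A \<ge> 0" "\<And>x y. \<bar>P x - P y\<bar> \<le> A * norm (x - y) * (1 + norm x + norm y) ^ K"
    using polynomial_lipschitz[OF P] by blast
  obtain B L where B: "B \<ge> 0" "\<And>x. \<bar>P x\<bar> \<le> B * (1 + norm x) ^ L"
    using polynomial_growth[OF P] by blast
  \<comment> \<open>leaves one spare power of \<open>1 + norm \<xi>\<close> after the growth of order \<open>K\<close> and \<open>L\<close> is absorbed\<close>
  define M where "M = Suc (K + L)"
  define C where "C = A * 2 ^ K + B"
  have "\<bar>P \<xi>\<bar> / (1 + norm \<xi>) ^ M \<le> C * orbit_aux \<O> \<xi>" if \<xi>: "\<xi> \<in> \<O>" for \<xi>
  proof -
    obtain \<eta> where \<eta>: "\<eta> \<notin> \<O>" "infdist \<xi> (- \<O>) = norm (\<xi> - \<eta>)" "norm (\<xi> - \<eta>) \<le> norm \<xi>"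
      "norm \<eta> = sqrt ((norm \<xi>)\<^sup>2 - (norm (\<xi> - \<eta>))\<^sup>2)" "\<And>s. norm \<eta> \<le> norm (\<eta> + s *\<^sub>R (\<xi> - \<eta>))"
      by (rule orbit_aux_bounds[OF H Orb \<xi>]) (rule that; blast)
    have \<eta>\<xi>: "norm \<eta> \<le> norm \<xi>" using \<eta>(5)[of 1] by simp
    define u where "u = 1 + norm \<xi>"
    have u: "u \<ge> 1" by (simp add: u_def)
    define \<delta> where "\<delta> = norm (\<xi> - \<eta>)"
    have \<delta>: "\<delta> \<ge> 0" by (simp add: \<delta>_def)
    have aux: "orbit_aux \<O> \<xi> = min (\<delta> / (1 + norm \<eta>)) (1 / u)"
      unfolding orbit_aux_def \<eta>(2) \<eta>(4)[symmetric] by (simp add: \<delta>_def u_def)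
    have pw: "u ^ j \<le> u ^ M / u" if "j \<le> K + L" for j
      using power_increasing[OF that u] u by (simp add: M_def)
    have uM: "u ^ M > 0" using u by simp
    have 1: "\<bar>P \<xi>\<bar> / u ^ M \<le> (A * 2 ^ K) * (\<delta> / (1 + norm \<eta>))"
    proof -
      have "\<bar>P \<xi>\<bar> \<le> A * \<delta> * (1 + norm \<xi> + norm \<eta>) ^ K" using A(2)[of \<xi> \<eta>] P0[OF \<eta>(1)] by (simp add: \<delta>_def)
      also have "\<dots> \<le> A * \<delta> * (2 * u) ^ K"
        using A(1) \<delta> \<eta>\<xi> by (intro mult_left_mono power_mono) (auto simp: u_def)
      also have "\<dots> = (A * 2 ^ K * \<delta>) * u ^ K" by (simp add: power_mult_distrib mult_ac)
      also have "\<dots> \<le> (A * 2 ^ K * \<delta>) * (u ^ M / u)"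
        using A(1) \<delta> by (intro mult_left_mono pw) auto
      finally have "\<bar>P \<xi>\<bar> / u ^ M \<le> (A * 2 ^ K * \<delta>) / u"
        using uM u by (simp add: divide_le_eq mult_ac)
      also have "\<dots> \<le> (A * 2 ^ K * \<delta>) / (1 + norm \<eta>)"
        using A(1) \<delta> u \<eta>\<xi> by (intro divide_left_mono) (auto simp: u_def add_pos_nonneg)
      finally show ?thesis by simp
    qed
    have 2: "\<bar>P \<xi>\<bar> / u ^ M \<le> B * (1 / u)"
    proof -
      have "\<bar>P \<xi>\<bar> \<le> B * u ^ L" using B(2)[of \<xi>] by (simp add: u_def)
      also have "\<dots> \<le> B * (u ^ M / u)" using B(1) by (intro mult_left_mono pw) auto
      finally show ?thesis using uM u by (simp add: divide_le_eq mult_ac)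
    qed
    have nn: "0 \<le> \<delta> / (1 + norm \<eta>)" "0 \<le> 1 / u" using \<delta> u by auto
    have 3: "(A * 2 ^ K) * (\<delta> / (1 + norm \<eta>)) \<le> C * (\<delta> / (1 + norm \<eta>))" "B * (1 / u) \<le> C * (1 / u)"
      unfolding C_def using A(1) B(1) by (intro mult_right_mono nn, simp)+
    show ?thesis
      unfolding aux u_def[symmetric] using order_trans[OF 1 3(1)] order_trans[OF 2 3(2)]
      by (cases "\<delta> / (1 + norm \<eta>) \<le> 1 / u") (simp_all only: min_def if_True if_False)
  qed
  then show thesis using that by blast
qed

text \<open>The function is \<open>P\<^sup>l\<close>, as a differential operator, applied to a mollifier, where \<open>P\<close> vanishes off the orbit.
  It is nonzero because the transform of the mollifier is 1 at the origin and \<open>P\<close> is nonzero on the ray through \<open>\<xi>\<^sub>0\<close>.\<close>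

lemma test_function_candidate:
  fixes H :: "(real^'n^'n) set"
  assumes H: "closed_matrix_group H" and Orb: "open_dual_orbit H \<O>" and \<xi>0: "\<xi>0 \<in> \<O>"
  obtains \<psi> C where "test_function \<psi>" "\<not> (AE x in lebesgue. \<psi> x = 0)"
    "\<And>\<xi>. \<xi> \<in> \<O> \<Longrightarrow> norm (fourier \<psi> \<xi>) \<le> C * orbit_aux \<O> \<xi> ^ l"
proof -
  obtain P :: "real^'n \<Rightarrow> real" where P: "real_polynomial_function P" "\<And>\<xi>. \<xi> \<notin> \<O> \<Longrightarrow> P \<xi> = 0"
    "\<And>s. P (s *\<^sub>R \<xi>0) = s ^ CARD('n)"
  proof (rule orbit_complement_polynomial[OF H Orb \<xi>0])
    fix P :: "real^'n \<Rightarrow> real"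
    assume *: "real_polynomial_function P" "\<And>\<xi>. \<xi> \<notin> \<O> \<Longrightarrow> P \<xi> = 0" "\<And>s. P (s *\<^sub>R \<xi>0) = s ^ CARD('n)"
    show thesis by (rule that[OF *])
  qed
  obtain M C where MC: "\<And>\<xi>. \<xi> \<in> \<O> \<Longrightarrow> \<bar>P \<xi>\<bar> / (1 + norm \<xi>) ^ M \<le> C * orbit_aux \<O> \<xi>"
    by (rule polynomial_times_decay[OF H Orb P(1)], erule P(2)) (rule that; blast)
  obtain \<rho> :: "real^'n \<Rightarrow> real" where \<rho>: "test_function (\<lambda>x. complex_of_real (\<rho> x))" "(LINT x|lborel. \<rho> x) = 1"
    by (rule mollifier_exists[where 'n='n])
  let ?f = "\<lambda>x. complex_of_real (\<rho> x)"
  have intf: "integrable lborel ?f" by (rule test_function_integrable[OF \<rho>(1)])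
  have "real_polynomial_function (\<lambda>\<xi>. P \<xi> ^ l)" by (rule real_polynomial_function_power[OF P(1)])
  from polynomial_multiplier[OF this \<rho>(1)]
  obtain \<psi> where \<psi>: "test_function \<psi>" "\<And>\<xi>. fourier \<psi> \<xi> = of_real (P \<xi> ^ l) * fourier ?f \<xi>" by blast
  obtain D where D: "D \<ge> 0" "\<And>\<xi>. norm (fourier ?f \<xi>) * (1 + norm \<xi>) ^ (M * l) \<le> D"
    using fourier_test_function_decay[OF \<rho>(1)] by blast
  show thesis
  proof
    show "test_function \<psi>" by (rule \<psi>(1))
    show "\<not> (AE x in lebesgue. \<psi> x = 0)"
    proof
      assume ae: "AE x in lebesgue. \<psi> x = 0"
      have pm: "\<psi> \<in> borel_measurable lebesgue"
        using test_function_integrable[OF \<psi>(1)] by (intro measurable_completion) simp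
      have "fourier \<psi> = fourier (\<lambda>x. 0)" by (rule fourier_cong_AE[OF ae pm]) simp
      then have z: "fourier \<psi> \<xi> = 0" for \<xi> by (simp add: fourier_def)
      \<comment> \<open>hence the transform of the mollifier is nonzero near the origin\<close>
      have f0: "fourier ?f 0 = 1"
      proof -
        have "fourier ?f 0 = (LINT x|lborel. ?f x * cis (- 2 * pi * (x \<bullet> 0)))"
          using borel_measurable_integrable[OF intf] by (intro fourier_lborel) simp
        also have "\<dots> = (LINT x|lborel. ?f x)" by simp
        also have "\<dots> = of_real (LINT x|lborel. \<rho> x)" by (rule integral_complex_of_real)
        finally show ?thesis using \<rho>(2) by simp
      qed
      define s where "s n = inverse (real (Suc n))" for n
      have "(\<lambda>n. s n *\<^sub>R \<xi>0) \<longlonglongrightarrow> 0 *\<^sub>R \<xi>0"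
        unfolding s_def by (intro tendsto_scaleR LIMSEQ_inverse_real_of_nat tendsto_const)
      then have "(\<lambda>n. fourier ?f (s n *\<^sub>R \<xi>0)) \<longlonglongrightarrow> fourier ?f 0"
        using continuous_on_fourier[OF intf]
        by (intro isCont_tendsto_compose[where g="fourier ?f"]) (simp_all add: continuous_on_eq_continuous_at)
      then have lim: "(\<lambda>n. norm (fourier ?f (s n *\<^sub>R \<xi>0))) \<longlonglongrightarrow> 1" unfolding f0 using tendsto_norm by fastforce
      have "eventually (\<lambda>n. norm (fourier ?f (s n *\<^sub>R \<xi>0)) > 0) sequentially"
        by (rule order_tendstoD(1)[OF lim]) simp
      then obtain n where n: "norm (fourier ?f (s n *\<^sub>R \<xi>0)) > 0" by (auto simp: eventually_sequentially)
      moreover have "P (s n *\<^sub>R \<xi>0) \<noteq> 0" unfolding P(3) by (simp add: s_def)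
      ultimately show False using z[of "s n *\<^sub>R \<xi>0"] by (simp add: \<psi>(2))
    qed
    show "norm (fourier \<psi> \<xi>) \<le> (D * C ^ l) * orbit_aux \<O> \<xi> ^ l" if \<xi>: "\<xi> \<in> \<O>" for \<xi>
    proof -
      let ?u = "1 + norm \<xi>"
      have u: "?u > 0" by (simp add: add_pos_nonneg)
      have "norm (fourier \<psi> \<xi>) = (\<bar>P \<xi>\<bar> / ?u ^ M) ^ l * (norm (fourier ?f \<xi>) * ?u ^ (M * l))"
        using u by (simp add: \<psi>(2) norm_mult norm_power power_divide power_mult)
      also have "\<dots> \<le> (C * orbit_aux \<O> \<xi>) ^ l * D"
        using u by (intro mult_mono power_mono MC[OF \<xi>] D(2) zero_le_power)
          (auto intro: order_trans[OF _ MC[OF \<xi>]])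
      finally show ?thesis by (simp add: power_mult_distrib mult_ac)
    qed
  qed
qed

theorem corollary4p3:
  fixes H :: "(real^'n^'n) set" and \<mu> :: "(real^'n^'n) measure"
    and \<O> :: "(real^'n) set" and l :: nat
  assumes "CARD('n) > 1"
    and "left_haar_measure H \<mu>"
    and "admissible_dilation_group H \<mu>"
    and "open_dual_orbit H \<O>"
    and "temperately_embedded H \<mu> \<O> 0 2 (\<lambda>h. 1) l"
  shows "(\<forall>(\<psi> :: real^'n \<Rightarrow> complex) (t :: nat).
            integrable lebesgue \<psi> \<and> \<not> (AE x in lebesgue. \<psi> x = 0) \<and>
            vanishing_moments (- \<O>) t \<psi> \<and> real t > real l + real CARD('n) / 2 + 1 \<and>
            schwartz_norm (real t) (real t) (fourier \<psi>) < \<infinity> \<longrightarrow>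
            admissible_vector \<mu> \<psi>) \<and>
         (\<exists>\<psi>. test_function \<psi> \<and> admissible_vector \<mu> \<psi>)"
proof -
  note \<mu> = assms(2) and Orb = assms(4) and te = assms(5)
  have H: "closed_matrix_group H" using assms(3) by (simp add: admissible_dilation_group_def)
  \<comment> \<open>both parts only have to provide this decay of the Fourier transform\<close>
  have crit: "admissible_vector \<mu> \<psi>"
    if int: "integrable lebesgue \<psi>" and nz: "\<not> (AE x in lebesgue. \<psi> x = 0)"
      and sq: "(\<integral>\<^sup>+\<xi>. ennreal ((norm (fourier \<psi> \<xi>))\<^sup>2) \<partial>lborel) < \<infinity>"
      and F: "\<And>\<xi>. \<xi> \<in> \<O> \<Longrightarrow> norm (fourier \<psi> \<xi>) \<le> C * orbit_aux \<O> \<xi> ^ l" for \<psi> :: "real^'n \<Rightarrow> complex" and C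
  proof -
    obtain \<xi>0 where "\<xi>0 \<in> \<O>" "(\<integral>\<^sup>+h. ennreal ((norm (fourier \<psi> (transpose h *v \<xi>0)))\<^sup>2) \<partial>\<mu>) < \<infinity>"
      by (rule temperate_integral_finite[OF H \<mu> Orb te], erule F) (rule that; blast)
    then show ?thesis by (intro admissible_vectorI[OF H \<mu> Orb _ int nz sq])
  qed
  show ?thesis
  proof (intro conjI allI impI)
    fix \<psi> :: "real^'n \<Rightarrow> complex" and t :: nat
    assume "integrable lebesgue \<psi> \<and> \<not> (AE x in lebesgue. \<psi> x = 0) \<and>
      vanishing_moments (- \<O>) t \<psi> \<and> real t > real l + real CARD('n) / 2 + 1 \<and>
      schwartz_norm (real t) (real t) (fourier \<psi>) < \<infinity>"
    then have int: "integrable lebesgue \<psi>" and nz: "\<not> (AE x in lebesgue. \<psi> x = 0)"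
      and vm: "vanishing_moments (- \<O>) t \<psi>" and t: "real t > real l + real CARD('n) / 2 + 1"
      and sn: "schwartz_norm (real t) (real t) (fourier \<psi>) < \<infinity>" by blast+
    obtain C where C: "C \<ge> 0" and dec: "\<And>\<xi>. norm (fourier \<psi> \<xi>) \<le> C / (1 + norm \<xi>) ^ t"
      and van: "\<And>\<eta> v r. \<eta> \<in> - \<O> \<Longrightarrow> r \<ge> 0 \<Longrightarrow> (\<And>s. 0 \<le> s \<Longrightarrow> s \<le> 1 \<Longrightarrow> r \<le> norm (\<eta> + s *\<^sub>R v))
        \<Longrightarrow> norm (fourier \<psi> (\<eta> + v)) \<le> C * (norm v / (1 + r)) ^ t"
      by (rule vanishing_moments_estimate[OF vm sn]) (rule that; blast)
    have tl: "l \<le> t" using t by linarith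
    have F: "norm (fourier \<psi> \<xi>) \<le> C * orbit_aux \<O> \<xi> ^ l" if \<xi>: "\<xi> \<in> \<O>" for \<xi>
    proof -
      obtain \<eta> where \<eta>: "\<eta> \<notin> \<O>" "infdist \<xi> (- \<O>) = norm (\<xi> - \<eta>)" "norm (\<xi> - \<eta>) \<le> norm \<xi>"
        "norm \<eta> = sqrt ((norm \<xi>)\<^sup>2 - (norm (\<xi> - \<eta>))\<^sup>2)" "\<And>s. norm \<eta> \<le> norm (\<eta> + s *\<^sub>R (\<xi> - \<eta>))"
        by (rule orbit_aux_bounds[OF H Orb \<xi>]) (rule that; blast)
      let ?a = "norm (\<xi> - \<eta>) / (1 + norm \<eta>)" and ?b = "1 / (1 + norm \<xi>)"
      have aux: "orbit_aux \<O> \<xi> = min ?a ?b"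
        unfolding orbit_aux_def \<eta>(2) \<eta>(4)[symmetric] ..
      have a: "norm (fourier \<psi> \<xi>) \<le> C * ?a ^ t"
        using van[of \<eta> "norm \<eta>" "\<xi> - \<eta>"] \<eta>(1,5) by simp
      have b: "norm (fourier \<psi> \<xi>) \<le> C * ?b ^ t"
        using dec[of \<xi>] by (simp add: power_divide)
      have ab: "norm (fourier \<psi> \<xi>) \<le> C * orbit_aux \<O> \<xi> ^ t"
        unfolding aux min_def using a b by (simp only: split: if_split) simp
      have u: "1 + norm \<xi> > 0" "1 + norm \<eta> > 0" by (simp_all add: add_pos_nonneg)
      have b1: "0 \<le> ?b" "?b \<le> 1" using u(1) by (simp_all add: divide_le_eq_1_pos)
      have a0: "0 \<le> ?a" using u(2) by simp
      have "0 \<le> orbit_aux \<O> \<xi>" "orbit_aux \<O> \<xi> \<le> 1"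
        unfolding aux using a0 b1 by (auto simp only: min.bounded_iff min_le_iff_disj)
      then have "orbit_aux \<O> \<xi> ^ t \<le> orbit_aux \<O> \<xi> ^ l" by (intro power_decreasing tl)
      then show ?thesis using ab C by (meson mult_left_mono order_trans)
    qed
    have sq: "(\<integral>\<^sup>+\<xi>. ennreal ((norm (fourier \<psi> \<xi>))\<^sup>2) \<partial>lborel) < \<infinity>"
      by (rule square_integrable_if_decay[OF dec]) (use t in linarith)
    show "admissible_vector \<mu> \<psi>" by (rule crit[OF int nz sq], erule F)
  next
    obtain \<xi>0 where \<xi>0: "\<xi>0 \<in> \<O>" using te unfolding temperately_embedded_def by blast
    obtain \<psi> C where \<psi>: "test_function \<psi>" "\<not> (AE x in lebesgue. \<psi> x = 0)"
      and F: "\<And>\<xi>. \<xi> \<in> \<O> \<Longrightarrow> norm (fourier \<psi> \<xi>) \<le> C * orbit_aux \<O> \<xi> ^ l"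
      by (rule test_function_candidate[OF H Orb \<xi>0]) (rule that; blast)
    have intb: "integrable lborel \<psi>" by (rule test_function_integrable[OF \<psi>(1)])
    have int: "integrable lebesgue \<psi>"
      using intb borel_measurable_integrable[OF intb] by (simp add: integrable_completion)
    obtain D where D: "\<And>\<xi>. norm (fourier \<psi> \<xi>) * (1 + norm \<xi>) ^ (CARD('n) + 2) \<le> D"
      by (rule fourier_test_function_decay[OF \<psi>(1)]) (rule that; blast)
    have "norm (fourier \<psi> \<xi>) \<le> D / (1 + norm \<xi>) ^ (CARD('n) + 2)" for \<xi>
      using D[of \<xi>] by (subst pos_le_divide_eq) (simp_all add: add_pos_nonneg del: power_Suc)
    then have sq: "(\<integral>\<^sup>+\<xi>. ennreal ((norm (fourier \<psi> \<xi>))\<^sup>2) \<partial>lborel) < \<infinity>"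
      by (rule square_integrable_if_decay) simp
    show "\<exists>\<psi>. test_function \<psi> \<and> admissible_vector \<mu> \<psi>"
      by (rule exI[of _ \<psi>], rule conjI[OF \<psi>(1)], rule crit[OF int \<psi>(2) sq], erule F)
  qed
qed

end
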